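(* Let $1\le s<m$ and $c\ge 1$ be integers. Let $S$ be a connected $s$-dimensional smooth embedded submanifold of $\mathbb{R}^{m+c}$ and let $\mathcal{D}\supset TS$ be a smooth distribution of rank $m$ along $S$. Suppose that there exists a (smooth) section $N^{\ast}$ of $\mathcal{D}^{\perp}$ such that the shape operator $A^{\ast}:=A_{N^{\ast}}$ of $S$ in direction $N^{\ast}$ is nonsingular, i.e. $\operatorname{rank} A^{\ast}|_{p}=s$ for all $p\in S$. Then the geometric Cauchy problem for rank-$s$ submanifolds of $\mathbb{R}^{m+c}$ with data $(S,\mathcal{D})$ has a solution if and only if $$\phi_{p}(T_{p}S,N^{\ast}_{p})=\operatorname{Im}\phi_{p}\quad\text{for all } p\in S.$$ Moreover, when a solution exists: (i) The solution is locally unique, i.e., any two solutions coincide on an open set containing $S$. (ii) In this open set, the unique solution is given by $$\{\,p+x \mid p\in S,\ x\in\mathcal{D}_{p}\cap(\operatorname{Im}\phi_{p})^{\perp}\,\},$$ where $^{\perp}$ denotes orthogonal complement in $\mathbb{R}^{m+c}$. (iii) Given a local parametrization $\xi\colon A\to\mathbb{R}^{m+c}$ of $S$ ($A\subset\mathbb{R}^{s}$ open), the solution can be locally parametrized as follows. Let $(E_{1},\dots,E_{m})$ be a smooth orthonormal frame for $\mathcal{D}|_{\xi(A)}$ whose first $s$ elements span $TS$, and let $\phi_{i}^{k}=\langle\phi(E_{i},N^{\ast}),E_{k}\rangle=\langle\nabla_{E_{i}}N^{\ast},E_{k}\rangle$. For any $j=1,\dots,m-s$ and $i\in\{1,\dots,s,s+j\}$,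 let $G_{i}$ be the group of permutations of the $s$-element set $I_i$ obtained from $\{1,\dots,s,s+j\}$ by omitting the element $i$; write $I_i=\{k_1<k_2<\dots<k_s\}$, and let $$X_{j}=\sum_{i\in\{1,\dots,s,s+j\}}(-1)^{h}\sum_{\lambda\in G_{i}}\operatorname{sgn}(\lambda)\,\phi_{1}^{\lambda(k_1)}\phi_{2}^{\lambda(k_2)}\cdots\phi_{s}^{\lambda(k_s)}\,E_{i},$$ where $h=i$ for $i=1,\dots,s$ and $h=s+1$ for $i=s+j$. Then $$\sigma(a,b^{1},\dots,b^{m-s})=\xi(a)+b^{1}X_{1}(a)+\dots+b^{m-s}X_{m-s}(a)$$ is the desired parametrization of the solution (near $S$, i.e. for $(b^1,\dots,b^{m-s})$ near $0$).
   Context: A smooth distribution of rank $m$ along $S$ is a smooth rank-$m$ subbundle of the ambient tangent bundle $T\mathbb{R}^{m+c}|_{S}$; $\mathcal{D}\supset TS$ means $T_pS\subset\mathcal{D}_p$ for all $p\in S$. $\mathcal{D}^{\perp}$ is the distribution of rank $c$ along $S$ whose fiber at $p\in S$ is the orthogonal complement of $\mathcal{D}_p$ in $\mathbb{R}^{m+c}$. $\nabla$ is the Euclidean connection and $\pi^{\top}$ is orthogonal projection onto $\mathcal{D}$. The map $\phi_{p}\colon T_{p}S\times\mathcal{D}_{p}^{\perp}\to\mathcal{D}_{p}$ is defined by $(v,n)\mapsto\pi^{\top}\nabla_{v}N$, where $N$ is any extension of $n$ to a local section of $\mathcal{D}^{\perp}$ (this is well defined). $\operatorname{Im}\phi_p$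 is the image of this map and $\phi_p(T_pS,N^*_p)=\{\phi_p(v,N^*_p)\mid v\in T_pS\}$. The shape operator of $S$ in direction $N^{\ast}$ is $A^{\ast}=\pi_{S}\circ\phi(\cdot,N^{\ast})$, where $\pi_S$ is orthogonal projection onto $TS$. For an $m$-dimensional smooth embedded submanifold $M$ of $\mathbb{R}^{m+c}$ with second fundamental form $\alpha$, the index of relative nullity at $p\in M$ is $\dim\{x\in T_pM\mid\alpha(x,\cdot)=0\}$. $M$ is rank-$s$ if its index of relative nullity equals $m-s$ at every point. Geometric Cauchy problem for rank-$s$ submanifolds with data $(S,\mathcal{D})$: find an $m$-dimensional rank-$s$ smooth embedded submanifold $M$ of $\mathbb{R}^{m+c}$ with $S\subset M$ and $T_pM=\mathcal{D}_p$ for all $p\in S$. Such an $M$ is called a solution. Two solutions $M_1,M_2$ coincide on an open set $U$ if $M_1\cap U=M_2\cap U$. The description in (ii) is understood near $S$: in a neighborhood of $S$ the solution is the image under $(p,x)\mapsto p+x$ of a neighborhood of the zero section in the bundle with fibers $\mathcal{D}_{p}\cap(\operatorname{Im}\phi_{p})^{\perp}$. *)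

theory Defs
  imports "HOL-Analysis.Analysis"
begin

(* Only used for open A.  On finite-dimensional spaces this is the usual class C^k: all iterated
   directional derivatives up to order k exist and are continuous. *)
fun Ck_on :: "nat \<Rightarrow> 'a::real_normed_vector set \<Rightarrow> ('a \<Rightarrow> 'b::real_normed_vector) \<Rightarrow> bool" where
  "Ck_on 0 A f \<longleftrightarrow> continuous_on A f"
| "Ck_on (Suc k) A f \<longleftrightarrow>
     (\<forall>x\<in>A. f differentiable (at x)) \<and> (\<forall>v. Ck_on k A (\<lambda>x. frechet_derivative f (at x) v))"

definition smooth_on :: "'a::real_normed_vector set \<Rightarrow> ('a \<Rightarrow> 'b::real_normed_vector) \<Rightarrow> bool" where
  "smooth_on A f \<longleftrightarrow> (\<forall>k. Ck_on k A f)"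

definition diffeomorphism_between ::
  "'a::real_normed_vector set \<Rightarrow> 'b::real_normed_vector set \<Rightarrow> ('a \<Rightarrow> 'b) \<Rightarrow> bool" where
  "diffeomorphism_between U V f \<longleftrightarrow>
     smooth_on U f \<and> f ` U = V \<and> (\<exists>g. smooth_on V g \<and> (\<forall>x\<in>U. g (f x) = x))"

(* Smoothness of a map given on an arbitrary subset: it extends locally to a smooth map on an open
   subset of the ambient space. *)
definition smooth_along :: "'a::real_normed_vector set \<Rightarrow> ('a \<Rightarrow> 'b::real_normed_vector) \<Rightarrow> bool" where
  "smooth_along S f \<longleftrightarrow>
     (\<forall>p\<in>S. \<exists>U g. open U \<and> p \<in> U \<and> smooth_on U g \<and> (\<forall>q\<in>S \<inter> U. f q = g q))"

(* The local slice condition. *)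
definition embedded_submanifold :: "nat \<Rightarrow> 'a::euclidean_space set \<Rightarrow> bool" where
  "embedded_submanifold k M \<longleftrightarrow>
     (\<forall>p\<in>M. \<exists>U V (f :: 'a \<Rightarrow> 'a) L. open U \<and> p \<in> U \<and> open V \<and> diffeomorphism_between U V f \<and>
        subspace L \<and> dim L = k \<and> f ` (M \<inter> U) = V \<inter> L)"

definition smooth_curve_in :: "'a::euclidean_space set \<Rightarrow> 'a \<Rightarrow> 'a \<Rightarrow> (real \<Rightarrow> 'a) \<Rightarrow> bool" where
  "smooth_curve_in M p v \<gamma> \<longleftrightarrow>
     (\<exists>\<epsilon>>0. smooth_on {-\<epsilon><..<\<epsilon>} \<gamma> \<and> \<gamma> ` {-\<epsilon><..<\<epsilon>} \<subseteq> M) \<and>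
     \<gamma> 0 = p \<and> (\<gamma> has_vector_derivative v) (at 0)"

definition tangent_space :: "'a::euclidean_space set \<Rightarrow> 'a \<Rightarrow> 'a set" where
  "tangent_space M p = {v. \<exists>\<gamma>. smooth_curve_in M p v \<gamma>}"

definition local_parametrization ::
  "'b::euclidean_space set \<Rightarrow> ('b \<Rightarrow> 'a::euclidean_space) \<Rightarrow> 'a set \<Rightarrow> bool" where
  "local_parametrization A \<xi> M \<longleftrightarrow>
     open A \<and> smooth_on A \<xi> \<and> (\<forall>a\<in>A. inj (frechet_derivative \<xi> (at a))) \<and>
     (\<exists>\<eta>. homeomorphism A (\<xi> ` A) \<xi> \<eta>) \<and> \<xi> ` A \<subseteq> M \<and> openin (top_of_set M) (\<xi> ` A)"

definition orth_proj :: "'a::euclidean_space set \<Rightarrow> 'a \<Rightarrow> 'a" where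
  "orth_proj V x = (THE y. y \<in> V \<and> x - y \<in> orthogonal_comp V)"

(* The Euclidean connection: derivative at p, in the direction v tangent to M, of a vector field X
   that need only be defined along M. *)
definition nabla :: "'a::euclidean_space set \<Rightarrow> ('a \<Rightarrow> 'a) \<Rightarrow> 'a \<Rightarrow> 'a \<Rightarrow> 'a" where
  "nabla M X p v =
     (THE w. \<exists>\<gamma>. smooth_curve_in M p v \<gamma> \<and> ((X \<circ> \<gamma>) has_vector_derivative w) (at 0))"

definition smooth_section :: "'a::euclidean_space set \<Rightarrow> ('a \<Rightarrow> 'a set) \<Rightarrow> ('a \<Rightarrow> 'a) \<Rightarrow> bool" where
  "smooth_section S D X \<longleftrightarrow> smooth_along S X \<and> (\<forall>p\<in>S. X p \<in> D p)"

(* The normal component of the derivative of Y in the direction x, where Y is any local tangent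
   vector field extending y. *)
definition second_fundamental_form :: "'a::euclidean_space set \<Rightarrow> 'a \<Rightarrow> 'a \<Rightarrow> 'a \<Rightarrow> 'a" where
  "second_fundamental_form M p x y =
     (THE w. \<exists>U Y. open U \<and> p \<in> U \<and> smooth_section (M \<inter> U) (tangent_space M) Y \<and> Y p = y \<and>
        w = orth_proj (orthogonal_comp (tangent_space M p)) (nabla (M \<inter> U) Y p x))"

definition relative_nullity_index :: "'a::euclidean_space set \<Rightarrow> 'a \<Rightarrow> nat" where
  "relative_nullity_index M p =
     dim {x \<in> tangent_space M p. \<forall>y\<in>tangent_space M p. second_fundamental_form M p x y = 0}"

definition rank_submanifold :: "nat \<Rightarrow> nat \<Rightarrow> 'a::euclidean_space set \<Rightarrow> bool" where
  "rank_submanifold m s M \<longleftrightarrow>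
     embedded_submanifold m M \<and> (\<forall>p\<in>M. relative_nullity_index M p = m - s)"

(* Only the values D p with p in S matter.  As D q has dimension m, the spanning condition makes
   the fields E 1, ..., E m a local frame. *)
definition smooth_distribution :: "nat \<Rightarrow> 'a::euclidean_space set \<Rightarrow> ('a \<Rightarrow> 'a set) \<Rightarrow> bool" where
  "smooth_distribution m S D \<longleftrightarrow>
     (\<forall>p\<in>S. subspace (D p) \<and> dim (D p) = m) \<and>
     (\<forall>p\<in>S. \<exists>U (E :: nat \<Rightarrow> 'a \<Rightarrow> 'a). open U \<and> p \<in> U \<and>
        (\<forall>i\<in>{1..m}. smooth_along (S \<inter> U) (E i)) \<and>
        (\<forall>q\<in>S \<inter> U. span ((\<lambda>i. E i q) ` {1..m}) = D q))"

definition normal_distribution :: "('a::euclidean_space \<Rightarrow> 'a set) \<Rightarrow> 'a \<Rightarrow> 'a set" where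
  "normal_distribution D p = orthogonal_comp (D p)"

(* Meaningful for v tangent to S at p and n normal to D p; N is any extension of n to a local
   section of the normal distribution. *)
definition phi :: "'a::euclidean_space set \<Rightarrow> ('a \<Rightarrow> 'a set) \<Rightarrow> 'a \<Rightarrow> 'a \<Rightarrow> 'a \<Rightarrow> 'a" where
  "phi S D p v n =
     (THE w. \<exists>U N. open U \<and> p \<in> U \<and> smooth_section (S \<inter> U) (normal_distribution D) N \<and> N p = n \<and>
        w = orth_proj (D p) (nabla (S \<inter> U) N p v))"

definition phi_image :: "'a::euclidean_space set \<Rightarrow> ('a \<Rightarrow> 'a set) \<Rightarrow> 'a \<Rightarrow> 'a set" where
  "phi_image S D p = {phi S D p v n | v n. v \<in> tangent_space S p \<and> n \<in> normal_distribution D p}"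

definition shape_operator ::
  "'a::euclidean_space set \<Rightarrow> ('a \<Rightarrow> 'a set) \<Rightarrow> ('a \<Rightarrow> 'a) \<Rightarrow> 'a \<Rightarrow> 'a \<Rightarrow> 'a" where
  "shape_operator S D N p v = orth_proj (tangent_space S p) (phi S D p v (N p))"

definition cauchy_solution ::
  "nat \<Rightarrow> nat \<Rightarrow> 'a::euclidean_space set \<Rightarrow> ('a \<Rightarrow> 'a set) \<Rightarrow> 'a set \<Rightarrow> bool" where
  "cauchy_solution m s S D M \<longleftrightarrow>
     rank_submanifold m s M \<and> S \<subseteq> M \<and> (\<forall>p\<in>S. tangent_space M p = D p)"

definition ruling_bundle :: "'a::euclidean_space set \<Rightarrow> ('a \<Rightarrow> 'a set) \<Rightarrow> ('a \<times> 'a) set" where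
  "ruling_bundle S D = {(p, x). p \<in> S \<and> x \<in> D p \<inter> orthogonal_comp (phi_image S D p)}"

definition zero_section_nhd ::
  "'a::euclidean_space set \<Rightarrow> ('a \<Rightarrow> 'a set) \<Rightarrow> ('a \<times> 'a) set \<Rightarrow> bool" where
  "zero_section_nhd S D W \<longleftrightarrow>
     openin (top_of_set (ruling_bundle S D)) W \<and> (\<forall>p\<in>S. (p, 0) \<in> W)"

definition adapted_orthonormal_frame ::
  "nat \<Rightarrow> nat \<Rightarrow> 'a::euclidean_space set \<Rightarrow> ('a \<Rightarrow> 'a set) \<Rightarrow> 'a set \<Rightarrow> (nat \<Rightarrow> 'a \<Rightarrow> 'a) \<Rightarrow> bool" where
  "adapted_orthonormal_frame m s S D R E \<longleftrightarrow>
     (\<forall>i\<in>{1..m}. smooth_along R (E i)) \<and>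
     (\<forall>q\<in>R. (\<forall>i\<in>{1..m}. \<forall>k\<in>{1..m}. E i q \<bullet> E k q = (if i = k then 1 else 0)) \<and>
        span ((\<lambda>i. E i q) ` {1..m}) = D q \<and>
        span ((\<lambda>i. E i q) ` {1..s}) = tangent_space S q)"

definition phi_coeff ::
  "'a::euclidean_space set \<Rightarrow> ('a \<Rightarrow> 'a set) \<Rightarrow> ('a \<Rightarrow> 'a) \<Rightarrow> (nat \<Rightarrow> 'a \<Rightarrow> 'a) \<Rightarrow> 'a \<Rightarrow> nat \<Rightarrow> nat \<Rightarrow> real" where
  "phi_coeff S D N E q i k = phi S D q (E i q) (N q) \<bullet> E k q"

(* The l-th element k_l of I i, with l counted from 1, is sorted_list_of_set (I i) ! (l - 1). *)
definition ruling_field ::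
  "nat \<Rightarrow> 'a::euclidean_space set \<Rightarrow> ('a \<Rightarrow> 'a set) \<Rightarrow> ('a \<Rightarrow> 'a) \<Rightarrow> (nat \<Rightarrow> 'a \<Rightarrow> 'a) \<Rightarrow> nat \<Rightarrow> 'a \<Rightarrow> 'a" where
  "ruling_field s S D N E j q =
     (let J = {1..s} \<union> {s + j}; I = (\<lambda>i. J - {i}) in
      \<Sum>i\<in>J.
        ((-1) ^ (if i = s + j then s + 1 else i) *
         (\<Sum>\<tau> | \<tau> permutes I i.
            of_int (sign \<tau>) *
            (\<Prod>l\<in>{1..s}. phi_coeff S D N E q l (\<tau> (sorted_list_of_set (I i) ! (l - 1)))))) *\<^sub>R
        E i q)"

end

theory Submission
  imports Defs
begin

text \<open>Writing \<open>Rul p = D p \<inter> (Im \<phi> p)\<^sup>\<bottom>\<close>, the condition on \<open>\<phi>\<close> makes \<open>Rul p\<close> a complement of \<open>T\<^sub>p S\<close> in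
  \<open>D p\<close>, so that \<open>(p, x) \<mapsto> p + x\<close> is an immersion near the zero section; differentiating normal
  sections of \<open>D\<close> shows that its image has the constant tangent space \<open>D p\<close> along each ruling, hence
  relative nullity \<open>Rul p\<close>. Conversely, at a point of \<open>S\<close> the relative nullity of a solution lies in
  \<open>Rul p\<close>, which for dimensional reasons forces the condition and equality. In a graph
  parametrization \<open>G\<close> of a solution, constancy of the rank makes \<open>D\<^sup>3G\<close> vanish on pairs of nullity
  vectors, and a Gronwall estimate then shows that \<open>G\<close> is affine along the nullity directions. So a
  solution contains its rulings, and invariance of domain identifies it with their union near \<open>S\<close>.
  The fields \<open>X\<^sub>j\<close> are generalized cross products, orthogonal to the rows \<open>\<phi>(E\<^sub>l, N)\<close> by expansion of a
  determinant with a repeated row.\<close>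

section \<open>Smooth maps\<close>

text \<open>\<open>nabla\<close>, \<open>phi\<close> and \<open>second_fundamental_form\<close> are
  definite descriptions, so each must be shown well defined before anything can be computed. For
  \<open>phi\<close> this is done by differentiating the vanishing inner product of a normal field
  and a field of \<open>D\<close>, which moves the derivative off the normal field. The same device
  later gives the tangent spaces and the nullity of the ruled set, and the second fundamental form
  of any solution along \<open>S\<close>. The map (p, x) \<mapsto> p + x on the rulings has an image
  of positive codimension. It is therefore fattened: \<open>Rul q\<close> is replaced by all of
  \<open>orthogonal_comp (Im\<phi> q)\<close>, which has codimension \<open>s\<close> and is
  complementary to the tangent space of \<open>S\<close>. The inverse function theorem then applies
  in the ambient space, and the rulings reappear as a coordinate slice. Uniqueness avoids
  foliations: instead of integrating the nullity distribution, a differential inequality is run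
  along one straight segment in a graph chart. As \<open>S\<close> need not be compact, the sizes of
  the boxes around its points vary without control; comparison with the larger of two boxes replaces
  a uniform radius.\<close>

lemma Ck_on_cong_imp:
  assumes "open U" "\<And>x. x \<in> U \<Longrightarrow> f x = g x" "Ck_on k U f"
  shows "Ck_on k U g"
  using assms(2,3)
proof (induction k arbitrary: f g)
  case 0
  then show ?case by (metis Ck_on.simps(1) continuous_on_cong)
next
  case (Suc k)
  have d: "(g has_derivative frechet_derivative f (at x)) (at x)" if "x \<in> U" for x
  proof -
    have "(f has_derivative frechet_derivative f (at x)) (at x)"
      using Suc.prems that by (simp add: frechet_derivative_works)
    then show ?thesis
      using has_derivative_transform_within_open[OF _ \<open>open U\<close> that] Suc.prems(1) by blast
  qed
  then have "frechet_derivative f (at x) v = frechet_derivative g (at x) v" if "x \<in> U" for x v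
    using frechet_derivative_at[OF d[OF that]] by simp
  then have "Ck_on k U (\<lambda>x. frechet_derivative g (at x) v)" for v
    using Suc.prems(2) Suc.IH[of "\<lambda>x. frechet_derivative f (at x) v" "\<lambda>x. frechet_derivative g (at x) v"]
    unfolding Ck_on.simps by metis
  with d show ?case by (auto simp: differentiable_def)
qed

lemma Ck_on_Suc_intro:
  assumes "open U" "\<And>x. x \<in> U \<Longrightarrow> (f has_derivative f' x) (at x)"
    and "\<And>v. Ck_on k U (\<lambda>x. f' x v)"
  shows "Ck_on (Suc k) U f"
proof -
  have "f' x v = frechet_derivative f (at x) v" if "x \<in> U" for x v
    using frechet_derivative_at[OF assms(2)[OF that]] by simp
  then have "Ck_on k U (\<lambda>x. frechet_derivative f (at x) v)" for v
    by (rule Ck_on_cong_imp[OF assms(1) _ assms(3)[of v]])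
  then show ?thesis
    using assms(2) by (auto simp: differentiable_def)
qed

lemma Ck_on_SucD: "Ck_on (Suc k) U f \<Longrightarrow> Ck_on k U f"
proof (induction k arbitrary: f)
  case 0
  then show ?case
    by (auto simp: continuous_at_imp_continuous_on differentiable_imp_continuous_within)
qed auto

lemma Ck_on_mono: "j \<le> k \<Longrightarrow> Ck_on k U f \<Longrightarrow> Ck_on j U f"
  by (induction k rule: dec_induct) (auto dest: Ck_on_SucD simp del: Ck_on.simps)

lemma Ck_on_subset: "V \<subseteq> U \<Longrightarrow> Ck_on k U f \<Longrightarrow> Ck_on k V f"
  by (induction k arbitrary: f) (auto intro: continuous_on_subset)

lemma Ck_on_locally:
  assumes "\<And>x. x \<in> U \<Longrightarrow> \<exists>V. open V \<and> x \<in> V \<and> Ck_on k V f"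
  shows "Ck_on k U f"
  using assms
proof (induction k arbitrary: f)
  case 0
  have "continuous (at x within U) f" if "x \<in> U" for x
  proof -
    obtain V where "open V" "x \<in> V" "continuous_on V f" using 0 \<open>x \<in> U\<close> by force
    then have "continuous (at x) f" using continuous_on_eq_continuous_at by blast
    then show ?thesis by (rule continuous_at_imp_continuous_at_within)
  qed
  then show ?case by (simp add: continuous_on_eq_continuous_within)
next
  case (Suc k)
  have "f differentiable at x" if "x \<in> U" for x
    using Suc.prems[OF that] by auto
  moreover have "Ck_on k U (\<lambda>x. frechet_derivative f (at x) v)" for v
    by (rule Suc.IH) (use Suc.prems in force)
  ultimately show ?case by simp
qed

lemma Ck_on_continuous_on: "Ck_on k U f \<Longrightarrow> continuous_on U f"
  using Ck_on_mono[of 0 k U f] by simp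

lemma Ck_on_Suc_has_derivative:
  "Ck_on (Suc k) U f \<Longrightarrow> x \<in> U \<Longrightarrow> (f has_derivative frechet_derivative f (at x)) (at x)"
  by (simp add: frechet_derivative_works)

lemma Ck_on_const [simp]: "open U \<Longrightarrow> Ck_on k U (\<lambda>_. c)"
proof (induction k arbitrary: c)
  case (Suc k)
  show ?case
    by (rule Ck_on_Suc_intro[where f'="\<lambda>_ _. 0"]) (use Suc in \<open>auto simp del: Ck_on.simps\<close>)
qed simp

lemma Ck_on_bounded_linear_comp:
  assumes "bounded_linear h" "open U" "Ck_on k U f"
  shows "Ck_on k U (\<lambda>x. h (f x))"
  using assms(3)
proof (induction k arbitrary: f)
  case 0
  then show ?case using assms(1) by (simp add: bounded_linear.continuous_on)
next
  case (Suc k)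
  show ?case
  proof (rule Ck_on_Suc_intro[OF assms(2)])
    show "((\<lambda>x. h (f x)) has_derivative (\<lambda>v. h (frechet_derivative f (at x) v))) (at x)" if "x \<in> U" for x
      using bounded_linear.has_derivative[OF assms(1) Ck_on_Suc_has_derivative[OF Suc.prems that]] .
    show "Ck_on k U (\<lambda>x. h (frechet_derivative f (at x) v))" for v
      using Suc by auto
  qed
qed

lemma Ck_on_id:
  assumes "open U"
  shows "Ck_on k U (\<lambda>x. x)"
proof (cases k)
  case (Suc j)
  show ?thesis unfolding Suc
    by (rule Ck_on_Suc_intro[where f'="\<lambda>_ v. v"]) (use assms in \<open>auto simp del: Ck_on.simps\<close>)
qed simp

lemma Ck_on_add:
  assumes "open U" "Ck_on k U f" "Ck_on k U g"
  shows "Ck_on k U (\<lambda>x. f x + g x)"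
  using assms(2,3)
proof (induction k arbitrary: f g)
  case (Suc k)
  show ?case
  proof (rule Ck_on_Suc_intro[OF assms(1)])
    show "((\<lambda>x. f x + g x) has_derivative
        (\<lambda>v. frechet_derivative f (at x) v + frechet_derivative g (at x) v)) (at x)" if "x \<in> U" for x
      using Suc.prems that by (intro has_derivative_add Ck_on_Suc_has_derivative)
    show "Ck_on k U (\<lambda>x. frechet_derivative f (at x) v + frechet_derivative g (at x) v)" for v
      using Suc by auto
  qed
qed (simp add: continuous_on_add)

lemma Ck_on_sum:
  assumes "open U" "\<And>i. i \<in> I \<Longrightarrow> Ck_on k U (f i)"
  shows "Ck_on k U (\<lambda>x. \<Sum>i\<in>I. f i x)"
  using assms(2) by (induction I rule: infinite_finite_induct) (auto simp: assms(1) Ck_on_add)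

lemma Ck_on_bilinear:
  assumes bl: "bounded_bilinear pr" and "open U" "Ck_on k U f" "Ck_on k U g"
  shows "Ck_on k U (\<lambda>x. pr (f x) (g x))"
  using assms(3,4)
proof (induction k arbitrary: f g)
  case 0
  then show ?case using bl by (simp add: bounded_bilinear.continuous_on)
next
  case (Suc k)
  have d: "((\<lambda>x. pr (f x) (g x)) has_derivative
      (\<lambda>v. pr (f x) (frechet_derivative g (at x) v) + pr (frechet_derivative f (at x) v) (g x))) (at x)"
    if "x \<in> U" for x
    using bounded_bilinear.FDERIV[OF bl Ck_on_Suc_has_derivative Ck_on_Suc_has_derivative] Suc.prems that
    by blast
  show ?case
  proof (rule Ck_on_Suc_intro[OF assms(2) d])
    have "Ck_on k U f" "Ck_on k U g" using Suc.prems Ck_on_SucD by blast+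
    moreover have "Ck_on k U (\<lambda>x. frechet_derivative f (at x) v)" "Ck_on k U (\<lambda>x. frechet_derivative g (at x) v)" for v
      using Suc.prems by simp_all
    ultimately show "Ck_on k U (\<lambda>x. pr (f x) (frechet_derivative g (at x) v) + pr (frechet_derivative f (at x) v) (g x))" for v
      by (intro Ck_on_add assms(2) Suc.IH)
  qed
qed

lemmas Ck_on_scaleR = Ck_on_bilinear[OF bounded_bilinear_scaleR]
  and Ck_on_inner = Ck_on_bilinear[OF bounded_bilinear_inner]
  and Ck_on_mult = Ck_on_bilinear[OF bounded_bilinear_mult]

lemma Ck_on_minus: "open U \<Longrightarrow> Ck_on k U f \<Longrightarrow> Ck_on k U (\<lambda>x. - f x)"
  by (rule Ck_on_bounded_linear_comp[OF bounded_linear_minus[OF bounded_linear_ident]])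

lemma Ck_on_diff:
  "open U \<Longrightarrow> Ck_on k U f \<Longrightarrow> Ck_on k U g \<Longrightarrow> Ck_on k U (\<lambda>x. f x - g x)"
  using Ck_on_add[of U k f "\<lambda>x. - g x"] by (simp add: Ck_on_minus)

lemma Ck_on_prod:
  fixes f :: "'i \<Rightarrow> 'a::real_normed_vector \<Rightarrow> real"
  assumes "open U" "\<And>i. i \<in> I \<Longrightarrow> Ck_on k U (f i)"
  shows "Ck_on k U (\<lambda>x. \<Prod>i\<in>I. f i x)"
  using assms(2) by (induction I rule: infinite_finite_induct) (auto simp: assms(1) intro: Ck_on_mult)

text \<open>The derivative of the inverse contains the same inverse, which the induction hypothesis
  already controls to one order less.\<close>

lemma Ck_on_inverse:
  fixes f :: "'a::real_normed_vector \<Rightarrow> real"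
  assumes "open U" "Ck_on k U f" "\<And>x. x \<in> U \<Longrightarrow> f x \<noteq> 0"
  shows "Ck_on k U (\<lambda>x. inverse (f x))"
  using assms(2)
proof (induction k)
  case 0
  then show ?case using assms(3) by (simp add: continuous_on_inverse)
next
  case (Suc k)
  have d: "((\<lambda>x. inverse (f x)) has_derivative
      (\<lambda>v. - (inverse (f x) * frechet_derivative f (at x) v * inverse (f x)))) (at x)" if "x \<in> U" for x
    using Deriv.has_derivative_inverse[OF assms(3)[OF that] Ck_on_Suc_has_derivative[OF Suc.prems that]] by simp
  have "Ck_on k U (\<lambda>x. inverse (f x))" using Suc Ck_on_SucD by blast
  then show ?case
  proof (intro Ck_on_Suc_intro[OF assms(1) d])
    show "Ck_on k U (\<lambda>x. - (inverse (f x) * frechet_derivative f (at x) v * inverse (f x)))" for v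
      using Suc.prems \<open>Ck_on k U (\<lambda>x. inverse (f x))\<close> by (intro Ck_on_minus Ck_on_mult assms(1)) auto
  qed
qed

text \<open>\<open>Ck_on\<close> controls derivatives in fixed directions only, whereas the chain
  rule evaluates the derivative of \<open>g\<close> on a moving vector. Expansion in the standard
  basis writes the result as a sum of products to which the induction hypothesis applies.\<close>

lemma Ck_on_compose:
  fixes f :: "'a::real_normed_vector \<Rightarrow> 'b::euclidean_space" and g :: "'b \<Rightarrow> 'c::real_normed_vector"
  assumes "open U" "open V" "Ck_on k U f" "Ck_on k V g" "f ` U \<subseteq> V"
  shows "Ck_on k U (\<lambda>x. g (f x))"
  using assms(3,4)
proof (induction k arbitrary: g)
  case 0
  then show ?case using assms(5) continuous_on_compose2 by (metis Ck_on.simps(1))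
next
  case (Suc k)
  let ?f = "\<lambda>x. frechet_derivative f (at x)" and ?g = "\<lambda>x. frechet_derivative g (at x)"
  have d: "((\<lambda>x. g (f x)) has_derivative (\<lambda>v. \<Sum>i\<in>Basis. (?f x v \<bullet> i) *\<^sub>R ?g (f x) i)) (at x)"
    if "x \<in> U" for x
  proof -
    have f: "f x \<in> V" using that assms(5) by auto
    have g: "(g has_derivative ?g (f x)) (at (f x))"
      using Ck_on_Suc_has_derivative[OF Suc.prems(2) f] .
    have "linear (?g (f x))" using g has_derivative_linear by blast
    then have "?g (f x) (?f x v) = (\<Sum>i\<in>Basis. (?f x v \<bullet> i) *\<^sub>R ?g (f x) i)" for v
      by (subst euclidean_representation[of "?f x v", symmetric])
        (simp add: linear_sum linear_scale del: euclidean_representation)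
    then show ?thesis
      using has_derivative_compose[OF Ck_on_Suc_has_derivative[OF Suc.prems(1) that] g] by simp
  qed
  show ?case
  proof (rule Ck_on_Suc_intro[OF assms(1) d])
    fix v
    have "Ck_on k U (\<lambda>x. ?g (f x) i)" for i
      using Suc.IH[of "\<lambda>x. ?g x i"] Suc.prems Ck_on_SucD by auto
    moreover have "Ck_on k U (\<lambda>x. ?f x v \<bullet> i)" for i
      using Suc.prems(1) by (intro Ck_on_inner[OF assms(1)] Ck_on_const assms(1)) auto
    ultimately show "Ck_on k U (\<lambda>x. \<Sum>i\<in>Basis. (?f x v \<bullet> i) *\<^sub>R ?g (f x) i)"
      by (intro Ck_on_sum Ck_on_scaleR assms(1))
  qed auto
qed

lemma smooth_on_Ck: "smooth_on U f \<Longrightarrow> Ck_on k U f"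
  by (simp add: smooth_on_def)

lemma smooth_on_cong_imp:
  "open U \<Longrightarrow> (\<And>x. x \<in> U \<Longrightarrow> f x = g x) \<Longrightarrow> smooth_on U f \<Longrightarrow> smooth_on U g"
  unfolding smooth_on_def using Ck_on_cong_imp by blast

lemma smooth_on_subset: "V \<subseteq> U \<Longrightarrow> smooth_on U f \<Longrightarrow> smooth_on V f"
  unfolding smooth_on_def using Ck_on_subset by blast

lemma smooth_on_locally:
  assumes "\<And>x. x \<in> U \<Longrightarrow> \<exists>V. open V \<and> x \<in> V \<and> smooth_on V f"
  shows "smooth_on U f"
  unfolding smooth_on_def by (intro allI Ck_on_locally) (use assms smooth_on_def in blast)

lemma smooth_on_continuous_on: "smooth_on U f \<Longrightarrow> continuous_on U f"
  using smooth_on_Ck Ck_on_continuous_on by blast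

lemma smooth_on_has_derivative:
  "smooth_on U f \<Longrightarrow> x \<in> U \<Longrightarrow> (f has_derivative frechet_derivative f (at x)) (at x)"
  using smooth_on_Ck Ck_on_Suc_has_derivative by blast

lemma smooth_on_linear_derivative:
  "smooth_on U f \<Longrightarrow> x \<in> U \<Longrightarrow> linear (frechet_derivative f (at x))"
  using smooth_on_has_derivative has_derivative_linear by blast

lemma smooth_on_derivative_const:
  "smooth_on U f \<Longrightarrow> smooth_on U (\<lambda>x. frechet_derivative f (at x) v)"
  unfolding smooth_on_def using Ck_on.simps(2) by blast

lemma smooth_on_const: "open U \<Longrightarrow> smooth_on U (\<lambda>_. c)"
  and smooth_on_id: "open U \<Longrightarrow> smooth_on U (\<lambda>x. x)"
  and smooth_on_bounded_linear_comp:
    "bounded_linear h \<Longrightarrow> open U \<Longrightarrow> smooth_on U f \<Longrightarrow> smooth_on U (\<lambda>x. h (f x))"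
  and smooth_on_add: "open U \<Longrightarrow> smooth_on U f \<Longrightarrow> smooth_on U g \<Longrightarrow> smooth_on U (\<lambda>x. f x + g x)"
  and smooth_on_diff: "open U \<Longrightarrow> smooth_on U f \<Longrightarrow> smooth_on U g \<Longrightarrow> smooth_on U (\<lambda>x. f x - g x)"
  and smooth_on_sum: "open U \<Longrightarrow> (\<And>i. i \<in> I \<Longrightarrow> smooth_on U (F i)) \<Longrightarrow> smooth_on U (\<lambda>x. \<Sum>i\<in>I. F i x)"
  and smooth_on_scaleR: "open U \<Longrightarrow> smooth_on U r \<Longrightarrow> smooth_on U f \<Longrightarrow> smooth_on U (\<lambda>x. r x *\<^sub>R f x)"
  unfolding smooth_on_def
  by (auto intro: Ck_on_const Ck_on_id Ck_on_bounded_linear_comp Ck_on_add Ck_on_diff Ck_on_sum Ck_on_scaleR)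

lemma smooth_on_inner: "open U \<Longrightarrow> smooth_on U f \<Longrightarrow> smooth_on U g \<Longrightarrow> smooth_on U (\<lambda>x. f x \<bullet> g x)"
  unfolding smooth_on_def by (auto intro: Ck_on_inner)

lemma smooth_on_mult:
  fixes f g :: "'a::real_normed_vector \<Rightarrow> real"
  shows "open U \<Longrightarrow> smooth_on U f \<Longrightarrow> smooth_on U g \<Longrightarrow> smooth_on U (\<lambda>x. f x * g x)"
  unfolding smooth_on_def by (auto intro: Ck_on_mult)

lemma smooth_on_prod:
  fixes f :: "'i \<Rightarrow> 'a::real_normed_vector \<Rightarrow> real"
  shows "open U \<Longrightarrow> (\<And>i. i \<in> I \<Longrightarrow> smooth_on U (f i)) \<Longrightarrow> smooth_on U (\<lambda>x. \<Prod>i\<in>I. f i x)"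
  unfolding smooth_on_def by (auto intro: Ck_on_prod)

lemma smooth_on_compose:
  fixes f :: "'a::real_normed_vector \<Rightarrow> 'b::euclidean_space"
  assumes "open U" "open V" "smooth_on U f" "smooth_on V g" "f ` U \<subseteq> V"
  shows "smooth_on U (\<lambda>x. g (f x))"
  using assms unfolding smooth_on_def by (auto intro: Ck_on_compose)

lemma linear_Basis_expansion:
  fixes h :: "'a::euclidean_space \<Rightarrow> 'b::real_vector"
  assumes "linear h"
  shows "h x = (\<Sum>i\<in>Basis. (x \<bullet> i) *\<^sub>R h i)"
  by (subst euclidean_representation[of x, symmetric])
    (simp add: assms linear_sum linear_scale del: euclidean_representation)

lemma smooth_on_linear_family:
  fixes v :: "'a::real_normed_vector \<Rightarrow> 'b::euclidean_space"
  assumes "open U" "\<And>x. x \<in> U \<Longrightarrow> linear (L x)" "\<And>e. smooth_on U (\<lambda>x. L x e)" "smooth_on U v"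
  shows "smooth_on U (\<lambda>x. L x (v x))"
proof (rule smooth_on_cong_imp[OF assms(1)])
  show "smooth_on U (\<lambda>x. \<Sum>i\<in>Basis. (v x \<bullet> i) *\<^sub>R L x i)"
    by (intro smooth_on_sum smooth_on_scaleR smooth_on_inner smooth_on_const assms)
qed (metis linear_Basis_expansion assms(2))

lemma smooth_on_derivative:
  fixes v :: "'a::euclidean_space \<Rightarrow> 'a"
  assumes "open U" "smooth_on U f" "smooth_on U v"
  shows "smooth_on U (\<lambda>x. frechet_derivative f (at x) (v x))"
  by (rule smooth_on_linear_family)
    (use assms smooth_on_linear_derivative smooth_on_derivative_const in auto)

section \<open>Orthogonal projections, the inverse function theorem and symmetric derivatives\<close>

text \<open>Two candidates differ by a vector of \<open>V\<close> that is orthogonal to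
  itself.\<close>

lemma orth_proj_unique:
  assumes "subspace V" "y \<in> V" "x - y \<in> orthogonal_comp V"
  shows "orth_proj V x = y"
  unfolding orth_proj_def
proof (rule the_equality)
  fix z assume z: "z \<in> V \<and> x - z \<in> orthogonal_comp V"
  have "y - z \<in> V" using z assms subspace_diff by blast
  then have "orthogonal (y - z) (x - z)" "orthogonal (y - z) (x - y)"
    using z assms by (auto simp: orthogonal_comp_def)
  then have "(y - z) \<bullet> (y - z) = 0"
    by (simp add: orthogonal_def inner_diff_right)
  then show "z = y" by simp
qed (use assms in blast)

lemma orth_proj_props:
  assumes "subspace V"
  shows orth_proj_in: "orth_proj V x \<in> V"
    and diff_orth_proj_in: "x - orth_proj V x \<in> orthogonal_comp V"
proof -
  obtain y z where "y \<in> span V" "\<And>w. w \<in> span V \<Longrightarrow> orthogonal z w" "x = y + z"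
    using orthogonal_subspace_decomp_exists by blast
  then have "y \<in> V" "x - y \<in> orthogonal_comp V"
    using assms by (auto simp: orthogonal_comp_def span_eq_iff[THEN iffD2] orthogonal_commute)
  then show "orth_proj V x \<in> V" "x - orth_proj V x \<in> orthogonal_comp V"
    using orth_proj_unique[OF assms] by auto
qed

lemma orthogonal_comp_iff: "x \<in> orthogonal_comp V \<longleftrightarrow> (\<forall>y\<in>V. x \<bullet> y = 0)"
  by (auto simp: orthogonal_comp_def orthogonal_def inner_commute)

lemma orthogonal_comp_orthogonal_comp:
  fixes V :: "'a::euclidean_space set"
  assumes "subspace V"
  shows "orthogonal_comp (orthogonal_comp V) = V"
  using assms by (simp add: orthogonal_comp_self span_eq_iff)

lemma orth_proj_id: "subspace V \<Longrightarrow> x \<in> V \<Longrightarrow> orth_proj V x = x"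
  by (rule orth_proj_unique) (auto simp: orthogonal_comp_iff)

lemma orth_proj_eq_0: "subspace V \<Longrightarrow> x \<in> orthogonal_comp V \<Longrightarrow> orth_proj V x = 0"
  by (rule orth_proj_unique) (auto simp: subspace_0)

lemma orth_proj_eq_0_iff: "subspace V \<Longrightarrow> orth_proj V x = 0 \<longleftrightarrow> x \<in> orthogonal_comp V"
  using diff_orth_proj_in[of V x] orth_proj_eq_0 by auto

lemma linear_orth_proj:
  assumes "subspace V"
  shows "linear (orth_proj V)"
proof (rule linearI)
  show "orth_proj V (x + y) = orth_proj V x + orth_proj V y" for x y
  proof (rule orth_proj_unique[OF assms])
    have "x + y - (orth_proj V x + orth_proj V y) = (x - orth_proj V x) + (y - orth_proj V y)" by simp
    then show "x + y - (orth_proj V x + orth_proj V y) \<in> orthogonal_comp V"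
      using diff_orth_proj_in[OF assms] subspace_orthogonal_comp subspace_add by metis
  qed (use orth_proj_in assms subspace_add in blast)
  show "orth_proj V (c *\<^sub>R x) = c *\<^sub>R orth_proj V x" for c x
  proof (rule orth_proj_unique[OF assms])
    have "c *\<^sub>R x - c *\<^sub>R orth_proj V x = c *\<^sub>R (x - orth_proj V x)" by (simp add: scaleR_diff_right)
    then show "c *\<^sub>R x - c *\<^sub>R orth_proj V x \<in> orthogonal_comp V"
      using diff_orth_proj_in[OF assms] subspace_orthogonal_comp subspace_scale by metis
  qed (use orth_proj_in assms subspace_scale in blast)
qed

lemma orth_proj_inner:
  assumes "subspace V" "y \<in> V"
  shows "orth_proj V x \<bullet> y = x \<bullet> y"
  using diff_orth_proj_in[OF assms(1), of x] assms(2)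
  by (auto simp: orthogonal_comp_iff inner_diff_left)

lemma norm_orth_proj_le:
  assumes "subspace V"
  shows "norm (orth_proj V x) \<le> norm x"
proof -
  have "(norm (orth_proj V x))\<^sup>2 = x \<bullet> orth_proj V x"
    using orth_proj_inner[OF assms orth_proj_in[OF assms], of x x] by (simp add: power2_norm_eq_inner)
  also have "\<dots> \<le> norm x * norm (orth_proj V x)" by (rule norm_cauchy_schwarz)
  finally show ?thesis
    by (metis mult_right_le_imp_le norm_ge_zero norm_le_zero_iff order_le_less power2_eq_square order.refl)
qed

section \<open>Smooth dependence of projections and inverse maps on parameters\<close>

lemma orth_proj_insert:
  assumes "subspace V" "x \<notin> V"
  defines "u \<equiv> x - orth_proj V x"
  shows "orth_proj (span (insert x V)) y = orth_proj V y + ((y \<bullet> u) * inverse (u \<bullet> u)) *\<^sub>R u"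
proof (rule orth_proj_unique)
  have u: "u \<in> orthogonal_comp V" using diff_orth_proj_in[OF assms(1)] by (simp add: u_def)
  have "u \<noteq> 0" using assms orth_proj_in[OF assms(1), of x] by auto
  have V: "V \<subseteq> span (insert x V)" and x: "x \<in> span (insert x V)" by (auto intro: span_base)
  have pV: "orth_proj V z \<in> span (insert x V)" for z using orth_proj_in[OF assms(1)] V by blast
  then show "orth_proj V y + ((y \<bullet> u) * inverse (u \<bullet> u)) *\<^sub>R u \<in> span (insert x V)"
    unfolding u_def using x by (intro span_add span_scale span_diff) auto
  let ?r = "y - (orth_proj V y + ((y \<bullet> u) * inverse (u \<bullet> u)) *\<^sub>R u)"
  have rV: "?r \<bullet> v = 0" if "v \<in> V" for v
    using that u diff_orth_proj_in[OF assms(1), of y]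
    by (auto simp: orthogonal_comp_iff inner_diff_left inner_add_left)
  have "u \<bullet> orth_proj V y = 0" using u orth_proj_in[OF assms(1)] by (auto simp: orthogonal_comp_iff)
  then have "orth_proj V y \<bullet> u = 0" by (simp add: inner_commute)
  moreover have "u \<bullet> u \<noteq> 0" using \<open>u \<noteq> 0\<close> by simp
  ultimately have "?r \<bullet> u = 0" by (simp add: inner_diff_left inner_add_left)
  moreover have "?r \<bullet> orth_proj V x = 0" using rV orth_proj_in[OF assms(1)] by blast
  ultimately have "?r \<bullet> x = 0" by (simp add: u_def inner_diff_right)
  with rV have "orthogonal ?r v" if "v \<in> span (insert x V)" for v
    using that by (intro orthogonal_to_span[of v "insert x V"]) (auto simp: orthogonal_def)
  then show "?r \<in> orthogonal_comp (span (insert x V))"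
    by (simp add: orthogonal_comp_def orthogonal_commute)
qed simp

lemma span_insert_span: "span (insert x (span S)) = span (insert x S)"
proof (rule span_eq[THEN iffD2], intro conjI)
  have "span S \<subseteq> span (insert x S)" by (rule span_mono) auto
  then show "insert x (span S) \<subseteq> span (insert x S)" by (auto intro: span_base)
  show "insert x S \<subseteq> span (insert x (span S))" by (auto intro: span_base)
qed

lemma dim_span_insert_full:
  fixes X :: "'i \<Rightarrow> 'b::euclidean_space"
  assumes "finite I" "i \<notin> I" "dim (span (X ` insert i I)) = Suc (card I)"
  shows "dim (span (X ` I)) = card I" "X i \<notin> span (X ` I)"
proof -
  have "dim (X ` I) \<le> card I"
    using assms(1) by (meson card_image_le dim_le_card' finite_imageI le_trans)
  moreover have "(if X i \<in> span (X ` I) then dim (X ` I) else dim (X ` I) + 1) = Suc (card I)"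
    using assms(3) dim_insert[of "X i" "X ` I"] by simp
  ultimately show "dim (span (X ` I)) = card I" "X i \<notin> span (X ` I)"
    by (auto split: if_splits)
qed

text \<open>Induction by Gram-Schmidt, one step being \<open>orth_proj_insert\<close>. Independence
  of the fields on \<open>U\<close> keeps the denominators \<open>?u q \<bullet> ?u q\<close>
  nonzero.\<close>

lemma Ck_on_orth_proj_span:
  fixes X :: "'i \<Rightarrow> 'a::real_normed_vector \<Rightarrow> 'b::euclidean_space"
  assumes "finite I" "open U" "\<And>i. i \<in> I \<Longrightarrow> Ck_on k U (X i)"
    and "\<And>q. q \<in> U \<Longrightarrow> dim (span ((\<lambda>i. X i q) ` I)) = card I" and "Ck_on k U Y"
  shows "Ck_on k U (\<lambda>q. orth_proj (span ((\<lambda>i. X i q) ` I)) (Y q))"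
  using assms(1,3-)
proof (induction I arbitrary: Y rule: finite_induct)
  case empty
  have "orth_proj (span {}) (Y q) = 0" for q
    by (rule orth_proj_unique) (auto simp: orthogonal_comp_iff)
  then show ?case using assms(2) by simp
next
  case (insert i I)
  let ?V = "\<lambda>q. span ((\<lambda>i. X i q) ` I)"
  let ?u = "\<lambda>q. X i q - orth_proj (?V q) (X i q)"
  have V: "dim (?V q) = card I" "X i q \<notin> ?V q" if "q \<in> U" for q
    using dim_span_insert_full[of I i "\<lambda>i. X i q"] insert that by auto
  have IH: "Ck_on k U (\<lambda>q. orth_proj (?V q) (Y q))" if "Ck_on k U Y" for Y
    using insert V that by auto
  have u: "Ck_on k U ?u" using IH insert.prems by (intro Ck_on_diff assms(2)) auto
  have un: "?u q \<bullet> ?u q \<noteq> 0" if "q \<in> U" for q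
    using V(2)[OF that] orth_proj_in[of "?V q" "X i q"] by auto
  have "Ck_on k U (\<lambda>q. orth_proj (?V q) (Y q) + ((Y q \<bullet> ?u q) * inverse (?u q \<bullet> ?u q)) *\<^sub>R ?u q)"
    using un by (intro Ck_on_add Ck_on_scaleR Ck_on_mult Ck_on_inner Ck_on_inverse assms(2) IH u insert.prems)
  then show ?case
  proof (rule Ck_on_cong_imp[OF assms(2), rotated])
    fix q assume "q \<in> U"
    then show "orth_proj (?V q) (Y q) + ((Y q \<bullet> ?u q) * inverse (?u q \<bullet> ?u q)) *\<^sub>R ?u q =
      orth_proj (span ((\<lambda>i. X i q) ` insert i I)) (Y q)"
      using orth_proj_insert[of "?V q" "X i q" "Y q"] V(2) by (simp add: span_insert_span)
  qed
qed

lemma smooth_on_orth_proj_span: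
  fixes X :: "'i \<Rightarrow> 'a::real_normed_vector \<Rightarrow> 'b::euclidean_space"
  assumes "finite I" "open U" "\<And>i. i \<in> I \<Longrightarrow> smooth_on U (X i)"
    and "\<And>q. q \<in> U \<Longrightarrow> dim (span ((\<lambda>i. X i q) ` I)) = card I" and "smooth_on U Y"
  shows "smooth_on U (\<lambda>q. orth_proj (span ((\<lambda>i. X i q) ` I)) (Y q))"
  using assms unfolding smooth_on_def by (auto intro!: Ck_on_orth_proj_span)

text \<open>The same induction at the level of continuity: a new vector is independent of the others
  exactly while its Gram-Schmidt remainder is nonzero, which is an open condition.\<close>

lemma full_span_open:
  fixes X :: "'i \<Rightarrow> 'a::real_normed_vector \<Rightarrow> 'b::euclidean_space"
  assumes "finite I" "open U" "\<And>i. i \<in> I \<Longrightarrow> continuous_on U (X i)" "p \<in> U"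
    and "dim (span ((\<lambda>i. X i p) ` I)) = card I"
  shows "\<exists>V. open V \<and> p \<in> V \<and> V \<subseteq> U \<and> (\<forall>q\<in>V. dim (span ((\<lambda>i. X i q) ` I)) = card I)"
  using assms(1,3,5)
proof (induction I rule: finite_induct)
  case empty
  then show ?case using assms(2,4) by auto
next
  case (insert i I)
  let ?V = "\<lambda>q. span ((\<lambda>i. X i q) ` I)"
  let ?u = "\<lambda>q. X i q - orth_proj (?V q) (X i q)"
  have p: "dim (?V p) = card I" "X i p \<notin> ?V p"
    using dim_span_insert_full[of I i "\<lambda>i. X i p"] insert by auto
  obtain V where V: "open V" "p \<in> V" "V \<subseteq> U" "\<And>q. q \<in> V \<Longrightarrow> dim (?V q) = card I"
    using insert.IH insert.prems(1) p(1) by auto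
  have c: "continuous_on V (X j)" if "j \<in> insert i I" for j
    using insert.prems that V(3) continuous_on_subset by blast
  have "continuous_on V ?u"
    using Ck_on_orth_proj_span[of I V 0 X "X i"] insert V c by (intro continuous_intros) auto
  moreover have "?u p \<noteq> 0" using p(2) orth_proj_in[of "?V p" "X i p"] by auto
  ultimately obtain W where W: "open W" "p \<in> W" "W \<subseteq> V" "\<And>q. q \<in> W \<Longrightarrow> ?u q \<noteq> 0"
  proof -
    let ?W = "V \<inter> ?u -` (- {0})"
    have "open ?W" using \<open>continuous_on V ?u\<close> V(1) by (intro continuous_open_preimage) auto
    then show ?thesis using that[of ?W] V \<open>?u p \<noteq> 0\<close> by auto
  qed
  have "X i q \<notin> ?V q" if "q \<in> W" for q
    using W(4)[OF that] orth_proj_id[of "?V q" "X i q"] by auto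
  then have "dim (span ((\<lambda>i. X i q) ` insert i I)) = card (insert i I)" if "q \<in> W" for q
    using that V W insert by (auto simp: dim_insert)
  then show ?case using W V by (intro exI[of _ W]) auto
qed

text \<open>A substitute for Cramer's rule: \<open>?u b q\<close> is the part of the column
  \<open>L q b\<close> orthogonal to all other columns, so pairing \<open>v\<close> with it isolates
  the coefficient of the preimage at \<open>b\<close>.\<close>

lemma Ck_on_inv_linear:
  fixes L :: "'a::real_normed_vector \<Rightarrow> 'b::euclidean_space \<Rightarrow> 'b"
  assumes "open U" "\<And>q. q \<in> U \<Longrightarrow> linear (L q)" "\<And>q. q \<in> U \<Longrightarrow> inj (L q)"
    and "\<And>e. Ck_on k U (\<lambda>q. L q e)"
  shows "Ck_on k U (\<lambda>q. inv (L q) v)"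
proof -
  let ?V = "\<lambda>b q. span ((\<lambda>c. L q c) ` (Basis - {b}))"
  let ?u = "\<lambda>b q. L q b - orth_proj (?V b q) (L q b)"
  have card: "dim (span (L q ` I)) = card I" if "q \<in> U" "I \<subseteq> Basis" for q I
  proof -
    have "dim (L q ` I) = dim I" using assms(2,3) that by (intro dim_image_eq) (auto intro: inj_on_subset)
    also have "\<dots> = card I" using that independent_Basis by (metis dim_eq_card_independent independent_mono)
    finally show ?thesis by simp
  qed
  have un: "?u b q \<noteq> 0" if "q \<in> U" "b \<in> Basis" for b q
  proof -
    have "L q b \<notin> ?V b q"
      using dim_span_insert_full(2)[of "Basis - {b}" b "L q"] card[OF that(1), of Basis] that
      by (simp add: insert_absorb insert_Diff)
    then show ?thesis using orth_proj_in[of "?V b q" "L q b"] by auto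
  qed
  have u: "Ck_on k U (?u b)" for b
    by (intro Ck_on_diff Ck_on_orth_proj_span assms(1,4) card) auto
  have "Ck_on k U (\<lambda>q. \<Sum>b\<in>Basis. ((v \<bullet> ?u b q) * inverse (?u b q \<bullet> ?u b q)) *\<^sub>R b)"
    using un by (intro Ck_on_sum Ck_on_scaleR Ck_on_mult Ck_on_inner Ck_on_inverse Ck_on_const u assms(1)) auto
  then show ?thesis
  proof (rule Ck_on_cong_imp[OF assms(1), rotated])
    fix q assume q: "q \<in> U"
    define x where "x = inv (L q) v"
    have "surj (L q)" using assms(2,3) q by (simp add: linear_injective_imp_surjective)
    then have v: "v = L q x" by (simp add: x_def surj_f_inv_f)
    have "v \<bullet> ?u b q = (x \<bullet> b) * (?u b q \<bullet> ?u b q)" if b: "b \<in> Basis" for b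
    proof -
      have perp: "w \<bullet> ?u b q = 0" if "w \<in> ?V b q" for w
        using diff_orth_proj_in[of "?V b q" "L q b"] that by (auto simp: orthogonal_comp_iff inner_commute)
      have "v = (x \<bullet> b) *\<^sub>R L q b + (\<Sum>c\<in>Basis - {b}. (x \<bullet> c) *\<^sub>R L q c)"
        using linear_Basis_expansion[OF assms(2)[OF q], of x] b v by (simp add: sum.remove[of _ b])
      moreover have "(\<Sum>c\<in>Basis - {b}. (x \<bullet> c) *\<^sub>R L q c) \<in> ?V b q"
        by (intro span_sum span_scale span_base) auto
      ultimately have "v \<bullet> ?u b q = (x \<bullet> b) * (L q b \<bullet> ?u b q)"
        using perp by (simp add: inner_add_left)
      also have "L q b \<bullet> ?u b q = ?u b q \<bullet> ?u b q"
        using perp[OF orth_proj_in[of "?V b q" "L q b"]] by (simp add: inner_diff_left)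
      finally show ?thesis .
    qed
    then have "(v \<bullet> ?u b q) * inverse (?u b q \<bullet> ?u b q) = x \<bullet> b" if "b \<in> Basis" for b
      using un[OF q that] that by simp
    then show "(\<Sum>b\<in>Basis. ((v \<bullet> ?u b q) * inverse (?u b q \<bullet> ?u b q)) *\<^sub>R b) = inv (L q) v"
      by (simp add: euclidean_representation flip: x_def)
  qed
qed

text \<open>Bootstrapping: the inverse function theorem for C^1 maps gives \<open>g\<close> with
  derivative \<open>inv\<close> of the derivative of \<open>f\<close> at \<open>g y\<close>. If
  \<open>g\<close> is of class C^k, so is this expression, and \<open>g\<close> is of class
  C^(k+1).\<close>

lemma smooth_inverse_function:
  fixes f :: "'a::euclidean_space \<Rightarrow> 'a"
  assumes "open U" "smooth_on U f" "x0 \<in> U" "inj (frechet_derivative f (at x0))"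
  obtains U' V g where "open U'" "U' \<subseteq> U" "x0 \<in> U'" "open V" "f ` U' = V" "g ` V = U'"
    "smooth_on V g" "\<And>x. x \<in> U' \<Longrightarrow> g (f x) = x" "\<And>y. y \<in> V \<Longrightarrow> f (g y) = y"
proof -
  let ?F = "\<lambda>x. frechet_derivative f (at x)"
  define f' where "f' x = Blinfun (?F x)" for x
  have bl: "bounded_linear (?F x)" if "x \<in> U" for x
    using smooth_on_has_derivative[OF assms(2) that] has_derivative_bounded_linear by blast
  then have f': "blinfun_apply (f' x) = ?F x" if "x \<in> U" for x
    using that by (simp add: f'_def bounded_linear_Blinfun_apply)
  have der: "(f has_derivative blinfun_apply (f' x)) (at x)" if "x \<in> U" for x
    using smooth_on_has_derivative[OF assms(2) that] f'[OF that] by simp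
  have cont: "continuous_on U f'"
  proof (rule continuous_on_blinfun_componentwise)
    fix i :: 'a
    have "continuous_on U (\<lambda>x. ?F x i)"
      using smooth_on_continuous_on smooth_on_derivative_const assms(2) by blast
    then show "continuous_on U (\<lambda>x. blinfun_apply (f' x) i)"
      by (rule continuous_on_eq) (simp add: f')
  qed
  have lin: "linear (?F x0)" using bl assms(3) bounded_linear.linear by blast
  obtain h where h: "linear h" "\<And>x. h (?F x0 x) = x"
    using linear_injective_left_inverse[OF lin assms(4)] by (auto simp: o_def fun_eq_iff)
  have inv: "Blinfun h o\<^sub>L f' x0 = id_blinfun"
    by (rule blinfun_eqI)
      (use h f'[OF assms(3)] in \<open>simp add: bounded_linear_Blinfun_apply linear_conv_bounded_linear\<close>)
  obtain U' V g g' where *: "open U'" "U' \<subseteq> U" "x0 \<in> U'" "open V" "f x0 \<in> V" "homeomorphism U' V f g"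
    "\<And>y. y \<in> V \<Longrightarrow> (g has_derivative (g' y)) (at y)"
    "\<And>y. y \<in> V \<Longrightarrow> g' y = inv (blinfun_apply (f'(g y)))"
    "\<And>y. y \<in> V \<Longrightarrow> bij (blinfun_apply (f'(g y)))"
    using inverse_function_theorem[OF assms(1) der cont assms(3) inv] by metis
  have gU: "g y \<in> U" if "y \<in> V" for y using *(2,6) that by (auto simp: homeomorphism_def)
  have "Ck_on k V g" for k
  proof (induction k)
    case 0
    then show ?case using *(6) homeomorphism_cont2 by auto
  next
    case (Suc k)
    show ?case
    proof (rule Ck_on_Suc_intro[OF *(4) *(7)])
      fix v
      have "Ck_on k V (\<lambda>y. ?F (g y) e)" for e
        using Ck_on_compose[OF *(4) assms(1) Suc, of "\<lambda>x. ?F x e"] gU smooth_on_derivative_const[OF assms(2)]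
        by (auto simp: smooth_on_Ck)
      moreover have "inj (?F (g y))" "linear (?F (g y))" if "y \<in> V" for y
        using *(9)[OF that] f'[OF gU[OF that]] bl[OF gU[OF that]] by (auto simp: bij_def bounded_linear.linear)
      ultimately have "Ck_on k V (\<lambda>y. inv (?F (g y)) v)"
        by (intro Ck_on_inv_linear *(4)) auto
      then show "Ck_on k V (\<lambda>y. g' y v)"
        by (rule Ck_on_cong_imp[OF *(4), rotated]) (use *(8) f'[OF gU] in simp)
    qed
  qed
  then have "smooth_on V g" by (simp add: smooth_on_def)
  with * show ?thesis
    by (intro that[of U' V g]) (auto simp: homeomorphism_def)
qed

section \<open>Symmetry of second derivatives\<close>

lemma has_derivative_along_line:
  assumes "(f has_derivative f') (at (x + t *\<^sub>R u))"
  shows "((\<lambda>t. f (x + t *\<^sub>R u)) has_vector_derivative f' u) (at t)"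
proof -
  have "((\<lambda>t. x + t *\<^sub>R u) has_vector_derivative u) (at t)"
    by (auto intro!: derivative_eq_intros simp: has_vector_derivative_def)
  then show ?thesis
    using vector_derivative_diff_chain_within[of "\<lambda>t. x + t *\<^sub>R u" u t UNIV f f'] assms
    by (auto simp: o_def intro: has_derivative_at_withinI)
qed

text \<open>The mean value theorem is applied twice: in direction \<open>u\<close> to a difference
  quotient taken in direction \<open>v\<close>, then in direction \<open>v\<close> to the derivative
  so obtained.\<close>

lemma double_difference:
  fixes f :: "'a::real_normed_vector \<Rightarrow> real"
  assumes f: "Ck_on 2 (ball x r) f" and t: "0 < t" "t * (norm u + norm v) < r"
  shows "\<exists>a b. a \<in> {0<..<t} \<and> b \<in> {0<..<t} \<and>
    f (x + t *\<^sub>R u + t *\<^sub>R v) - f (x + t *\<^sub>R u) - f (x + t *\<^sub>R v) + f x =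
    t\<^sup>2 * frechet_derivative (\<lambda>y. frechet_derivative f (at y) u) (at (x + a *\<^sub>R u + b *\<^sub>R v)) v"
proof -
  have inb: "x + a *\<^sub>R u + b *\<^sub>R v \<in> ball x r" if "0 \<le> a" "a \<le> t" "0 \<le> b" "b \<le> t" for a b
  proof -
    have "norm (a *\<^sub>R u + b *\<^sub>R v) \<le> a * norm u + b * norm v"
      using that norm_triangle_ineq[of "a *\<^sub>R u" "b *\<^sub>R v"] by simp
    also have "\<dots> \<le> t * norm u + t * norm v" using that by (intro add_mono mult_right_mono) auto
    finally have "norm (a *\<^sub>R u + b *\<^sub>R v) < r" using t by (simp add: distrib_left)
    moreover have "dist x (x + a *\<^sub>R u + b *\<^sub>R v) = norm (a *\<^sub>R u + b *\<^sub>R v)"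
      by (metis add.assoc add_diff_cancel_left' dist_norm dist_commute)
    ultimately show ?thesis by simp
  qed
  let ?D = "\<lambda>y. frechet_derivative f (at y) u"
  have d: "(f has_derivative frechet_derivative f (at y)) (at y)"
    "(?D has_derivative frechet_derivative ?D (at y)) (at y)" if "y \<in> ball x r" for y
    using f that by (auto simp: numeral_2_eq_2 frechet_derivative_works)
  let ?h = "\<lambda>a. f (x + t *\<^sub>R v + a *\<^sub>R u) - f (x + a *\<^sub>R u)"
  have "DERIV ?h a :> ?D (x + t *\<^sub>R v + a *\<^sub>R u) - ?D (x + a *\<^sub>R u)" if "0 \<le> a" "a \<le> t" for a
    using that t inb[of a t] inb[of a 0]
    by (intro DERIV_diff has_derivative_along_line[THEN has_real_derivative_iff_has_vector_derivative[THEN iffD2]] d)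
      (auto simp: algebra_simps)
  then obtain a where a: "0 < a" "a < t"
    "?h t - ?h 0 = (t - 0) * (?D (x + t *\<^sub>R v + a *\<^sub>R u) - ?D (x + a *\<^sub>R u))"
    using MVT2[OF t(1), of ?h "\<lambda>a. ?D (x + t *\<^sub>R v + a *\<^sub>R u) - ?D (x + a *\<^sub>R u)"] by blast
  have "DERIV (\<lambda>b. ?D (x + a *\<^sub>R u + b *\<^sub>R v)) b :> frechet_derivative ?D (at (x + a *\<^sub>R u + b *\<^sub>R v)) v"
    if "0 \<le> b" "b \<le> t" for b
    using that t inb[of a b] a
    by (intro has_derivative_along_line[THEN has_real_derivative_iff_has_vector_derivative[THEN iffD2]] d) auto
  then obtain b where b: "0 < b" "b < t"
    "?D (x + a *\<^sub>R u + t *\<^sub>R v) - ?D (x + a *\<^sub>R u + 0 *\<^sub>R v) =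
       (t - 0) * frechet_derivative ?D (at (x + a *\<^sub>R u + b *\<^sub>R v)) v"
    using MVT2[OF t(1), of "\<lambda>b. ?D (x + a *\<^sub>R u + b *\<^sub>R v)"
      "\<lambda>b. frechet_derivative ?D (at (x + a *\<^sub>R u + b *\<^sub>R v)) v"] by blast
  have "?h t - ?h 0 = t * (t * frechet_derivative ?D (at (x + a *\<^sub>R u + b *\<^sub>R v)) v)"
    using a(3) b(3) by (simp add: algebra_simps)
  then show ?thesis
    using a b by (intro exI[of _ a] exI[of _ b]) (simp add: algebra_simps power2_eq_square)
qed

text \<open>The double difference does not change when \<open>u\<close> and \<open>v\<close> are
  exchanged, so the two mixed derivatives agree at intermediate points close to \<open>x\<close>;
  continuity carries the equality to \<open>x\<close>.\<close>

lemma second_derivative_symmetric_real: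
  fixes f :: "'a::real_normed_vector \<Rightarrow> real"
  assumes "open U" "Ck_on 2 U f" "x \<in> U"
  shows "frechet_derivative (\<lambda>y. frechet_derivative f (at y) u) (at x) v =
    frechet_derivative (\<lambda>y. frechet_derivative f (at y) v) (at x) u"
proof -
  let ?A = "\<lambda>z. frechet_derivative (\<lambda>y. frechet_derivative f (at y) u) (at z) v"
  let ?B = "\<lambda>z. frechet_derivative (\<lambda>y. frechet_derivative f (at y) v) (at z) u"
  obtain r where r: "0 < r" "ball x r \<subseteq> U" using assms openE by blast
  have f: "Ck_on 2 (ball x r) f" using Ck_on_subset r assms by blast
  have "continuous_on (ball x r) ?A" "continuous_on (ball x r) ?B" using f by (auto simp: numeral_2_eq_2)
  then have c: "isCont ?A x" "isCont ?B x" using r by (auto simp: continuous_on_eq_continuous_at)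
  \<comment> \<open>The \<open>+ 1\<close> excludes a zero denominator, and \<open>n + 2\<close>
    makes the estimate strict already for \<open>n = 0\<close>.\<close>
  define t where "t n = r / (norm u + norm v + 1) / real (n + 2)" for n
  have n1: "0 < norm u + norm v + 1" by (simp add: add_nonneg_pos)
  have tpos: "0 < t n" for n using r n1 by (simp add: t_def)
  have tr: "t n * (norm u + norm v) < r" for n
  proof -
    have "t n * (norm u + norm v) \<le> t n * (norm u + norm v + 1)" using tpos[of n] by simp
    also have "\<dots> = r / real (n + 2)" using n1 by (simp add: t_def)
    also have "\<dots> < r / 1" using r by (intro divide_strict_left_mono) auto
    finally show ?thesis by simp
  qed
  have t0: "t \<longlonglongrightarrow> 0"
  proof -
    have "(\<lambda>n. r / (norm u + norm v + 1) * inverse (real (Suc (Suc n)))) \<longlonglongrightarrow> r / (norm u + norm v + 1) * 0"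
      by (intro tendsto_mult tendsto_const LIMSEQ_Suc[OF LIMSEQ_inverse_real_of_nat])
    then show ?thesis by (simp add: t_def[abs_def] divide_inverse add.commute)
  qed
  have "\<exists>a b. a \<in> {0<..<t n} \<and> b \<in> {0<..<t n} \<and>
     f (x + t n *\<^sub>R u + t n *\<^sub>R v) - f (x + t n *\<^sub>R u) - f (x + t n *\<^sub>R v) + f x = (t n)\<^sup>2 * ?A (x + a *\<^sub>R u + b *\<^sub>R v)" for n
    by (rule double_difference[OF f tpos tr])
  then obtain a b where ab: "\<And>n. a n \<in> {0<..<t n} \<and> b n \<in> {0<..<t n} \<and>
     f (x + t n *\<^sub>R u + t n *\<^sub>R v) - f (x + t n *\<^sub>R u) - f (x + t n *\<^sub>R v) + f x = (t n)\<^sup>2 * ?A (x + a n *\<^sub>R u + b n *\<^sub>R v)"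
    by metis
  have "\<exists>a b. a \<in> {0<..<t n} \<and> b \<in> {0<..<t n} \<and>
     f (x + t n *\<^sub>R v + t n *\<^sub>R u) - f (x + t n *\<^sub>R v) - f (x + t n *\<^sub>R u) + f x = (t n)\<^sup>2 * ?B (x + a *\<^sub>R v + b *\<^sub>R u)" for n
    using double_difference[OF f tpos, of n v u] tr[of n] by (simp add: add.commute)
  then obtain a' b' where ab': "\<And>n. a' n \<in> {0<..<t n} \<and> b' n \<in> {0<..<t n} \<and>
     f (x + t n *\<^sub>R v + t n *\<^sub>R u) - f (x + t n *\<^sub>R v) - f (x + t n *\<^sub>R u) + f x = (t n)\<^sup>2 * ?B (x + a' n *\<^sub>R v + b' n *\<^sub>R u)"
    by metis
  have "(t n)\<^sup>2 * ?A (x + a n *\<^sub>R u + b n *\<^sub>R v) = (t n)\<^sup>2 * ?B (x + a' n *\<^sub>R v + b' n *\<^sub>R u)" for n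
    using ab[of n] ab'[of n] by (simp add: algebra_simps)
  moreover have "(t n)\<^sup>2 \<noteq> 0" for n using tpos[of n] by simp
  ultimately have eq: "?A (x + a n *\<^sub>R u + b n *\<^sub>R v) = ?B (x + a' n *\<^sub>R v + b' n *\<^sub>R u)" for n
    using mult_left_cancel by blast
  have lim: "c \<longlonglongrightarrow> 0" if "\<And>n. c n \<in> {0<..<t n}" for c
    by (rule tendsto_sandwich[OF _ _ tendsto_const t0]) (use that in \<open>auto intro!: always_eventually less_imp_le\<close>)
  have "(\<lambda>n. x + a n *\<^sub>R u + b n *\<^sub>R v) \<longlonglongrightarrow> x + 0 *\<^sub>R u + 0 *\<^sub>R v"
    using ab by (intro tendsto_intros lim) auto
  then have A: "(\<lambda>n. ?A (x + a n *\<^sub>R u + b n *\<^sub>R v)) \<longlonglongrightarrow> ?A x"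
    using isCont_tendsto_compose[OF c(1)] by simp
  have "(\<lambda>n. x + a' n *\<^sub>R v + b' n *\<^sub>R u) \<longlonglongrightarrow> x + 0 *\<^sub>R v + 0 *\<^sub>R u"
    using ab' by (intro tendsto_intros lim) auto
  then have "(\<lambda>n. ?B (x + a' n *\<^sub>R v + b' n *\<^sub>R u)) \<longlonglongrightarrow> ?B x"
    using isCont_tendsto_compose[OF c(2)] by simp
  then show ?thesis using A eq LIMSEQ_unique by simp
qed

lemma frechet_derivative_inner:
  assumes "f differentiable at x"
  shows "frechet_derivative (\<lambda>y. f y \<bullet> b) (at x) v = frechet_derivative f (at x) v \<bullet> b"
proof -
  have "((\<lambda>y. f y \<bullet> b) has_derivative (\<lambda>v. frechet_derivative f (at x) v \<bullet> b)) (at x)"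
    using assms frechet_derivative_works has_derivative_inner_left by blast
  then show ?thesis using frechet_derivative_at by metis
qed

lemma second_derivative_symmetric:
  fixes f :: "'a::real_normed_vector \<Rightarrow> 'b::euclidean_space"
  assumes "open U" "Ck_on 2 U f" "x \<in> U"
  shows "frechet_derivative (\<lambda>y. frechet_derivative f (at y) u) (at x) v =
    frechet_derivative (\<lambda>y. frechet_derivative f (at y) v) (at x) u"
proof (rule euclidean_eqI)
  fix b :: 'b
  have c: "Ck_on 2 U (\<lambda>y. f y \<bullet> b)" by (intro Ck_on_inner assms Ck_on_const)
  have d: "f differentiable at y" "(\<lambda>y. frechet_derivative f (at y) w) differentiable at y" if "y \<in> U" for y w
    using assms(2) that by (auto simp: numeral_2_eq_2)
  have *: "frechet_derivative (\<lambda>y. frechet_derivative (\<lambda>y. f y \<bullet> b) (at y) w) (at x) z =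
    frechet_derivative (\<lambda>y. frechet_derivative f (at y) w) (at x) z \<bullet> b" for w z
  proof -
    have "((\<lambda>y. frechet_derivative f (at y) w \<bullet> b) has_derivative
      (\<lambda>z. frechet_derivative (\<lambda>y. frechet_derivative f (at y) w) (at x) z \<bullet> b)) (at x)"
      using d(2)[OF assms(3)] frechet_derivative_works has_derivative_inner_left by blast
    then have "((\<lambda>y. frechet_derivative (\<lambda>y. f y \<bullet> b) (at y) w) has_derivative
      (\<lambda>z. frechet_derivative (\<lambda>y. frechet_derivative f (at y) w) (at x) z \<bullet> b)) (at x)"
      using has_derivative_transform_within_open[OF _ assms(1,3)] frechet_derivative_inner[OF d(1)] by force
    then show ?thesis using frechet_derivative_at by metis
  qed
  show "frechet_derivative (\<lambda>y. frechet_derivative f (at y) u) (at x) v \<bullet> b =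
    frechet_derivative (\<lambda>y. frechet_derivative f (at y) v) (at x) u \<bullet> b"
    using second_derivative_symmetric_real[OF assms(1) c assms(3), of u v] by (simp add: *)
qed

section \<open>Submanifolds as graphs and their second fundamental form\<close>

lemma smooth_curve_inD:
  assumes "smooth_curve_in M p v \<gamma>"
  shows "\<gamma> 0 = p" "(\<gamma> has_vector_derivative v) (at 0)" "(\<gamma> has_derivative (\<lambda>t. t *\<^sub>R v)) (at 0)"
    "eventually (\<lambda>t. \<gamma> t \<in> M) (nhds 0)" "p \<in> M"
proof -
  obtain e where e: "e > 0" "\<gamma> ` {-e<..<e} \<subseteq> M" "\<gamma> 0 = p" "(\<gamma> has_vector_derivative v) (at 0)"
    using assms by (auto simp: smooth_curve_in_def)
  then show "\<gamma> 0 = p" "(\<gamma> has_vector_derivative v) (at 0)" "(\<gamma> has_derivative (\<lambda>t. t *\<^sub>R v)) (at 0)"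
    by (auto simp: has_vector_derivative_def)
  show "eventually (\<lambda>t. \<gamma> t \<in> M) (nhds 0)"
    unfolding eventually_nhds using e by (intro exI[of _ "{-e<..<e}"]) auto
  then show "p \<in> M" using e eventually_nhds_x_imp_x by fastforce
qed

lemma smooth_curve_in_eventually:
  assumes "smooth_curve_in M p v \<gamma>" "open U" "p \<in> U"
  shows "eventually (\<lambda>t. \<gamma> t \<in> M \<inter> U) (nhds 0)"
proof -
  have "isCont \<gamma> 0" using smooth_curve_inD(3)[OF assms(1)] has_derivative_continuous by blast
  then have "eventually (\<lambda>t. \<gamma> t \<in> U) (nhds 0)"
    using assms smooth_curve_inD(1)[OF assms(1)] by (simp add: continuous_at_open eventually_nhds)
  then show ?thesis using smooth_curve_inD(4)[OF assms(1)] by (simp add: eventually_conj_iff)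
qed

lemma vector_derivative_eventually_eq:
  assumes "(f has_vector_derivative a) (at x)" "(g has_vector_derivative b) (at x)"
    and "eventually (\<lambda>t. f t = g t) (nhds x)"
  shows "a = b"
proof -
  obtain S where "open S" "x \<in> S" "\<And>t. t \<in> S \<Longrightarrow> f t = g t" using assms(3) by (auto simp: eventually_nhds)
  then have "(g has_vector_derivative a) (at x)"
    using has_vector_derivative_transform_within_open[OF assms(1)] by blast
  then show ?thesis using vector_derivative_unique_at assms(2) by blast
qed

lemma has_vector_derivative_compose_smooth:
  assumes "(\<gamma> has_vector_derivative v) (at t)" "(f has_derivative f') (at (\<gamma> t))"
  shows "((\<lambda>t. f (\<gamma> t)) has_vector_derivative f' v) (at t)"
  using vector_derivative_diff_chain_within[of \<gamma> v t UNIV f f'] assms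
  by (auto simp: o_def intro: has_derivative_at_withinI)

lemma smooth_curve_in_image:
  assumes c: "smooth_curve_in M p v \<gamma>" and U: "open U" "p \<in> U" and f: "smooth_on U f"
    and M': "\<And>q. q \<in> M \<inter> U \<Longrightarrow> f q \<in> M'"
  shows "smooth_curve_in M' (f p) (frechet_derivative f (at p) v) (\<lambda>t. f (\<gamma> t))"
proof -
  obtain e where e: "e > 0" "smooth_on {-e<..<e} \<gamma>" using c by (auto simp: smooth_curve_in_def)
  obtain S where S: "open S" "0 \<in> S" "\<And>t. t \<in> S \<Longrightarrow> \<gamma> t \<in> M \<inter> U"
    using smooth_curve_in_eventually[OF c U] by (auto simp: eventually_nhds)
  obtain d where d: "d > 0" "ball 0 d \<subseteq> S" using S openE by blast
  let ?e = "min d e"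
  have sub: "{-?e<..<?e} \<subseteq> S" "{-?e<..<?e} \<subseteq> {-e<..<e}"
    using d by (auto simp: subset_iff dist_real_def abs_less_iff)
  have "smooth_on {-?e<..<?e} (\<lambda>t. f (\<gamma> t))"
    by (rule smooth_on_compose[OF _ U(1) smooth_on_subset[OF sub(2) e(2)] f]) (use S sub in auto)
  moreover have "((\<lambda>t. f (\<gamma> t)) has_vector_derivative frechet_derivative f (at p) v) (at 0)"
    using has_vector_derivative_compose_smooth smooth_curve_inD[OF c] smooth_on_has_derivative[OF f U(2)] by metis
  ultimately show ?thesis
    unfolding smooth_curve_in_def using smooth_curve_inD(1)[OF c] e d S(3) sub(1) M'
    by (intro conjI exI[of _ ?e]) (auto simp: image_subset_iff subset_iff)
qed

lemma frechet_derivative_id [simp]: "frechet_derivative (\<lambda>x. x) (at p) = (\<lambda>v. v)"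
  by (metis frechet_derivative_at has_derivative_ident)

lemma smooth_curve_in_Int_open:
  assumes "smooth_curve_in M p v \<gamma>" "open U" "p \<in> U"
  shows "smooth_curve_in (M \<inter> U) p v \<gamma>"
  using smooth_curve_in_image[OF assms smooth_on_id[OF assms(2)], of "M \<inter> U"] by simp

lemma smooth_curve_in_mono: "M \<subseteq> M' \<Longrightarrow> smooth_curve_in M p v \<gamma> \<Longrightarrow> smooth_curve_in M' p v \<gamma>"
  by (auto simp: smooth_curve_in_def)

lemma tangent_space_Int_open:
  "open U \<Longrightarrow> p \<in> U \<Longrightarrow> tangent_space (M \<inter> U) p = tangent_space M p"
  using smooth_curve_in_Int_open smooth_curve_in_mono[of "M \<inter> U" M] unfolding tangent_space_def by blast

lemma tangent_space_image:
  assumes "v \<in> tangent_space M p" "open U" "p \<in> U" "smooth_on U f" "\<And>q. q \<in> M \<inter> U \<Longrightarrow> f q \<in> M'"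
  shows "frechet_derivative f (at p) v \<in> tangent_space M' (f p)"
  using assms smooth_curve_in_image unfolding tangent_space_def by blast

lemma tangent_space_in: "v \<in> tangent_space M p \<Longrightarrow> p \<in> M"
  using smooth_curve_inD(5) by (auto simp: tangent_space_def)

lemma smooth_on_line: "smooth_on UNIV (\<lambda>t::real. p + t *\<^sub>R v)"
  by (intro smooth_on_add smooth_on_scaleR smooth_on_const smooth_on_id) auto

lemma line_has_vector_derivative: "((\<lambda>t. p + t *\<^sub>R v) has_vector_derivative v) (at t)"
  by (auto intro!: derivative_eq_intros simp: has_vector_derivative_def)

lemma smooth_curve_in_line:
  assumes "\<And>t. p + t *\<^sub>R v \<in> M"
  shows "smooth_curve_in M p v (\<lambda>t. p + t *\<^sub>R v)"
  unfolding smooth_curve_in_def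
  using assms line_has_vector_derivative[of p v 0] smooth_on_subset[OF subset_UNIV smooth_on_line]
  by (auto intro!: exI[of _ 1])

lemma tangent_space_image_line:
  fixes p v :: "'a::euclidean_space"
  assumes "open U" "p \<in> U" "smooth_on U f" "\<And>t. p + t *\<^sub>R v \<in> A" "\<And>q. q \<in> A \<inter> U \<Longrightarrow> f q \<in> M"
  shows "frechet_derivative f (at p) v \<in> tangent_space M (f p)"
proof (rule tangent_space_image[OF _ assms(1-3)])
  show "v \<in> tangent_space A p"
    using smooth_curve_in_line[of p v A] assms(4) unfolding tangent_space_def by blast
qed (use assms(5) in blast)

text \<open>A curve in \<open>L\<close> is fixed by the linear projection onto \<open>L\<close>,
  hence so is its velocity.\<close>

lemma tangent_space_subspace_subset:
  assumes "subspace L" "M \<subseteq> L"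
  shows "tangent_space M p \<subseteq> L"
proof
  fix v assume "v \<in> tangent_space M p"
  then obtain \<gamma> where c: "smooth_curve_in M p v \<gamma>" by (auto simp: tangent_space_def)
  have "bounded_linear (orth_proj L)" using linear_orth_proj[OF assms(1)] by (simp add: linear_conv_bounded_linear)
  then have "((\<lambda>t. orth_proj L (\<gamma> t)) has_vector_derivative orth_proj L v) (at 0)"
    using bounded_linear.has_vector_derivative smooth_curve_inD(2)[OF c] by blast
  moreover have "eventually (\<lambda>t. \<gamma> t = orth_proj L (\<gamma> t)) (nhds 0)"
    using smooth_curve_inD(4)[OF c] by (rule eventually_mono) (use assms orth_proj_id in \<open>metis subsetD\<close>)
  ultimately have "v = orth_proj L v" using vector_derivative_eventually_eq smooth_curve_inD(2)[OF c] by blast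
  then show "v \<in> L" using orth_proj_in[OF assms(1)] by metis
qed

text \<open>Discharges the description in \<open>nabla\<close>: by the chain rule for the ambient
  extension \<open>g\<close>, all admissible curves yield the same derivative, and tangency of
  \<open>v\<close> supplies one such curve.\<close>

lemma nabla_eq:
  assumes U: "open U" "p \<in> U" and g: "smooth_on U g" "\<And>q. q \<in> M \<inter> U \<Longrightarrow> X q = g q"
    and v: "v \<in> tangent_space M p"
  shows "nabla M X p v = frechet_derivative g (at p) v"
proof -
  have *: "((X \<circ> \<gamma>) has_vector_derivative frechet_derivative g (at p) v) (at 0)"
    if c: "smooth_curve_in M p v \<gamma>" for \<gamma>
  proof -
    have "((\<lambda>t. g (\<gamma> t)) has_vector_derivative frechet_derivative g (at p) v) (at 0)"
      using has_vector_derivative_compose_smooth smooth_curve_inD[OF c] smooth_on_has_derivative[OF g(1) U(2)] by metis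
    moreover obtain S where "open S" "0 \<in> S" "\<And>t. t \<in> S \<Longrightarrow> \<gamma> t \<in> M \<inter> U"
      using smooth_curve_in_eventually[OF c U] by (auto simp: eventually_nhds)
    ultimately show ?thesis
      using has_vector_derivative_transform_within_open[of "\<lambda>t. g (\<gamma> t)" _ 0 S "X \<circ> \<gamma>"] g(2) by simp
  qed
  show ?thesis unfolding nabla_def
  proof (rule the_equality)
    show "\<exists>\<gamma>. smooth_curve_in M p v \<gamma> \<and> ((X \<circ> \<gamma>) has_vector_derivative frechet_derivative g (at p) v) (at 0)"
      using v * by (auto simp: tangent_space_def)
  qed (use * vector_derivative_unique_at in blast)
qed

lemma smooth_alongE:
  assumes "smooth_along M X" "p \<in> M"
  obtains U g where "open U" "p \<in> U" "smooth_on U g" "\<And>q. q \<in> M \<inter> U \<Longrightarrow> X q = g q"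
  using bspec[OF assms(1)[unfolded smooth_along_def] assms(2)] by blast

lemma nabla_along_curve:
  assumes X: "smooth_along M X" and c: "smooth_curve_in M p v \<gamma>"
  shows "((\<lambda>t. X (\<gamma> t)) has_vector_derivative nabla M X p v) (at 0)"
proof -
  have v: "v \<in> tangent_space M p" using c by (auto simp: tangent_space_def)
  obtain U g where U: "open U" "p \<in> U" and g: "smooth_on U g" "\<And>q. q \<in> M \<inter> U \<Longrightarrow> X q = g q"
    using smooth_alongE[OF X tangent_space_in[OF v]] by blast
  have "((\<lambda>t. g (\<gamma> t)) has_vector_derivative frechet_derivative g (at p) v) (at 0)"
    using has_vector_derivative_compose_smooth smooth_curve_inD[OF c] smooth_on_has_derivative[OF g(1) U(2)] by metis
  moreover obtain S where "open S" "0 \<in> S" "\<And>t. t \<in> S \<Longrightarrow> \<gamma> t \<in> M \<inter> U"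
    using smooth_curve_in_eventually[OF c U] by (auto simp: eventually_nhds)
  ultimately show ?thesis
    using has_vector_derivative_transform_within_open[of "\<lambda>t. g (\<gamma> t)" _ 0 S "\<lambda>t. X (\<gamma> t)"] g(2)
      nabla_eq[OF U g v] by simp
qed

lemma smooth_on_imp_along: "open U \<Longrightarrow> smooth_on U g \<Longrightarrow> M \<subseteq> U \<Longrightarrow> smooth_along M g"
  unfolding smooth_along_def by blast

text \<open>The product rule for a linear map applied to a vector, both depending on
  \<open>z\<close>. It goes through a basis expansion because smoothness is known in constant
  directions only; the auxiliary fact \<open>H\<close> sums the expansion up again.\<close>

lemma has_derivative_derivative_family:
  fixes v :: "'a::euclidean_space \<Rightarrow> 'a" and G :: "'a \<Rightarrow> 'b::real_normed_vector"
  assumes "open U" "smooth_on U G" "q \<in> U" "(v has_derivative v') (at q)"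
  shows "((\<lambda>z. frechet_derivative G (at z) (v z)) has_derivative
    (\<lambda>x. frechet_derivative (\<lambda>z. frechet_derivative G (at z) (v q)) (at q) x + frechet_derivative G (at q) (v' x))) (at q)"
proof -
  let ?G = "\<lambda>z. frechet_derivative G (at z)"
  let ?H = "\<lambda>w. frechet_derivative (\<lambda>z. ?G z w) (at q)"
  have lin: "linear (?G z)" if "z \<in> U" for z using smooth_on_linear_derivative assms(2) that by blast
  have dH: "((\<lambda>z. ?G z w) has_derivative ?H w) (at q)" for w
    using smooth_on_has_derivative[OF smooth_on_derivative_const[OF assms(2)] assms(3)] .
  have exp: "(\<lambda>z. \<Sum>i\<in>Basis. (w \<bullet> i) *\<^sub>R ?G z i) z = ?G z w" if "z \<in> U" for z w
    using linear_Basis_expansion[OF lin[OF that], of w] by simp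
  have "((\<lambda>z. \<Sum>i\<in>Basis. (w \<bullet> i) *\<^sub>R ?G z i) has_derivative (\<lambda>x. \<Sum>i\<in>Basis. (w \<bullet> i) *\<^sub>R ?H i x)) (at q)" for w
    by (intro has_derivative_sum has_derivative_scaleR_right dH)
  then have "((\<lambda>z. ?G z w) has_derivative (\<lambda>x. \<Sum>i\<in>Basis. (w \<bullet> i) *\<^sub>R ?H i x)) (at q)" for w
    by (rule has_derivative_transform_within_open[OF _ assms(1,3)]) (use exp in auto)
  then have H: "(\<Sum>i\<in>Basis. (w \<bullet> i) *\<^sub>R ?H i x) = ?H w x" for w x
    using fun_cong[OF has_derivative_unique[OF _ dH[of w]]] by fast
  have "((\<lambda>z. \<Sum>i\<in>Basis. (v z \<bullet> i) *\<^sub>R ?G z i) has_derivative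
      (\<lambda>x. \<Sum>i\<in>Basis. (v q \<bullet> i) *\<^sub>R ?H i x + (v' x \<bullet> i) *\<^sub>R ?G q i)) (at q)"
    by (intro has_derivative_sum has_derivative_scaleR dH has_derivative_inner_left assms(4))
  moreover have "(\<lambda>x. \<Sum>i\<in>Basis. (v q \<bullet> i) *\<^sub>R ?H i x + (v' x \<bullet> i) *\<^sub>R ?G q i) = (\<lambda>x. ?H (v q) x + ?G q (v' x))"
    using H exp[OF assms(3)] by (simp add: sum.distrib)
  ultimately have "((\<lambda>z. \<Sum>i\<in>Basis. (v z \<bullet> i) *\<^sub>R ?G z i) has_derivative (\<lambda>x. ?H (v q) x + ?G q (v' x))) (at q)"
    by simp
  then show ?thesis
    by (rule has_derivative_transform_within_open[OF _ assms(1,3)]) (use exp in auto)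
qed

text \<open>Linearity in \<open>v\<close> is that of a derivative; linearity in \<open>w\<close>
  follows by exchanging the two directions.\<close>

lemma linear_second_derivative:
  fixes G :: "'a::euclidean_space \<Rightarrow> 'b::euclidean_space"
  assumes "open U" "smooth_on U G" "q \<in> U"
  shows "linear (\<lambda>v. frechet_derivative (\<lambda>z. frechet_derivative G (at z) w) (at q) v)"
    "linear (\<lambda>w. frechet_derivative (\<lambda>z. frechet_derivative G (at z) w) (at q) v)"
proof -
  show 1: "linear (\<lambda>v. frechet_derivative (\<lambda>z. frechet_derivative G (at z) w) (at q) v)" for w
    using smooth_on_linear_derivative[OF smooth_on_derivative_const[OF assms(2)] assms(3)] .
  show "linear (\<lambda>w. frechet_derivative (\<lambda>z. frechet_derivative G (at z) w) (at q) v)"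
    using 1[of v] second_derivative_symmetric[OF assms(1) smooth_on_Ck[OF assms(2)] assms(3)] by simp
qed

lemma frechet_derivative_shift_invariant:
  assumes "open \<Omega>" "\<And>w. w \<in> \<Omega> \<Longrightarrow> w + a \<in> \<Omega> \<and> f (w + a) = f w" "z \<in> \<Omega>"
    and "f differentiable at (z + a)"
  shows "frechet_derivative f (at (z + a)) = frechet_derivative f (at z)"
proof -
  have "((\<lambda>w. w + a) has_derivative (\<lambda>v. v)) (at z)" by (auto intro!: derivative_eq_intros)
  moreover have "(f has_derivative frechet_derivative f (at (z + a))) (at (z + a))"
    using assms(4) frechet_derivative_works by blast
  ultimately have "((\<lambda>w. f (w + a)) has_derivative (\<lambda>v. frechet_derivative f (at (z + a)) v)) (at z)"
    using has_derivative_compose by blast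
  then have "(f has_derivative frechet_derivative f (at (z + a))) (at z)"
    by (rule has_derivative_transform_within_open[OF _ assms(1,3)]) (use assms(2) in auto)
  then show ?thesis using frechet_derivative_at by metis
qed

section \<open>Graph charts and the second fundamental form\<close>

definition relative_nullity :: "'a::euclidean_space set \<Rightarrow> 'a \<Rightarrow> 'a set" where
  "relative_nullity M q =
     {x \<in> tangent_space M q. \<forall>y\<in>tangent_space M q. second_fundamental_form M q x y = 0}"

lemma relative_nullity_index_eq: "relative_nullity_index M q = dim (relative_nullity M q)"
  by (simp add: relative_nullity_index_def relative_nullity_def)

text \<open>A submanifold \<open>M\<close> which over the open set \<open>U\<close> is a graph over the subspace \<open>T\<close>;
  \<open>G\<close> moves points along the orthogonal complement of \<open>T\<close> onto the graph.\<close>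

locale smooth_graph =
  fixes M T \<Omega> U :: "'a::euclidean_space set" and G :: "'a \<Rightarrow> 'a"
  assumes T: "subspace T" and open_\<Omega>: "open \<Omega>" and open_U: "open U" and U_\<Omega>: "U \<subseteq> \<Omega>"
    and smooth_G: "smooth_on \<Omega> G"
    and G_in: "z \<in> \<Omega> \<Longrightarrow> G z \<in> M \<inter> U"
    and proj_G: "z \<in> \<Omega> \<Longrightarrow> orth_proj T (G z) = orth_proj T z"
    and G_cyl: "z \<in> \<Omega> \<Longrightarrow> orth_proj T z' = orth_proj T z \<Longrightarrow> z' \<in> \<Omega> \<and> G z' = G z"
    and G_id: "q \<in> M \<inter> U \<Longrightarrow> G q = q"
begin

abbreviation "DG z \<equiv> frechet_derivative G (at z)"

text \<open>The Hessian of \<open>G\<close>; the direction \<open>w\<close> is differentiated first.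
  Keeping directions as arguments avoids functions with values in spaces of linear maps.\<close>

definition "H z v w = frechet_derivative (\<lambda>z. DG z w) (at z) v"

lemma linear_DG: "z \<in> \<Omega> \<Longrightarrow> linear (DG z)"
  using smooth_on_linear_derivative smooth_G by blast

lemma DG_has_derivative: "z \<in> \<Omega> \<Longrightarrow> (G has_derivative DG z) (at z)"
  using smooth_on_has_derivative smooth_G by blast

lemma H_has_derivative: "z \<in> \<Omega> \<Longrightarrow> ((\<lambda>z. DG z w) has_derivative (\<lambda>v. H z v w)) (at z)"
  unfolding H_def using smooth_on_has_derivative[OF smooth_on_derivative_const[OF smooth_G]] .

lemma linear_H1: "z \<in> \<Omega> \<Longrightarrow> linear (\<lambda>v. H z v w)"
  and linear_H2: "z \<in> \<Omega> \<Longrightarrow> linear (\<lambda>w. H z v w)"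
  using linear_second_derivative[OF open_\<Omega> smooth_G] by (simp_all add: H_def)

lemma H_sym: "z \<in> \<Omega> \<Longrightarrow> H z v w = H z w v"
  unfolding H_def using second_derivative_symmetric[OF open_\<Omega> smooth_on_Ck[OF smooth_G]] by blast

lemma smooth_H: "smooth_on \<Omega> (\<lambda>z. H z v w)"
  unfolding H_def by (intro smooth_on_derivative_const smooth_G)

lemma bl_proj: "bounded_linear (orth_proj T)"
  using linear_orth_proj[OF T] by (simp add: linear_conv_bounded_linear)

lemma proj_DG:
  assumes "z \<in> \<Omega>" shows "orth_proj T (DG z v) = orth_proj T v"
proof -
  have "((\<lambda>z. orth_proj T (G z)) has_derivative (\<lambda>v. orth_proj T (DG z v))) (at z)"
    using bounded_linear.has_derivative[OF bl_proj DG_has_derivative[OF assms]] .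
  then have "(orth_proj T has_derivative (\<lambda>v. orth_proj T (DG z v))) (at z)"
    by (rule has_derivative_transform_within_open[OF _ open_\<Omega> assms]) (rule proj_G)
  moreover have "(orth_proj T has_derivative orth_proj T) (at z)"
    using bl_proj bounded_linear_imp_has_derivative by blast
  ultimately show ?thesis using has_derivative_unique by metis
qed

lemma shift:
  assumes "w \<in> \<Omega>" "orth_proj T a = 0" shows "w + a \<in> \<Omega>" "G (w + a) = G w"
  using G_cyl[OF assms(1), of "w + a"] assms(2) linear_add[OF linear_orth_proj[OF T]] by auto

lemma DG_perp:
  assumes "z \<in> \<Omega>" "orth_proj T a = 0" shows "DG z a = 0"
proof -
  have "((\<lambda>t. G (z + t *\<^sub>R a)) has_vector_derivative DG z a) (at 0)"
    using has_derivative_along_line[of G "DG z" z 0 a] DG_has_derivative assms by simp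
  moreover have "G (z + t *\<^sub>R a) = G z" for t
    using shift assms linear_scale[OF linear_orth_proj[OF T]] by (metis scaleR_zero_right)
  ultimately have "((\<lambda>t::real. G z) has_vector_derivative DG z a) (at 0)" by simp
  then show ?thesis using has_vector_derivative_const vector_derivative_unique_at by blast
qed

lemma proj_idem: "orth_proj T (orth_proj T v) = orth_proj T v"
  using orth_proj_id orth_proj_in T by blast

lemma proj_diff: "orth_proj T (a - b) = orth_proj T a - orth_proj T b"
  using linear_diff linear_orth_proj[OF T] by blast

lemma DG_cong: "z \<in> \<Omega> \<Longrightarrow> orth_proj T v = orth_proj T w \<Longrightarrow> DG z v = DG z w"
  using DG_perp[of z "v - w"] linear_diff[OF linear_DG] by (simp add: proj_diff)

lemma DG_shift: "z \<in> \<Omega> \<Longrightarrow> orth_proj T a = 0 \<Longrightarrow> DG (z + a) = DG z"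
  by (rule frechet_derivative_shift_invariant[OF open_\<Omega>])
    (use shift DG_has_derivative[of "z + a"] in \<open>auto simp: differentiable_def\<close>)

lemma H_shift:
  assumes "z \<in> \<Omega>" "orth_proj T a = 0" shows "H (z + a) v w = H z v w"
  unfolding H_def
  by (subst frechet_derivative_shift_invariant[OF open_\<Omega>, of a])
    (use assms shift DG_shift H_has_derivative[of "z + a"] in \<open>force simp: differentiable_def\<close>)+

text \<open>\<open>G z - z\<close> is orthogonal to \<open>T\<close>, and nothing changes in such
  directions. So the Hessian at a point of \<open>M\<close> can be read off at any point with the
  same projection, in particular on a segment parallel to \<open>T\<close>.\<close>

lemma H_G: "z \<in> \<Omega> \<Longrightarrow> H (G z) v w = H z v w"
  using H_shift[of z "G z - z"] proj_G by (simp add: proj_diff)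

lemma H_perp:
  assumes "z \<in> \<Omega>" "orth_proj T a = 0" shows "H z v a = 0"
proof -
  have "((\<lambda>z. 0) has_derivative (\<lambda>v. H z v a)) (at z)"
    by (rule has_derivative_transform_within_open[OF H_has_derivative[OF assms(1)] open_\<Omega> assms(1)])
      (use DG_perp assms in auto)
  then show ?thesis using has_derivative_unique[OF has_derivative_const] by metis
qed

lemma H_cong2: "z \<in> \<Omega> \<Longrightarrow> orth_proj T w = orth_proj T w' \<Longrightarrow> H z v w = H z v w'"
  using H_perp[of z "w - w'" v] linear_diff[OF linear_H2] by (simp add: proj_diff)

lemma H_cong1: "z \<in> \<Omega> \<Longrightarrow> orth_proj T w = orth_proj T w' \<Longrightarrow> H z w v = H z w' v"
  using H_cong2 H_sym by metis

text \<open>The \<open>T\<close>-part of \<open>DG z w\<close> is \<open>orth_proj T w\<close>,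
  independent of \<open>z\<close>.\<close>

lemma proj_H:
  assumes "z \<in> \<Omega>" shows "orth_proj T (H z v w) = 0"
proof -
  have "((\<lambda>z. orth_proj T (DG z w)) has_derivative (\<lambda>v. orth_proj T (H z v w))) (at z)"
    using bounded_linear.has_derivative[OF bl_proj H_has_derivative[OF assms]] .
  then have "((\<lambda>z. orth_proj T w) has_derivative (\<lambda>v. orth_proj T (H z v w))) (at z)"
    by (rule has_derivative_transform_within_open[OF _ open_\<Omega> assms]) (rule proj_DG)
  then show ?thesis using has_derivative_unique[OF has_derivative_const] by metis
qed

lemma U_in: "q \<in> M \<inter> U \<Longrightarrow> q \<in> \<Omega>" using U_\<Omega> by auto

lemma DG_tangent: "q \<in> M \<inter> U \<Longrightarrow> DG q v \<in> tangent_space M q"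
  using tangent_space_image_line[OF open_\<Omega> _ smooth_G, of q v UNIV M] U_in G_in G_id by force

text \<open>Inside \<open>U\<close> the points of \<open>M\<close> are the points fixed by
  \<open>G\<close>; infinitesimally, tangent vectors are those fixed by its derivative.\<close>

lemma tangent_iff:
  assumes "q \<in> M \<inter> U" shows "x \<in> tangent_space M q \<longleftrightarrow> DG q x = x"
proof
  assume "x \<in> tangent_space M q"
  then obtain \<gamma> where c: "smooth_curve_in M q x \<gamma>" by (auto simp: tangent_space_def)
  have "((\<lambda>t. G (\<gamma> t)) has_vector_derivative DG q x) (at 0)"
    using has_vector_derivative_compose_smooth smooth_curve_inD[OF c] DG_has_derivative[OF U_in[OF assms]] by metis
  moreover have "eventually (\<lambda>t. \<gamma> t = G (\<gamma> t)) (nhds 0)"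
    using smooth_curve_in_eventually[OF c open_U] assms by (auto elim!: eventually_mono simp: G_id)
  ultimately show "DG q x = x" using vector_derivative_eventually_eq smooth_curve_inD(2)[OF c] by metis
qed (metis DG_tangent assms)

lemma subspace_tangent: "q \<in> M \<inter> U \<Longrightarrow> subspace (tangent_space M q)"
  using linear_DG[OF U_in] by (auto simp: subspace_def tangent_iff linear_0 linear_add linear_scale)

lemma DG_idem: "q \<in> M \<inter> U \<Longrightarrow> DG q (DG q v) = DG q v"
  using tangent_iff DG_tangent by blast

lemma DG_proj: "z \<in> \<Omega> \<Longrightarrow> DG z (orth_proj T v) = DG z v"
  by (rule DG_cong) (auto simp: proj_idem)

text \<open>Every tangent field satisfies \<open>Y p = DG p (Y p)\<close> on \<open>M\<close>. Its
  derivative is therefore the Hessian term plus a value of \<open>DG q\<close>, and the latter is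
  tangent, so the normal part sees \<open>Y\<close> only through its value at
  \<open>q\<close>.\<close>

lemma second_fundamental_form_eq:
  assumes q: "q \<in> M \<inter> U" and x: "x \<in> tangent_space M q" and y: "y \<in> tangent_space M q"
  shows "second_fundamental_form M q x y = orth_proj (orthogonal_comp (tangent_space M q)) (H q x y)"
  unfolding second_fundamental_form_def
proof (rule the_equality)
  let ?N = "orth_proj (orthogonal_comp (tangent_space M q))"
  let ?Y = "\<lambda>z. DG z y"
  have "smooth_section (M \<inter> U) (tangent_space M) ?Y"
    unfolding smooth_section_def
    using smooth_on_imp_along[OF open_\<Omega> smooth_on_derivative_const[OF smooth_G]] U_\<Omega> DG_tangent by blast
  moreover have "nabla (M \<inter> U) ?Y q x = H q x y"
    unfolding H_def
    by (rule nabla_eq[OF open_\<Omega> U_in[OF q] smooth_on_derivative_const[OF smooth_G]])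
      (use q x tangent_space_Int_open[OF open_U] in auto)
  moreover have "?Y q = y" using y tangent_iff[OF q] by simp
  ultimately show "\<exists>V Y. open V \<and> q \<in> V \<and> smooth_section (M \<inter> V) (tangent_space M) Y \<and> Y q = y \<and>
      ?N (H q x y) = ?N (nabla (M \<inter> V) Y q x)"
    using open_U q by (intro exI[of _ U] exI[of _ ?Y]) auto
next
  let ?N = "orth_proj (orthogonal_comp (tangent_space M q))"
  fix w assume "\<exists>V Y. open V \<and> q \<in> V \<and> smooth_section (M \<inter> V) (tangent_space M) Y \<and> Y q = y \<and>
      w = ?N (nabla (M \<inter> V) Y q x)"
  then obtain V Y where V: "open V" "q \<in> V" and Y: "smooth_along (M \<inter> V) Y"
    "\<And>p. p \<in> M \<inter> V \<Longrightarrow> Y p \<in> tangent_space M p" "Y q = y" and w: "w = ?N (nabla (M \<inter> V) Y q x)"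
    by (auto simp: smooth_section_def)
  obtain W g where W: "open W" "q \<in> W" and g: "smooth_on W g" "\<And>p. p \<in> M \<inter> V \<inter> W \<Longrightarrow> Y p = g p"
    using smooth_alongE[OF Y(1), of q] q V by blast
  have x': "x \<in> tangent_space (M \<inter> V) q" using x tangent_space_Int_open V by blast
  let ?W = "W \<inter> U" and ?F = "\<lambda>z. DG z (g z)"
  have qW: "open ?W" "q \<in> ?W" "q \<in> \<Omega>" using W open_U q U_in by auto
  have sg: "smooth_on ?W g" "smooth_on ?W G" using g smooth_G U_\<Omega> by (auto intro: smooth_on_subset)
  have F: "Y p = ?F p" if "p \<in> (M \<inter> V) \<inter> ?W" for p
    using that g(2)[of p] Y(2)[of p] tangent_iff[of p] by auto
  have "nabla (M \<inter> V) Y q x = frechet_derivative ?F (at q) x"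
    by (rule nabla_eq[OF qW(1,2) _ F x']) (intro smooth_on_derivative sg qW)
  also have "\<dots> = H q x (g q) + DG q (frechet_derivative g (at q) x)"
    using frechet_derivative_at[OF has_derivative_derivative_family[OF qW(1) sg(2) qW(2)
      smooth_on_has_derivative[OF sg(1) qW(2)]], symmetric] by (simp add: H_def)
  also have "g q = y" using g(2)[of q] Y(3) q V W by auto
  finally have "w = ?N (H q x y + DG q (frechet_derivative g (at q) x))" using w by simp
  moreover have "?N (DG q v) = 0" for v
  proof (rule orth_proj_eq_0[OF subspace_orthogonal_comp])
    show "DG q v \<in> orthogonal_comp (orthogonal_comp (tangent_space M q))"
      using DG_tangent[OF q, of v] orthogonal_comp_orthogonal_comp[OF subspace_tangent[OF q]] by simp
  qed
  ultimately show "w = ?N (H q x y)"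
    by (simp only: linear_add[OF linear_orth_proj[OF subspace_orthogonal_comp]] add_0_right)
qed

text \<open>Taking the normal part loses nothing: \<open>H\<close> has no
  \<open>T\<close>-component, and a tangent vector without \<open>T\<close>-component is both fixed
  and killed by \<open>DG q\<close>.\<close>

lemma second_fundamental_form_eq_0_iff:
  assumes q: "q \<in> M \<inter> U" and x: "x \<in> tangent_space M q" "y \<in> tangent_space M q"
  shows "second_fundamental_form M q x y = 0 \<longleftrightarrow> H q x y = 0"
proof -
  have "H q x y = 0" if "H q x y \<in> tangent_space M q"
  proof -
    have "DG q (H q x y) = H q x y" using that tangent_iff[OF q] by simp
    then show ?thesis using DG_perp[OF U_in[OF q] proj_H[OF U_in[OF q]]] by metis
  qed
  moreover have "0 \<in> tangent_space M q" using subspace_tangent[OF q] subspace_0 by blast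
  ultimately have "H q x y = 0 \<longleftrightarrow> H q x y \<in> tangent_space M q" by metis
  then have "H q x y = 0 \<longleftrightarrow> H q x y \<in> orthogonal_comp (orthogonal_comp (tangent_space M q))"
    by (simp add: orthogonal_comp_orthogonal_comp[OF subspace_tangent[OF q]])
  then show ?thesis
    using second_fundamental_form_eq[OF assms] orth_proj_eq_0_iff[OF subspace_orthogonal_comp] by simp
qed

abbreviation "Null \<equiv> relative_nullity M"

text \<open>\<open>H\<close> sees its second argument through \<open>orth_proj T\<close> only, and
  \<open>DG q y\<close> has the same projection as \<open>y\<close>; so testing on tangent vectors
  amounts to testing on all vectors.\<close>

lemma Null_iff:
  assumes q: "q \<in> M \<inter> U"
  shows "x \<in> Null q \<longleftrightarrow> x \<in> tangent_space M q \<and> (\<forall>y. H q x y = 0)"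
proof -
  have "H q x y = H q x (DG q y)" for y using H_cong2[OF U_in[OF q]] proj_DG[OF U_in[OF q]] by metis
  then show ?thesis
    unfolding relative_nullity_def using second_fundamental_form_eq_0_iff[OF q] DG_tangent[OF q] by auto
qed

end

text \<open>The slice chart is straightened until, on the slice, it becomes the projection onto the
  tangent space \<open>T\<close>. Its inverse then lifts \<open>T\<close> to \<open>M\<close>, and
  \<open>G\<close> projects to \<open>T\<close> before lifting.\<close>

lemma embedded_submanifold_tangent_graph:
  fixes M :: "'a::euclidean_space set"
  assumes "embedded_submanifold k M" "p \<in> M"
  obtains \<Omega> U G where "smooth_graph M (tangent_space M p) \<Omega> U G" "p \<in> U" "dim (tangent_space M p) = k"
proof -
  obtain U V and f :: "'a \<Rightarrow> 'a" and L where U: "open U" "p \<in> U" "open V"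
    and "diffeomorphism_between U V f" and L: "subspace L" "dim L = k" and fM: "f ` (M \<inter> U) = V \<inter> L"
    using assms unfolding embedded_submanifold_def by meson
  then obtain g where f: "smooth_on U f" "f ` U = V" and g: "smooth_on V g" "\<And>x. x \<in> U \<Longrightarrow> g (f x) = x"
    unfolding diffeomorphism_between_def by auto
  have fg: "f (g y) = y \<and> g y \<in> U" if y: "y \<in> V" for y
  proof -
    obtain x where "x \<in> U" "y = f x" using y f(2) by blast
    then show ?thesis using g(2) by simp
  qed
  have gM: "g y \<in> M" if "y \<in> V \<inter> L" for y using that fM g(2) by (metis Int_iff imageE)
  have fL: "f q \<in> V \<inter> L" if "q \<in> M \<inter> U" for q using that fM by blast
  define y0 where "y0 = f p"
  have y0: "y0 \<in> V" "y0 \<in> L" "g y0 = p" using fL[of p] g(2) U assms by (auto simp: y0_def)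
  define B where "B = frechet_derivative g (at y0)"
  have gB: "(g has_derivative B) (at y0)" using smooth_on_has_derivative[OF g(1) y0(1)] by (simp add: B_def)
  have fp: "(f has_derivative frechet_derivative f (at p)) (at p)" using smooth_on_has_derivative[OF f(1) U(2)] .
  have linB: "linear B" using gB has_derivative_linear by blast
  have DfB: "frechet_derivative f (at p) (B v) = v" for v
  proof -
    have "((\<lambda>y. f (g y)) has_derivative (\<lambda>v. frechet_derivative f (at p) (B v))) (at y0)"
      using has_derivative_compose[OF gB] fp y0 by simp
    then have "((\<lambda>y. y) has_derivative (\<lambda>v. frechet_derivative f (at p) (B v))) (at y0)"
      by (rule has_derivative_transform_within_open[OF _ U(3) y0(1)]) (simp add: fg)
    then show ?thesis using has_derivative_unique[OF has_derivative_ident] by metis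
  qed
  have BDf: "B (frechet_derivative f (at p) v) = v" for v
  proof -
    have "((\<lambda>x. g (f x)) has_derivative (\<lambda>v. B (frechet_derivative f (at p) v))) (at p)"
      using has_derivative_compose[OF fp] gB by (simp add: y0_def)
    then have "((\<lambda>y. y) has_derivative (\<lambda>v. B (frechet_derivative f (at p) v))) (at p)"
      by (rule has_derivative_transform_within_open[OF _ U(1,2)]) (rule g)
    then show ?thesis using has_derivative_unique[OF has_derivative_ident] by metis
  qed
  have injB: "inj B" using DfB by (metis injI)
  define T where "T = B ` L"
  have T: "subspace T" using L linB by (simp add: T_def linear_subspace_image)
  have tangent: "tangent_space M p = T"
  proof
    show "tangent_space M p \<subseteq> T"
    proof
      fix v assume "v \<in> tangent_space M p"
      from tangent_space_image[OF this U(1,2) f(1), of "V \<inter> L"] fL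
      have "frechet_derivative f (at p) v \<in> tangent_space (V \<inter> L) (f p)" by blast
      then have "frechet_derivative f (at p) v \<in> L" using tangent_space_subspace_subset[OF L(1), of "V \<inter> L"] by blast
      then show "v \<in> T" using BDf by (metis T_def imageI)
    qed
    show "T \<subseteq> tangent_space M p"
    proof
      fix v assume "v \<in> T"
      then obtain l where l: "l \<in> L" "v = B l" by (auto simp: T_def)
      have "B l \<in> tangent_space M (g y0)"
        unfolding B_def
        by (rule tangent_space_image_line[OF U(3) y0(1) g(1), of l L])
          (use gM y0 l L in \<open>auto intro: subspace_add subspace_scale\<close>)
      then show "v \<in> tangent_space M p" using l y0 by simp
    qed
  qed
  have dimT: "dim T = k" using dim_image_eq[OF linB] injB L by (simp add: T_def inj_on_subset)
  let ?P = "orth_proj T"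
  \<comment> \<open>\<open>chi\<close> takes its \<open>T\<close>-part from \<open>g\<close> and its
    normal part from the linearization \<open>B\<close>. Its derivative at \<open>y0\<close> is thus
    the injective \<open>B\<close>, while on \<open>L\<close>, where \<open>B y\<close> lies in
    \<open>T\<close>, it equals the projection of \<open>g y\<close>.\<close>
  define chi where "chi y = ?P (g y) + (B y - ?P (B y))" for y
  have linP: "linear ?P" using linear_orth_proj[OF T] .
  have blP: "bounded_linear ?P" and blB: "bounded_linear B" using linP linB by (simp_all add: linear_conv_bounded_linear)
  have smchi: "smooth_on V chi"
    unfolding chi_def
    using smooth_on_bounded_linear_comp[OF blP U(3) g(1)] smooth_on_bounded_linear_comp[OF blB U(3) smooth_on_id[OF U(3)]]
      smooth_on_bounded_linear_comp[OF blP U(3) smooth_on_bounded_linear_comp[OF blB U(3) smooth_on_id[OF U(3)]]]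
    by (intro smooth_on_add smooth_on_diff U(3))
  have "(chi has_derivative (\<lambda>v. ?P (B v) + (B v - ?P (B v)))) (at y0)"
    unfolding chi_def
    using bounded_linear.has_derivative[OF blP gB] bounded_linear_imp_has_derivative[OF blB]
      bounded_linear.has_derivative[OF blP bounded_linear_imp_has_derivative[OF blB]]
    by (intro has_derivative_add has_derivative_diff)
  then have "frechet_derivative chi (at y0) = B" using frechet_derivative_at by fastforce
  with injB obtain V1 Z \<kappa> where V1: "open V1" "V1 \<subseteq> V" "y0 \<in> V1" "open Z" "chi ` V1 = Z" "\<kappa> ` Z = V1"
    "smooth_on Z \<kappa>" "\<And>y. y \<in> V1 \<Longrightarrow> \<kappa> (chi y) = y" "\<And>z. z \<in> Z \<Longrightarrow> chi (\<kappa> z) = z"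
    using smooth_inverse_function[OF U(3) smchi y0(1)] by metis
  have idemP: "?P (?P z) = ?P z" for z using orth_proj_id orth_proj_in T by blast
  have Pchi: "?P (chi y) = ?P (g y)" for y
    by (simp add: chi_def linear_add[OF linP] linear_diff[OF linP] idemP)
  have chiL: "chi y = ?P (g y)" if "y \<in> L" for y
    using that orth_proj_id[OF T, of "B y"] by (simp add: chi_def T_def)
  \<comment> \<open>Conversely, a value in \<open>T\<close> forces the normal part of
    \<open>B y\<close> to vanish, hence \<open>y\<close> to lie in \<open>L\<close>.\<close>
  have inL: "y \<in> L" if "chi y = ?P z" for y z
  proof -
    have "?P (g y) = ?P z" using arg_cong[OF that, of ?P] by (simp add: Pchi idemP)
    then have "B y = ?P (B y)" using that by (simp add: chi_def)
    then have "B y \<in> T" using orth_proj_in[OF T] by metis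
    then show ?thesis using injB by (auto simp: T_def inj_def)
  qed
  define G where "G z = g (\<kappa> (?P z))" for z
  define U0 where "U0 = U \<inter> f -` V1"
  have contf: "continuous_on U f" using f smooth_on_continuous_on by blast
  have openU0: "open U0" unfolding U0_def using contf U(1) V1(1) continuous_open_preimage by blast
  have pU0: "p \<in> U0" using U V1 by (simp add: U0_def flip: y0_def)
  define \<Omega>0 where "\<Omega>0 = ?P -` Z"
  have open\<Omega>0: "open \<Omega>0" unfolding \<Omega>0_def
    using V1(4) linear_continuous_on[OF blP] by (intro open_vimage) auto
  have G0: "G z \<in> M" "?P (G z) = ?P z" if "z \<in> \<Omega>0" for z
  proof -
    have z: "?P z \<in> Z" "\<kappa> (?P z) \<in> V" using that V1 by (auto simp: \<Omega>0_def)
    then have "\<kappa> (?P z) \<in> L" using inL V1(9) by blast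
    then show "G z \<in> M" using gM z by (simp add: G_def)
    show "?P (G z) = ?P z" using V1(9)[OF z(1)] Pchi[of "\<kappa> (?P z)"] idemP by (simp add: G_def)
  qed
  have smG0: "smooth_on \<Omega>0 G"
  proof -
    have "smooth_on \<Omega>0 (\<lambda>z. \<kappa> (?P z))"
      by (rule smooth_on_compose[OF open\<Omega>0 V1(4) smooth_on_bounded_linear_comp[OF blP open\<Omega>0 smooth_on_id[OF open\<Omega>0]] V1(7)])
        (auto simp: \<Omega>0_def)
    then show ?thesis unfolding G_def
      by (rule smooth_on_compose[OF open\<Omega>0 U(3) _ g(1)]) (use V1 in \<open>auto simp: \<Omega>0_def\<close>)
  qed
  \<comment> \<open>Base points are discarded whose lift leaves \<open>U0\<close>, the region in
    which \<open>G\<close> is known to fix the points of \<open>M\<close>.\<close>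
  define \<Omega> where "\<Omega> = \<Omega>0 \<inter> G -` U0"
  have open\<Omega>: "open \<Omega>" unfolding \<Omega>_def
    using smG0 smooth_on_continuous_on continuous_open_preimage open\<Omega>0 openU0 by blast
  have Gid: "?P q \<in> Z" "G q = q" if "q \<in> M \<inter> U0" for q
  proof -
    have y: "f q \<in> L" "f q \<in> V1" "g (f q) = q" using that fL g(2) by (auto simp: U0_def)
    then have e: "chi (f q) = ?P q" using chiL by simp
    show "?P q \<in> Z" using e V1(5) y by (metis imageI)
    show "G q = q" using V1(8)[OF y(2)] e y by (simp add: G_def)
  qed
  have "smooth_graph M T \<Omega> (U0 \<inter> \<Omega>) G"
  proof
    show "G z \<in> M \<inter> (U0 \<inter> \<Omega>)" if "z \<in> \<Omega>" for z
    proof -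
      have z: "z \<in> \<Omega>0" "G z \<in> U0" using that by (auto simp: \<Omega>_def)
      have "G z \<in> \<Omega>0" using z G0(2)[OF z(1)] by (auto simp: \<Omega>0_def)
      moreover have "G (G z) = G z" using G0(2)[OF z(1)] by (simp add: G_def)
      ultimately show ?thesis using z G0 by (auto simp: \<Omega>_def)
    qed
    show "z' \<in> \<Omega> \<and> G z' = G z" if "z \<in> \<Omega>" "?P z' = ?P z" for z z'
      using that by (auto simp: \<Omega>_def \<Omega>0_def G_def)
  qed (use T open\<Omega> openU0 smooth_on_subset[OF _ smG0] G0 Gid in \<open>auto simp: \<Omega>_def\<close>)
  moreover have "p \<in> U0 \<inter> \<Omega>" using pU0 Gid[of p] assms by (auto simp: \<Omega>_def \<Omega>0_def)
  ultimately show ?thesis using that tangent dimT by metis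
qed

section \<open>Rulings of submanifolds of constant rank\<close>

text \<open>The product \<open>u t * exp (- B * t)\<close> is nonincreasing and starts at
  zero.\<close>

lemma gronwall_zero:
  fixes u :: "real \<Rightarrow> real"
  assumes "\<And>t. 0 \<le> t \<Longrightarrow> t \<le> 1 \<Longrightarrow> DERIV u t :> u' t" "\<And>t. 0 \<le> t \<Longrightarrow> t \<le> 1 \<Longrightarrow> u' t \<le> B * u t"
    and "u 0 = 0" "\<And>t. 0 \<le> t \<Longrightarrow> t \<le> 1 \<Longrightarrow> 0 \<le> u t" and t: "0 \<le> t" "t \<le> 1"
  shows "u t = 0"
proof -
  have "u t * exp (- B * t) \<le> u 0 * exp (- B * 0)"
  proof (rule DERIV_nonpos_imp_nonincreasing[OF t(1)])
    fix x assume x: "0 \<le> x" "x \<le> t"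
    have "DERIV (\<lambda>t. u t * exp (- B * t)) x :> u' x * exp (- B * x) + u x * (exp (- B * x) * - B)"
      using assms(1)[of x] x t by (auto intro!: derivative_eq_intros)
    moreover have "u' x * exp (- B * x) + u x * (exp (- B * x) * - B) = (u' x - B * u x) * exp (- B * x)"
      by (simp add: algebra_simps)
    moreover have "(u' x - B * u x) * exp (- B * x) \<le> 0"
      using assms(2)[of x] x t by (intro mult_nonpos_nonneg) auto
    ultimately show "\<exists>y. DERIV (\<lambda>t. u t * exp (- B * t)) x :> y \<and> y \<le> 0" by metis
  qed
  then have "u t * exp (- B * t) \<le> 0" using assms(3) by simp
  then have "u t \<le> 0" by (metis exp_gt_zero mult_le_0_iff not_less)
  then show ?thesis using assms(4)[OF t] by simp
qed

text \<open>By domination, \<open>norm d * g t - h t \<bullet> d\<close> has a local minimum at 0,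
  so its derivative there, \<open>- (d \<bullet> d)\<close>, vanishes.\<close>

lemma vector_derivative_zero_if_dominated:
  fixes h :: "real \<Rightarrow> 'a::real_inner"
  assumes h: "(h has_vector_derivative d) (at 0)" "h 0 = 0"
    and g: "DERIV g 0 :> 0" "g 0 = 0" and le: "e > 0" "\<And>t. \<bar>t\<bar> < e \<Longrightarrow> norm (h t) \<le> g t"
  shows "d = 0"
proof -
  have "((\<lambda>t. h t \<bullet> d) has_vector_derivative d \<bullet> d) (at 0)"
    by (rule bounded_linear.has_vector_derivative[OF bounded_linear_inner_left h(1)])
  then have "DERIV (\<lambda>t. norm d * g t - h t \<bullet> d) 0 :> norm d * 0 - d \<bullet> d"
    by (intro DERIV_diff DERIV_cmult g) (simp add: has_real_derivative_iff_has_vector_derivative)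
  moreover have "norm d * g 0 - h 0 \<bullet> d \<le> norm d * g t - h t \<bullet> d" if "\<bar>0 - t\<bar> < e" for t
  proof -
    have "h t \<bullet> d \<le> norm (h t) * norm d" by (rule norm_cauchy_schwarz)
    also have "\<dots> \<le> g t * norm d" using le(2)[of t] that by (intro mult_right_mono) auto
    finally show ?thesis using h(2) g(2) by (simp add: mult.commute)
  qed
  ultimately have "norm d * 0 - d \<bullet> d = 0" using DERIV_local_min le(1) by blast
  then show ?thesis by simp
qed

lemma subspace_sum_decomposition:
  fixes A B T :: "'a::euclidean_space set"
  assumes "subspace A" "subspace B" "subspace T" "A \<subseteq> T" "B \<subseteq> T" "A \<inter> B \<subseteq> {0}" "dim T \<le> dim A + dim B"
    and "x \<in> T"
  obtains a b where "a \<in> A" "b \<in> B" "x = a + b"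
proof -
  let ?S = "{x + y |x y. x \<in> A \<and> y \<in> B}"
  have "A \<inter> B = {0}" using assms(6) subspace_0[OF assms(1)] subspace_0[OF assms(2)] by auto
  then have "dim ?S = dim A + dim B" using dim_sums_Int[OF assms(1,2)] by simp
  moreover have "subspace ?S" using subspace_sums assms by blast
  moreover have "?S \<subseteq> T" using assms subspace_add by blast
  ultimately have "?S = T" using subspace_dim_equal[of ?S T] assms(3,7) by simp
  then show ?thesis using that assms(8) by blast
qed

lemma norm_bilinear_le:
  fixes b :: "'a::euclidean_space \<Rightarrow> 'b::euclidean_space \<Rightarrow> 'c::real_normed_vector"
  assumes "\<And>w. linear (\<lambda>v. b v w)" "\<And>v. linear (b v)"
  shows "norm (b v w) \<le> (\<Sum>i\<in>Basis. \<Sum>j\<in>Basis. norm (b i j)) * norm v * norm w"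
proof -
  have "b v w = (\<Sum>i\<in>Basis. \<Sum>j\<in>Basis. (v \<bullet> i) *\<^sub>R (w \<bullet> j) *\<^sub>R b i j)"
    using linear_Basis_expansion[OF assms(1), of v w] linear_Basis_expansion[OF assms(2), of _ w]
    by (simp add: scaleR_sum_right)
  also have "norm \<dots> \<le> (\<Sum>i\<in>Basis. \<Sum>j\<in>Basis. norm v * norm w * norm (b i j))"
  proof (intro sum_norm_le)
    fix i :: 'a and j :: 'b assume "i \<in> Basis" "j \<in> Basis"
    then have "\<bar>v \<bullet> i\<bar> * \<bar>w \<bullet> j\<bar> \<le> norm v * norm w" by (intro mult_mono Basis_le_norm) auto
    then have "\<bar>v \<bullet> i\<bar> * \<bar>w \<bullet> j\<bar> * norm (b i j) \<le> norm v * norm w * norm (b i j)" by (rule mult_right_mono) simp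
    then show "norm ((v \<bullet> i) *\<^sub>R (w \<bullet> j) *\<^sub>R b i j) \<le> norm v * norm w * norm (b i j)" by (simp add: mult.assoc abs_mult)
  qed
  finally show ?thesis by (simp add: sum_distrib_left sum_distrib_right mult_ac)
qed

lemma sum_abs_inner_le_norm: "(\<Sum>i\<in>Basis. \<bar>v \<bullet> i\<bar> * f i) \<le> norm v * (\<Sum>i\<in>Basis. f i)"
  if "\<And>i. 0 \<le> f i" for f :: "'a::euclidean_space \<Rightarrow> real" and v :: 'a
  unfolding sum_distrib_left using that by (intro sum_mono mult_right_mono Basis_le_norm)

section \<open>Nullity spaces and the third derivative in a graph chart\<close>

context smooth_graph
begin

text \<open>The nullity space moved into \<open>T\<close> by projection: subspaces of one fixed
  space can be compared at different points.\<close>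

definition "Delta z = {v \<in> T. \<forall>y. H z v y = 0}"

lemma subspace_Delta:
  assumes "z \<in> \<Omega>" shows "subspace (Delta z)"
  using T linear_0[OF linear_H1[OF assms]] linear_add[OF linear_H1[OF assms]] linear_scale[OF linear_H1[OF assms]]
  unfolding Delta_def subspace_def by simp

text \<open>The projection onto \<open>T\<close> is injective on the tangent space, where
  \<open>DG\<close> inverts it, and it maps the nullity onto \<open>Delta z\<close>.\<close>

lemma dim_Delta:
  assumes z: "z \<in> \<Omega>" shows "dim (Delta z) = dim (Null (G z))"
proof -
  let ?q = "G z" and ?P = "orth_proj T"
  have q: "?q \<in> M \<inter> U" using G_in z by blast
  have N: "x \<in> Null ?q \<longleftrightarrow> DG ?q x = x \<and> (\<forall>y. H z x y = 0)" for x
    using Null_iff[OF q] tangent_iff[OF q] H_G[OF z] by simp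
  have "Delta z = ?P ` Null ?q"
  proof (intro equalityI subsetI)
    fix v assume v: "v \<in> Delta z"
    have Pv: "?P (DG ?q v) = v" using v proj_DG[OF U_in[OF q]] orth_proj_id[OF T] by (auto simp: Delta_def)
    have "H z (DG ?q v) y = H z v y" for y using H_cong1[OF z] Pv proj_idem by metis
    then have "DG ?q v \<in> Null ?q" using v N DG_idem[OF q] by (auto simp: Delta_def)
    then show "v \<in> ?P ` Null ?q" using Pv by (metis imageI)
  next
    fix v assume "v \<in> ?P ` Null ?q"
    then obtain x where x: "x \<in> Null ?q" "v = ?P x" by blast
    have "H z v y = H z x y" for y using H_cong1[OF z] x proj_idem by metis
    then show "v \<in> Delta z" using x N orth_proj_in[OF T] by (auto simp: Delta_def)
  qed
  moreover have "inj_on ?P (span (Null ?q))"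
  proof -
    have "Null ?q \<subseteq> tangent_space M ?q" using Null_iff[OF q] by blast
    then have "span (Null ?q) \<subseteq> tangent_space M ?q" using subspace_tangent[OF q] span_minimal by blast
    moreover have "inj_on ?P (tangent_space M ?q)"
      using tangent_iff[OF q] DG_cong[OF U_in[OF q]] by (intro inj_onI) metis
    ultimately show ?thesis using inj_on_subset by blast
  qed
  ultimately show ?thesis using dim_image_eq[OF linear_orth_proj[OF T]] by metis
qed

text \<open>The third derivative of \<open>G\<close>, with \<open>w\<close> the first and
  \<open>u\<close> the last direction of differentiation.\<close>

definition "K z u v w = frechet_derivative (\<lambda>z. H z v w) (at z) u"

lemma K_has_derivative: "z \<in> \<Omega> \<Longrightarrow> ((\<lambda>z. H z v w) has_derivative (\<lambda>u. K z u v w)) (at z)"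
  unfolding K_def using smooth_on_has_derivative[OF smooth_H] .

lemma K_sym12: "z \<in> \<Omega> \<Longrightarrow> K z u v w = K z v u w"
  unfolding K_def H_def
  using second_derivative_symmetric[OF open_\<Omega> smooth_on_Ck[OF smooth_on_derivative_const[OF smooth_G]]] by blast

lemma K_sym23: assumes "z \<in> \<Omega>" shows "K z u v w = K z u w v"
proof -
  have "((\<lambda>z. H z w v) has_derivative (\<lambda>u. K z u v w)) (at z)"
    by (rule has_derivative_transform_within_open[OF K_has_derivative[OF assms] open_\<Omega> assms]) (rule H_sym)
  then show ?thesis using has_derivative_unique[OF K_has_derivative[OF assms]] by metis
qed

lemma linear_K1: "z \<in> \<Omega> \<Longrightarrow> linear (\<lambda>u. K z u v w)"
  using K_has_derivative has_derivative_linear by blast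

lemma linear_K2: "z \<in> \<Omega> \<Longrightarrow> linear (\<lambda>v. K z u v w)"
  using linear_K1[of z u w] K_sym12[of z u] by simp

lemma linear_K3: "z \<in> \<Omega> \<Longrightarrow> linear (\<lambda>w. K z u v w)"
  using linear_K2[of z u v] K_sym23[of z u v] by simp

text \<open>A seminorm in \<open>v\<close> whose kernel inside \<open>T\<close> is
  \<open>Delta z\<close>; it measures how far a vector is transversal to the nullity.\<close>

definition "N1 z v = (\<Sum>j\<in>Basis. norm (H z v j))"

lemma N1_le:
  assumes "z \<in> \<Omega>" "(\<Sum>i\<in>Basis. \<Sum>j\<in>Basis. norm (H z i j)) \<le> C"
  shows "norm (H z v w) \<le> C * norm v * norm w"
proof -
  have "norm (H z v w) \<le> (\<Sum>i\<in>Basis. \<Sum>j\<in>Basis. norm (H z i j)) * norm v * norm w"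
    by (rule norm_bilinear_le) (use linear_H1 linear_H2 assms(1) in auto)
  also have "\<dots> \<le> C * norm v * norm w" using assms(2) by (intro mult_right_mono) auto
  finally show ?thesis .
qed

lemma N1_cong: "z \<in> \<Omega> \<Longrightarrow> v - w \<in> Delta z \<Longrightarrow> N1 z v = N1 z w"
  using linear_diff[OF linear_H1] unfolding N1_def Delta_def by simp

text \<open>At \<open>p\<close> the seminorm has a positive minimum on the compact unit sphere of
  \<open>W\<close>. At \<open>z\<close> it differs by at most \<open>norm w * \<delta> z\<close>, so
  half of the bound survives where \<open>\<delta> z < \<kappa> / 2\<close>.\<close>

lemma N1_lower_bound_near:
  assumes p: "p \<in> \<Omega>" and W: "subspace W" "W \<inter> Delta p \<subseteq> {0}" "W \<subseteq> T"
  shows "\<exists>r>0. \<exists>\<kappa>>0. ball p r \<subseteq> \<Omega> \<and> (\<forall>z\<in>ball p r. \<forall>w\<in>W. \<kappa> * norm w \<le> N1 z w)"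
proof -
  let ?S = "W \<inter> sphere 0 1"
  have contH: "continuous_on \<Omega> (\<lambda>z. H z v w)" for v w using smooth_H smooth_on_continuous_on by blast
  have cN: "continuous_on A (N1 p)" for A
    unfolding N1_def
    by (intro continuous_on_sum continuous_on_norm linear_continuous_on)
      (use linear_H1[OF p] in \<open>simp add: linear_conv_bounded_linear\<close>)
  have "\<exists>\<kappa>>0. \<forall>w\<in>W. \<kappa> * norm w \<le> N1 p w"
  proof (cases "?S = {}")
    \<comment> \<open>An empty sphere means that \<open>W\<close> is zero: there is no minimum to
      take, and 1 serves as the constant.\<close>
    case True
    have "w = 0" if "w \<in> W" for w
    proof (rule ccontr)
      assume "w \<noteq> 0"
      then have "(1 / norm w) *\<^sub>R w \<in> ?S" using that W(1) by (auto intro: subspace_scale)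
      then show False using True by blast
    qed
    then have "1 * norm w \<le> N1 p w" if "w \<in> W" for w
      using \<open>\<And>w. w \<in> W \<Longrightarrow> w = 0\<close>[OF that] by (simp add: N1_def sum_nonneg)
    then show ?thesis using zero_less_one by blast
  next
    case False
    have "compact ?S" using closed_subspace[OF W(1)] by (intro closed_Int_compact) auto
    then obtain w0 where w0: "w0 \<in> ?S" "\<And>w. w \<in> ?S \<Longrightarrow> N1 p w0 \<le> N1 p w"
      using continuous_attains_inf[OF _ False cN] by blast
    have "N1 p w0 \<noteq> 0"
    proof
      assume "N1 p w0 = 0"
      then have "H p w0 j = 0" if "j \<in> Basis" for j
        using that by (simp add: N1_def sum_nonneg_eq_0_iff)
      then have "H p w0 y = 0" for y
        using linear_Basis_expansion[OF linear_H2[OF p], of w0 y] by simp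
      then have "w0 \<in> Delta p" using w0(1) W(3) by (auto simp: Delta_def)
      then show False using w0(1) W(2) by auto
    qed
    then have pos: "N1 p w0 > 0" by (simp add: N1_def sum_nonneg order_less_le)
    have "N1 p w0 * norm w \<le> N1 p w" if w: "w \<in> W" for w
    proof (cases "w = 0")
      case False
      then have "(1 / norm w) *\<^sub>R w \<in> ?S" using w W(1) by (auto intro: subspace_scale)
      then have "N1 p w0 \<le> N1 p ((1 / norm w) *\<^sub>R w)" using w0(2) by blast
      also have "\<dots> = N1 p w / norm w"
        unfolding N1_def linear_scale[OF linear_H1[OF p]] by (simp add: sum_divide_distrib)
      finally show ?thesis using False by (simp add: field_simps)
    qed (simp add: N1_def sum_nonneg)
    then show ?thesis using pos by blast
  qed
  then obtain \<kappa> where \<kappa>: "\<kappa> > 0" "\<And>w. w \<in> W \<Longrightarrow> \<kappa> * norm w \<le> N1 p w" by blast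
  define \<delta> where "\<delta> z = (\<Sum>j\<in>Basis. \<Sum>i\<in>Basis. norm (H p i j - H z i j))" for z
  have "continuous_on \<Omega> \<delta>" unfolding \<delta>_def[abs_def]
    by (intro continuous_on_sum continuous_on_norm continuous_on_diff continuous_on_const contH)
  then have "open (\<Omega> \<inter> \<delta> -` {..<\<kappa> / 2})" by (rule continuous_open_preimage[OF _ open_\<Omega> open_lessThan])
  moreover have "p \<in> \<Omega> \<inter> \<delta> -` {..<\<kappa> / 2}" using p \<kappa> by (simp add: \<delta>_def)
  ultimately obtain r where r: "r > 0" "ball p r \<subseteq> \<Omega> \<inter> \<delta> -` {..<\<kappa> / 2}" using openE by blast
  have "\<kappa> / 2 * norm w \<le> N1 z w" if z: "z \<in> ball p r" and w: "w \<in> W" for z w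
  proof -
    have z\<Omega>: "z \<in> \<Omega>" "\<delta> z < \<kappa> / 2" using z r by auto
    have "norm (H p w j) \<le> norm (H z w j) + norm w * (\<Sum>i\<in>Basis. norm (H p i j - H z i j))" for j
    proof -
      have "H p w j - H z w j = (\<Sum>i\<in>Basis. (w \<bullet> i) *\<^sub>R (H p i j - H z i j))"
        using linear_Basis_expansion[OF linear_H1[OF p], of w j] linear_Basis_expansion[OF linear_H1[OF z\<Omega>(1)], of w j]
        by (simp add: scaleR_diff_right sum_subtractf)
      then have "norm (H p w j - H z w j) = norm (\<Sum>i\<in>Basis. (w \<bullet> i) *\<^sub>R (H p i j - H z i j))" by simp
      also have "\<dots> \<le> (\<Sum>i\<in>Basis. \<bar>w \<bullet> i\<bar> * norm (H p i j - H z i j))"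
        by (rule order_trans[OF norm_sum]) simp
      also have "\<dots> \<le> norm w * (\<Sum>i\<in>Basis. norm (H p i j - H z i j))" by (rule sum_abs_inner_le_norm) simp
      finally show ?thesis using norm_triangle_ineq[of "H z w j" "H p w j - H z w j"] by simp
    qed
    then have "N1 p w \<le> (\<Sum>j\<in>Basis. norm (H z w j) + norm w * (\<Sum>i\<in>Basis. norm (H p i j - H z i j)))"
      unfolding N1_def by (rule sum_mono)
    also have "\<dots> = N1 z w + norm w * \<delta> z" by (simp add: N1_def \<delta>_def sum.distrib sum_distrib_left)
    also have "\<dots> \<le> N1 z w + norm w * (\<kappa> / 2)" using z\<Omega> by (intro add_left_mono mult_left_mono) auto
    finally show ?thesis using \<kappa>(2)[OF w] by (simp add: algebra_simps)
  qed
  then show ?thesis using r \<kappa>(1) by (intro exI[of _ r] conjI exI[of _ "\<kappa> / 2"]) auto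
qed

text \<open>Constancy of the rank makes the third derivative vanish on \<open>Delta z \<times> Delta z\<close>:
  moving \<open>z\<close> by \<open>\<tau>\<close>, a vector of \<open>Delta z\<close> acquires a transversal part of size \<open>O(\<tau>)\<close> only,
  so that its value under the quadratic form \<open>H\<close> is \<open>O(\<tau>\<^sup>2)\<close>.\<close>

lemma K_Delta:
  assumes r: "ball p r \<subseteq> \<Omega>" and \<kappa>: "\<kappa> > 0" "\<And>z w. z \<in> ball p r \<Longrightarrow> w \<in> W \<Longrightarrow> \<kappa> * norm w \<le> N1 z w"
    and dec: "\<And>z v. z \<in> ball p r \<Longrightarrow> v \<in> T \<Longrightarrow> \<exists>a b. a \<in> Delta z \<and> b \<in> W \<and> v = a + b"
    and C: "\<And>z. z \<in> ball p r \<Longrightarrow> (\<Sum>i\<in>Basis. \<Sum>j\<in>Basis. norm (H z i j)) \<le> C" "0 \<le> C"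
    and z: "z \<in> ball p r" and v: "v \<in> Delta z"
  shows "K z e v v = 0"
proof -
  have z\<Omega>: "z \<in> \<Omega>" using z r by blast
  obtain d where d: "d > 0" "ball z d \<subseteq> ball p r" using z openE open_ball by blast
  define e0 where "e0 = d / (norm e + 1)"
  have e0: "e0 > 0" using d by (simp add: e0_def add_nonneg_pos)
  have inb: "z + t *\<^sub>R e \<in> ball p r" if "\<bar>t\<bar> < e0" for t
  proof -
    have "\<bar>t\<bar> * (norm e + 1) < d" using that by (simp add: e0_def pos_less_divide_eq add_nonneg_pos)
    moreover have "\<bar>t\<bar> * norm e \<le> \<bar>t\<bar> * (norm e + 1)" by (simp add: mult_left_mono)
    ultimately show ?thesis using d(2) by (intro subsetD[OF d(2)]) (simp add: dist_norm)
  qed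
  let ?q = "\<lambda>t. \<Sum>j\<in>Basis. H (z + t *\<^sub>R e) v j \<bullet> H (z + t *\<^sub>R e) v j"
  have dH: "((\<lambda>t. H (z + t *\<^sub>R e) v j) has_vector_derivative K z e v j) (at 0)" for j
    using has_derivative_along_line[of "\<lambda>z. H z v j" _ z 0 e] K_has_derivative[OF z\<Omega>] by force
  have v0: "H z v y = 0" for y using v by (simp add: Delta_def)
  \<comment> \<open>At the shifted point \<open>H\<close> sees only the \<open>W\<close>-part
    \<open>b\<close> of \<open>v\<close>, with value at most \<open>C\<close> times the square of
    \<open>norm b\<close>. Here \<open>norm b\<close> is at most \<open>N1 / \<kappa>\<close>, and
    Cauchy-Schwarz bounds the square of the sum \<open>N1\<close> by \<open>?q\<close> at the price
    of a factor \<open>DIM('a)\<close>.\<close>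
  let ?A = "C * (real DIM('a) / \<kappa>\<^sup>2)"
  \<comment> \<open>\<open>?q\<close> is a sum of squares of functions vanishing at 0, so its
    derivative there is zero. The vector function dominated by a multiple of it has derivative
    \<open>K z e v v\<close>, which must vanish as well.\<close>
  show ?thesis
  proof (rule vector_derivative_zero_if_dominated[OF dH _ _ _ e0])
    have "((\<lambda>t. H (z + t *\<^sub>R e) v j \<bullet> H (z + t *\<^sub>R e) v j) has_vector_derivative
        H (z + 0 *\<^sub>R e) v j \<bullet> K z e v j + K z e v j \<bullet> H (z + 0 *\<^sub>R e) v j) (at 0)" for j
      using bounded_bilinear.has_vector_derivative[OF bounded_bilinear_inner dH dH] .
    then have "((\<lambda>t. H (z + t *\<^sub>R e) v j \<bullet> H (z + t *\<^sub>R e) v j) has_real_derivative 0) (at 0)" for j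
      by (simp add: v0 has_real_derivative_iff_has_vector_derivative)
    then have "(?q has_real_derivative (\<Sum>j\<in>(Basis::'a set). 0)) (at 0)" by (intro DERIV_sum)
    then show "((\<lambda>t. ?A * ?q t) has_real_derivative 0) (at 0)" using DERIV_cmult[of ?q 0 0 UNIV ?A] by simp
    show "H (z + 0 *\<^sub>R e) v v = 0" "?A * ?q 0 = 0" by (simp_all add: v0)
    fix t assume t: "\<bar>t\<bar> < e0"
    let ?z = "z + t *\<^sub>R e"
    have z': "?z \<in> ball p r" "?z \<in> \<Omega>" using inb[OF t] r by auto
    have "v \<in> T" using v by (simp add: Delta_def)
    then obtain a b where ab: "a \<in> Delta ?z" "b \<in> W" "v = a + b" using dec[OF z'(1)] by blast
    have Ha: "H ?z a y = 0" "H ?z y a = 0" for y using ab(1) H_sym[OF z'(2), of y a] by (auto simp: Delta_def)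
    have "H ?z v v = H ?z b b"
      by (simp add: ab(3) linear_add[OF linear_H1[OF z'(2)]] linear_add[OF linear_H2[OF z'(2)]] Ha)
    then have "norm (H ?z v v) \<le> C * norm b * norm b" using N1_le[OF z'(2) C(1)[OF z'(1)]] by simp
    moreover have "(\<kappa> * norm b)\<^sup>2 \<le> (N1 ?z v)\<^sup>2"
      using \<kappa>(2)[OF z'(1) ab(2)] N1_cong[OF z'(2), of v b] ab \<kappa>(1) by (intro power_mono) auto
    moreover have "(N1 ?z v)\<^sup>2 \<le> ?q t * real DIM('a)"
      using sum_squared_le_sum_of_squares[of "\<lambda>j. norm (H ?z v j)" Basis]
      by (simp add: N1_def power2_norm_eq_inner)
    ultimately show "norm (H ?z v v) \<le> ?A * ?q t"
    proof -
      assume 1: "norm (H ?z v v) \<le> C * norm b * norm b" and 2: "(\<kappa> * norm b)\<^sup>2 \<le> (N1 ?z v)\<^sup>2"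
        and 3: "(N1 ?z v)\<^sup>2 \<le> ?q t * real DIM('a)"
      have "(norm b)\<^sup>2 \<le> ?q t * real DIM('a) / \<kappa>\<^sup>2"
        using 2 3 \<kappa>(1) by (simp add: pos_le_divide_eq power_mult_distrib mult.commute)
      then have "C * (norm b)\<^sup>2 \<le> C * (?q t * real DIM('a) / \<kappa>\<^sup>2)" using C(2) by (rule mult_left_mono)
      then show ?thesis using 1 by (simp add: power2_eq_square mult_ac)
    qed
  qed
qed

text \<open>Let \<xi> be the projection of a nullity vector \<open>x\<close> to \<open>T\<close>.
  The size of \<open>H\<close> on \<xi> along the segment from \<open>q\<close> in direction \<xi>
  obeys a linear differential inequality with zero initial value. So \<open>DG\<close> is constant
  on \<xi> there, \<open>G\<close> is affine, and its endpoint \<open>q + x\<close> belongs to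
  \<open>M\<close>.\<close>

lemma rulings_in:
  assumes p: "p \<in> M \<inter> U" and dimN: "\<And>q. q \<in> M \<inter> U \<Longrightarrow> dim (Null q) = d"
  shows "\<exists>\<epsilon>>0. \<forall>q\<in>M \<inter> U. \<forall>x\<in>Null q. dist q p < \<epsilon> \<and> norm x < \<epsilon> \<longrightarrow> q + x \<in> M"
proof -
  have p\<Omega>: "p \<in> \<Omega>" using U_in p by blast
  have dimD: "dim (Delta z) = d" if "z \<in> \<Omega>" for z using dim_Delta[OF that] dimN G_in that by metis
  \<comment> \<open>A complement of \<open>Delta p\<close> in \<open>T\<close>. It remains a
    complement of \<open>Delta z\<close> for \<open>z\<close> near \<open>p\<close>, because the
    seminorm stays definite on it and the dimension of the nullity is constant.\<close>
  define W where "W = {y \<in> T. \<forall>x\<in>Delta p. orthogonal x y}"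
  have W: "subspace W" "W \<subseteq> T" "W \<inter> Delta p \<subseteq> {0}"
    using T by (auto simp: W_def subspace_def orthogonal_def inner_add_right)
  have dimW: "dim W + d = dim T"
    using dim_subspace_orthogonal_to_vectors[OF subspace_Delta[OF p\<Omega>] T] dimD[OF p\<Omega>]
    by (auto simp: W_def Delta_def)
  obtain r0 \<kappa> where r0: "r0 > 0" "ball p r0 \<subseteq> \<Omega>" and \<kappa>: "\<kappa> > 0"
    "\<And>z w. z \<in> ball p r0 \<Longrightarrow> w \<in> W \<Longrightarrow> \<kappa> * norm w \<le> N1 z w"
    using N1_lower_bound_near[OF p\<Omega> W(1,3,2)] by blast
  \<comment> \<open>One continuous function dominating all components of the second and third
    derivatives, so that a single ball yields the same constant \<open>C\<close> for both.\<close>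
  define S where "S z = (\<Sum>i\<in>Basis. \<Sum>j\<in>Basis. norm (H z i j))
      + (\<Sum>k\<in>Basis. \<Sum>i\<in>Basis. \<Sum>j\<in>Basis. norm (K z k i j))" for z
  have contK: "continuous_on \<Omega> (\<lambda>z. K z u v w)" for u v w
    unfolding K_def using smooth_on_continuous_on[OF smooth_on_derivative_const[OF smooth_H]] .
  have contH: "continuous_on \<Omega> (\<lambda>z. H z v w)" for v w using smooth_H smooth_on_continuous_on by blast
  have "continuous_on \<Omega> S"
    unfolding S_def[abs_def] by (intro continuous_on_add continuous_on_sum continuous_on_norm contK contH)
  then have "open (\<Omega> \<inter> S -` {..<S p + 1})" by (rule continuous_open_preimage[OF _ open_\<Omega> open_lessThan])
  moreover have "p \<in> \<Omega> \<inter> S -` {..<S p + 1}" using p\<Omega> by simp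
  ultimately obtain r1 where r1: "r1 > 0" "ball p r1 \<subseteq> \<Omega> \<inter> S -` {..<S p + 1}" using openE by blast
  define C where "C = S p + 1"
  have C0: "C \<ge> 0" by (simp add: C_def S_def sum_nonneg add_nonneg_nonneg)
  define r where "r = min r0 r1"
  have r: "r > 0" "ball p r \<subseteq> \<Omega>" "ball p r \<subseteq> ball p r0" "ball p r \<subseteq> ball p r1" using r0 r1 by (auto simp: r_def)
  have CH: "(\<Sum>i\<in>Basis. \<Sum>j\<in>Basis. norm (H z i j)) \<le> C" if "z \<in> ball p r" for z
  proof -
    have "S z < C" using that r(4) r1(2) by (auto simp: C_def)
    moreover have "0 \<le> (\<Sum>k\<in>Basis. \<Sum>i\<in>Basis. \<Sum>j\<in>Basis. norm (K z k i j))" by (intro sum_nonneg) auto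
    ultimately show ?thesis by (simp add: S_def)
  qed
  have CK: "norm (K z k v w) \<le> C * norm v * norm w" if z: "z \<in> ball p r" "k \<in> Basis" for z k v w
  proof -
    have "S z < C" using that r(4) r1(2) by (auto simp: C_def)
    moreover have "(\<Sum>i\<in>Basis. \<Sum>j\<in>Basis. norm (K z k i j)) \<le> (\<Sum>k\<in>Basis. \<Sum>i\<in>Basis. \<Sum>j\<in>Basis. norm (K z k i j))"
      using z(2) by (intro member_le_sum sum_nonneg) auto
    moreover have "0 \<le> (\<Sum>i\<in>Basis. \<Sum>j\<in>Basis. norm (H z i j))" by (intro sum_nonneg) auto
    ultimately have le: "(\<Sum>i\<in>Basis. \<Sum>j\<in>Basis. norm (K z k i j)) \<le> C" by (simp add: S_def)
    have z\<Omega>: "z \<in> \<Omega>" using z r by blast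
    have "norm (K z k v w) \<le> (\<Sum>i\<in>Basis. \<Sum>j\<in>Basis. norm (K z k i j)) * norm v * norm w"
      by (rule norm_bilinear_le) (use linear_K2[OF z\<Omega>] linear_K3[OF z\<Omega>] in auto)
    also have "\<dots> \<le> C * norm v * norm w" using le by (intro mult_right_mono) auto
    finally show ?thesis .
  qed
  have \<kappa>': "\<kappa> * norm w \<le> N1 z w" if "z \<in> ball p r" "w \<in> W" for z w using \<kappa> that r(3) by blast
  have dec: "\<exists>a b. a \<in> Delta z \<and> b \<in> W \<and> v = a + b" if z: "z \<in> ball p r" and v: "v \<in> T" for z v
  proof -
    have z\<Omega>: "z \<in> \<Omega>" using z r by blast
    have "x = 0" if "x \<in> Delta z" "x \<in> W" for x
    proof -
      have "N1 z x = 0" using that by (simp add: N1_def Delta_def)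
      then have "\<kappa> * norm x \<le> 0" using \<kappa>'[OF z that(2)] by simp
      then show ?thesis using \<kappa>(1) by (simp add: mult_le_0_iff)
    qed
    then have "Delta z \<inter> W \<subseteq> {0}" by blast
    moreover have "Delta z \<subseteq> T" by (auto simp: Delta_def)
    moreover have "dim T \<le> dim (Delta z) + dim W" using dimD[OF z\<Omega>] dimW by simp
    ultimately show ?thesis
      using subspace_sum_decomposition[OF subspace_Delta[OF z\<Omega>] W(1) T _ W(2) _ _ v] by metis
  qed
  have KD: "K z e v v = 0" if "z \<in> ball p r" "v \<in> Delta z" for z e v
    by (rule K_Delta[OF r(2) \<kappa>(1) \<kappa>' dec CH C0 that])
  have main: "q + x \<in> M" if q: "q \<in> M \<inter> U" and x: "x \<in> Null q" and near: "dist q p < r / 2" "norm x < r / 2" for q x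
  proof -
    define \<xi> where "\<xi> = orth_proj T x"
    have xT: "DG q x = x" "\<And>y. H q x y = 0" using x Null_iff[OF q] tangent_iff[OF q] by auto
    have \<xi>: "\<xi> \<in> T" "norm \<xi> < r / 2" using orth_proj_in[OF T] norm_orth_proj_le[OF T, of x] near by (auto simp: \<xi>_def)
    let ?c = "\<lambda>t. q + t *\<^sub>R \<xi>"
    have inb: "?c t \<in> ball p r" if "0 \<le> t" "t \<le> 1" for t
    proof -
      have "t * norm \<xi> \<le> 1 * norm \<xi>" using that by (intro mult_right_mono) auto
      then have "norm (t *\<^sub>R \<xi>) < r / 2" using \<xi> that by simp
      then show ?thesis using near(1) norm_triangle_ineq[of "q - p" "t *\<^sub>R \<xi>"]
        by (simp add: dist_norm norm_minus_commute[of p] algebra_simps)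
    qed
    have in\<Omega>: "?c t \<in> \<Omega>" if "0 \<le> t" "t \<le> 1" for t using inb[OF that] r by blast
    \<comment> \<open>Built from \<open>norm b \<le> N1 / \<kappa>\<close> and
      \<open>norm a \<le> norm \<xi> + norm b\<close>, where \<open>N1\<close> is bounded by
      \<open>C * norm \<xi> * DIM('a)\<close>.\<close>
    define B where "B = C * (norm \<xi> + norm \<xi> + C * norm \<xi> * real DIM('a) / \<kappa>) / \<kappa>"
    have B0: "B \<ge> 0" using C0 \<kappa>(1) by (auto simp: B_def intro!: divide_nonneg_nonneg mult_nonneg_nonneg add_nonneg_nonneg)
    have Kbound: "norm (K (?c t) \<xi> \<xi> j) \<le> B * N1 (?c t) \<xi>" if t: "0 \<le> t" "t \<le> 1" and j: "j \<in> Basis" for t j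
    proof -
      let ?z = "?c t"
      note z = inb[OF t] and z\<Omega> = in\<Omega>[OF t]
      obtain a b where ab: "a \<in> Delta ?z" "b \<in> W" "\<xi> = a + b" using dec[OF z \<xi>(1)] by blast
      \<comment> \<open>Full symmetry of the third derivative moves both copies of \<xi> into the
        last two slots. As \<open>K ?z j a a\<close> vanishes, every remaining term contains the
        transversal part \<open>b\<close>, which \<open>N1\<close> controls.\<close>
      have "K ?z \<xi> \<xi> j = K ?z j \<xi> \<xi>" using K_sym12[OF z\<Omega>] K_sym23[OF z\<Omega>] by metis
      also have "\<dots> = K ?z j \<xi> b + K ?z j b a + K ?z j a a"
        using linear_add[OF linear_K3[OF z\<Omega>], of j \<xi> a b] linear_add[OF linear_K2[OF z\<Omega>], of j a b a]
        by (simp flip: ab(3))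
      finally have "K ?z \<xi> \<xi> j = K ?z j \<xi> b + K ?z j b a" using KD[OF z ab(1)] by simp
      then have "norm (K ?z \<xi> \<xi> j) = norm (K ?z j \<xi> b + K ?z j b a)" by simp
      then have "norm (K ?z \<xi> \<xi> j) \<le> C * norm \<xi> * norm b + C * norm b * norm a"
        using CK[OF z j, of \<xi> b] CK[OF z j, of b a] norm_triangle_ineq[of "K ?z j \<xi> b" "K ?z j b a"] by linarith
      also have "\<dots> = C * norm b * (norm \<xi> + norm a)" by (simp add: algebra_simps)
      finally have 1: "norm (K ?z \<xi> \<xi> j) \<le> C * norm b * (norm \<xi> + norm a)" .
      have "\<kappa> * norm b \<le> N1 ?z \<xi>" using \<kappa>'[OF z ab(2)] N1_cong[OF z\<Omega>, of \<xi> b] ab by simp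
      then have b: "norm b \<le> N1 ?z \<xi> / \<kappa>" using \<kappa>(1) by (simp add: pos_le_divide_eq mult.commute)
      have "N1 ?z \<xi> \<le> (\<Sum>j\<in>Basis. C * norm \<xi> * norm (j::'a))"
        unfolding N1_def by (intro sum_mono N1_le[OF z\<Omega> CH[OF z]])
      then have N: "N1 ?z \<xi> \<le> C * norm \<xi> * real DIM('a)" by (simp add: mult.commute)
      have "norm a \<le> norm \<xi> + norm b" using ab(3) norm_triangle_ineq4[of \<xi> b] by simp
      also have "\<dots> \<le> norm \<xi> + C * norm \<xi> * real DIM('a) / \<kappa>"
        using b divide_right_mono[OF N, of \<kappa>] \<kappa>(1) by simp
      finally have "norm \<xi> + norm a \<le> norm \<xi> + norm \<xi> + C * norm \<xi> * real DIM('a) / \<kappa>" by simp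
      then have "C * norm b * (norm \<xi> + norm a) \<le> C * (N1 ?z \<xi> / \<kappa>) * (norm \<xi> + norm \<xi> + C * norm \<xi> * real DIM('a) / \<kappa>)"
        using b C0 order_trans[OF norm_ge_zero b] by (intro mult_mono mult_left_mono mult_nonneg_nonneg add_nonneg_nonneg) auto
      then show ?thesis using 1 by (simp add: B_def mult_ac)
    qed
    let ?u = "\<lambda>t. \<Sum>j\<in>Basis. H (?c t) \<xi> j \<bullet> H (?c t) \<xi> j"
    let ?u' = "\<lambda>t. \<Sum>j\<in>Basis. H (?c t) \<xi> j \<bullet> K (?c t) \<xi> \<xi> j + K (?c t) \<xi> \<xi> j \<bullet> H (?c t) \<xi> j"
    have u0: "?u t = 0" if t: "0 \<le> t" "t \<le> 1" for t
    proof (rule gronwall_zero[where u' = ?u' and B = "2 * B * real DIM('a)" and u = ?u, OF _ _ _ _ t])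
      fix t :: real assume t: "0 \<le> t" "t \<le> 1"
      have dH: "((\<lambda>t. H (?c t) \<xi> j) has_vector_derivative K (?c t) \<xi> \<xi> j) (at t)" for j
        using has_derivative_along_line[of "\<lambda>z. H z \<xi> j" _ q t \<xi>] K_has_derivative[OF in\<Omega>[OF t]] by blast
      show "(?u has_real_derivative ?u' t) (at t)"
        using bounded_bilinear.has_vector_derivative[OF bounded_bilinear_inner dH dH]
        by (intro DERIV_sum) (simp add: has_real_derivative_iff_has_vector_derivative)
      have "H (?c t) \<xi> j \<bullet> K (?c t) \<xi> \<xi> j + K (?c t) \<xi> \<xi> j \<bullet> H (?c t) \<xi> j
          \<le> 2 * (norm (H (?c t) \<xi> j) * (B * N1 (?c t) \<xi>))" if "j \<in> Basis" for j
      proof -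
        have "H (?c t) \<xi> j \<bullet> K (?c t) \<xi> \<xi> j \<le> norm (H (?c t) \<xi> j) * norm (K (?c t) \<xi> \<xi> j)"
          by (rule norm_cauchy_schwarz)
        also have "\<dots> \<le> norm (H (?c t) \<xi> j) * (B * N1 (?c t) \<xi>)"
          by (intro mult_left_mono Kbound[OF t that]) auto
        finally show ?thesis by (simp add: inner_commute)
      qed
      then have "?u' t \<le> (\<Sum>j\<in>Basis. 2 * (norm (H (?c t) \<xi> j) * (B * N1 (?c t) \<xi>)))" by (rule sum_mono)
      also have "\<dots> = 2 * B * (N1 (?c t) \<xi>)\<^sup>2"
        unfolding N1_def power2_eq_square by (simp add: sum_distrib_left sum_distrib_right mult_ac)
      also have "\<dots> \<le> 2 * B * (?u t * real DIM('a))"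
        using B0 sum_squared_le_sum_of_squares[of "\<lambda>j. norm (H (?c t) \<xi> j)" Basis]
        by (intro mult_left_mono) (simp_all add: N1_def power2_norm_eq_inner)
      finally show "?u' t \<le> 2 * B * real DIM('a) * ?u t" by (simp only: mult_ac)
    next
      have "H q \<xi> j = 0" for j using H_cong1[OF U_in[OF q]] xT(2) proj_idem \<xi>_def by metis
      then show "?u 0 = 0" by simp
    qed (auto intro: sum_nonneg)
    have H0: "H (?c t) \<xi> \<xi> = 0" if t: "0 \<le> t" "t \<le> 1" for t
    proof -
      have "\<forall>j\<in>Basis. H (?c t) \<xi> j \<bullet> H (?c t) \<xi> j = 0"
        using u0[OF t] by (subst (asm) sum_nonneg_eq_0_iff) auto
      then show ?thesis using linear_Basis_expansion[OF linear_H2[OF in\<Omega>[OF t]], of \<xi> \<xi>] by simp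
    qed
    have D: "DG (?c t) \<xi> = x" if t: "t \<in> {0..1}" for t
    proof -
      have "((\<lambda>t. DG (?c t) \<xi>) has_vector_derivative 0) (at s within {0..1})" if s: "s \<in> {0..1}" for s
      proof -
        have "((\<lambda>t. DG (?c t) \<xi>) has_vector_derivative H (?c s) \<xi> \<xi>) (at s)"
          by (rule has_derivative_along_line[OF H_has_derivative[OF in\<Omega>]]) (use s in auto)
        then show ?thesis using H0[of s] s by (simp add: has_vector_derivative_at_within)
      qed
      then obtain k where k: "\<And>s. s \<in> {0..1} \<Longrightarrow> DG (?c s) \<xi> = k"
        using has_vector_derivative_zero_constant[of "{0..1::real}" "\<lambda>t. DG (?c t) \<xi>"] by auto
      have "DG q \<xi> = x" using DG_proj[OF U_in[OF q]] xT by (simp add: \<xi>_def)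
      then show ?thesis using k[OF t] k[of 0] by simp
    qed
    have "((\<lambda>t. G (?c t) - t *\<^sub>R x) has_vector_derivative 0) (at s within {0..1})" if s: "s \<in> {0..1}" for s
    proof -
      have "((\<lambda>t. G (?c t)) has_vector_derivative DG (?c s) \<xi>) (at s)"
        by (rule has_derivative_along_line[OF DG_has_derivative[OF in\<Omega>]]) (use s in auto)
      then have "((\<lambda>t. G (?c t)) has_vector_derivative x) (at s)" using D[OF s] by simp
      moreover have "((\<lambda>t. t *\<^sub>R x) has_vector_derivative x) (at s)"
        using line_has_vector_derivative[of 0 x s] by simp
      ultimately have "((\<lambda>t. G (?c t) - t *\<^sub>R x) has_vector_derivative x - x) (at s)"
        by (rule has_vector_derivative_diff)
      then show ?thesis by (simp add: has_vector_derivative_at_within)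
    qed
    then obtain k where k: "\<And>s. s \<in> {0..1} \<Longrightarrow> G (?c s) - s *\<^sub>R x = k"
      using has_vector_derivative_zero_constant[of "{0..1::real}" "\<lambda>t. G (?c t) - t *\<^sub>R x"] by auto
    have "G (q + \<xi>) - x = G q" using k[of 0] k[of 1] by simp
    then have "G (q + \<xi>) = q + x" using G_id[OF q] by (simp add: algebra_simps)
    then show ?thesis using G_in[of "q + \<xi>"] in\<Omega>[of 1] by auto
  qed
  then show ?thesis using r(1) by (intro exI[of _ "r / 2"]) auto
qed

end

section \<open>The data of the Cauchy problem\<close>

text \<open>The frame fields, smooth along \<open>S\<close> only, are replaced by ambient
  extensions; shrinking the neighbourhood keeps these independent off \<open>S\<close> too.\<close>

lemma smooth_distribution_frame:
  fixes D :: "'a::euclidean_space \<Rightarrow> 'a set"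
  assumes "smooth_distribution m S D" "p \<in> S"
  obtains U and E :: "nat \<Rightarrow> 'a \<Rightarrow> 'a" where "open U" "p \<in> U" "\<And>i. i \<in> {1..m} \<Longrightarrow> smooth_on U (E i)"
    "\<And>q. q \<in> S \<inter> U \<Longrightarrow> span ((\<lambda>i. E i q) ` {1..m}) = D q"
    "\<And>q. q \<in> U \<Longrightarrow> dim (span ((\<lambda>i. E i q) ` {1..m})) = m"
proof -
  obtain U0 and E0 :: "nat \<Rightarrow> 'a \<Rightarrow> 'a" where U0: "open U0" "p \<in> U0"
    and E0: "\<And>i. i \<in> {1..m} \<Longrightarrow> smooth_along (S \<inter> U0) (E0 i)"
    "\<And>q. q \<in> S \<inter> U0 \<Longrightarrow> span ((\<lambda>i. E0 i q) ` {1..m}) = D q"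
    using bspec[OF conjunct2[OF assms(1)[unfolded smooth_distribution_def]] assms(2)] by blast
  have "\<exists>W g. open W \<and> p \<in> W \<and> smooth_on W g \<and> (\<forall>q\<in>S \<inter> U0 \<inter> W. E0 i q = g q)" if "i \<in> {1..m}" for i
    using smooth_alongE[OF E0(1)[OF that], of p] U0 assms(2) by (metis IntI)
  then obtain W E where W: "\<And>i. i \<in> {1..m} \<Longrightarrow> open (W i) \<and> p \<in> W i \<and> smooth_on (W i) (E i) \<and>
      (\<forall>q\<in>S \<inter> U0 \<inter> W i. E0 i q = E i q)"
    by metis
  define U1 where "U1 = U0 \<inter> (\<Inter>i\<in>{1..m}. W i)"
  have U1: "open U1" "p \<in> U1" using U0 W by (auto simp: U1_def intro!: open_INT open_Int)
  have sm: "smooth_on U1 (E i)" if "i \<in> {1..m}" for i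
    using W[OF that] that by (intro smooth_on_subset[of U1 "W i"]) (auto simp: U1_def)
  have sp: "span ((\<lambda>i. E i q) ` {1..m}) = D q" if "q \<in> S \<inter> U1" for q
  proof -
    have "(\<lambda>i. E i q) ` {1..m} = (\<lambda>i. E0 i q) ` {1..m}"
      using W that by (intro image_cong) (auto simp: U1_def)
    then show ?thesis using E0(2)[of q] that by (simp add: U1_def)
  qed
  have "dim (D p) = m" using assms by (simp add: smooth_distribution_def)
  then have "dim (span ((\<lambda>i. E i p) ` {1..m})) = card {1..m}" using sp[of p] U1 assms(2) by simp
  then have "\<exists>V. open V \<and> p \<in> V \<and> V \<subseteq> U1 \<and> (\<forall>q\<in>V. dim (span ((\<lambda>i. E i q) ` {1..m})) = card {1..m})"
    by (intro full_span_open U1 smooth_on_continuous_on[OF sm]) auto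
  then obtain U where "open U" "p \<in> U" "U \<subseteq> U1" "\<And>q. q \<in> U \<Longrightarrow> dim (span ((\<lambda>i. E i q) ` {1..m})) = m"
    unfolding card_atLeastAtMost diff_Suc_1 by blast
  then show ?thesis using that[of U E] sm sp smooth_on_subset by blast
qed

text \<open>The lower bound of the injective \<open>L p\<close> is perturbed, half of it being given
  up.\<close>

lemma linear_family_bounded_below:
  fixes L :: "'a::euclidean_space \<Rightarrow> 'a \<Rightarrow> 'a"
  assumes U: "open U" "p \<in> U" and L: "\<And>q. q \<in> U \<Longrightarrow> linear (L q)"
    and c: "\<And>e. continuous_on U (\<lambda>q. L q e)" and "inj (L p)"
  shows "\<exists>r>0. \<exists>\<kappa>>0. ball p r \<subseteq> U \<and> (\<forall>q\<in>ball p r. \<forall>x. \<kappa> * norm x \<le> norm (L q x))"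
proof -
  obtain \<kappa> where \<kappa>: "\<kappa> > 0" "\<And>x. \<kappa> * norm x \<le> norm (L p x)"
    using linear_inj_bounded_below_pos[OF L[OF U(2)] assms(5)] by (metis mult.commute)
  define \<delta> where "\<delta> q = (\<Sum>i\<in>Basis. norm (L q i - L p i))" for q
  have "continuous_on U \<delta>" unfolding \<delta>_def[abs_def]
    by (intro continuous_on_sum continuous_on_norm continuous_on_diff continuous_on_const c)
  then have "open (U \<inter> \<delta> -` {..<\<kappa> / 2})" by (rule continuous_open_preimage[OF _ U(1) open_lessThan])
  moreover have "p \<in> U \<inter> \<delta> -` {..<\<kappa> / 2}" using U \<kappa> by (simp add: \<delta>_def)
  ultimately obtain r where r: "r > 0" "ball p r \<subseteq> U \<inter> \<delta> -` {..<\<kappa> / 2}" using openE by blast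
  have "\<kappa> / 2 * norm x \<le> norm (L q x)" if q: "q \<in> ball p r" for q x
  proof -
    have qU: "q \<in> U" "\<delta> q < \<kappa> / 2" using r q by auto
    have "L q x - L p x = (\<Sum>i\<in>Basis. (x \<bullet> i) *\<^sub>R (L q i - L p i))"
      using linear_Basis_expansion[OF L[OF qU(1)], of x] linear_Basis_expansion[OF L[OF U(2)], of x]
      by (simp add: scaleR_diff_right sum_subtractf)
    then have "norm (L q x - L p x) = norm (\<Sum>i\<in>Basis. (x \<bullet> i) *\<^sub>R (L q i - L p i))" by simp
    also have "\<dots> \<le> (\<Sum>i\<in>Basis. norm x * norm (L q i - L p i))"
      by (intro sum_norm_le) (simp add: Basis_le_norm mult_right_mono)
    also have "\<dots> = norm x * \<delta> q" by (simp add: \<delta>_def sum_distrib_left)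
    also have "\<dots> \<le> norm x * (\<kappa> / 2)" using qU by (intro mult_left_mono) auto
    finally have "norm (L p x) - norm (L q x) \<le> \<kappa> / 2 * norm x"
      using norm_triangle_ineq2[of "L p x" "L q x"] by (simp add: norm_minus_commute mult.commute)
    then show ?thesis using \<kappa>(2)[of x] by (simp add: algebra_simps)
  qed
  then show ?thesis using r \<kappa>(1) by (intro exI[of _ r] conjI exI[of _ "\<kappa> / 2"]) auto
qed

text \<open>The term that differentiates \<open>F\<close> is multiplied by the argument, which is 0
  at the base point.\<close>

lemma has_derivative_linear_family_at_zero:
  fixes F :: "'a::euclidean_space \<Rightarrow> 'a \<Rightarrow> 'b::real_normed_vector"
  assumes "open V" "0 \<in> V" "\<And>y. y \<in> V \<Longrightarrow> linear (F y)" "\<And>e. (\<lambda>y. F y e) differentiable (at 0)"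
  shows "((\<lambda>y. F y y) has_derivative F 0) (at 0)"
proof -
  have d: "((\<lambda>y. F y e) has_derivative frechet_derivative (\<lambda>y. F y e) (at 0)) (at 0)" for e
    using assms(4) frechet_derivative_works by blast
  have "((\<lambda>y. \<Sum>i\<in>Basis. (y \<bullet> i) *\<^sub>R F y i) has_derivative
     (\<lambda>v. \<Sum>i\<in>Basis. (0 \<bullet> i) *\<^sub>R frechet_derivative (\<lambda>y. F y i) (at 0) v + (v \<bullet> i) *\<^sub>R F 0 i)) (at 0)"
    by (intro has_derivative_sum has_derivative_scaleR d has_derivative_inner_left has_derivative_ident)
  moreover have "(\<lambda>v. \<Sum>i\<in>Basis. (0 \<bullet> i) *\<^sub>R frechet_derivative (\<lambda>y. F y i) (at 0) v + (v \<bullet> i) *\<^sub>R F 0 i) = F 0"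
    by (rule ext) (simp flip: linear_Basis_expansion[OF assms(3)[OF assms(2)]])
  ultimately have "((\<lambda>y. \<Sum>i\<in>Basis. (y \<bullet> i) *\<^sub>R F y i) has_derivative F 0) (at 0)" by simp
  then show ?thesis
    by (rule has_derivative_transform_within_open[OF _ assms(1,2)]) (rule linear_Basis_expansion[OF assms(3), symmetric])
qed

lemma rank_nullity_subspace:
  fixes f :: "'a::euclidean_space \<Rightarrow> 'b::euclidean_space"
  assumes f: "linear f" and V: "subspace V"
  shows "dim (f ` V) + dim {v \<in> V. f v = 0} = dim V"
proof -
  let ?Z = "{v \<in> V. f v = 0}" and ?W = "{y \<in> V. \<forall>x\<in>{v \<in> V. f v = 0}. orthogonal x y}"
  have Z: "subspace ?Z" using V by (auto simp: subspace_def linear_0[OF f] linear_add[OF f] linear_scale[OF f])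
  have d: "dim ?W + dim ?Z = dim V" by (rule dim_subspace_orthogonal_to_vectors[OF Z V]) auto
  have W: "subspace ?W" using V by (auto simp: subspace_def orthogonal_def inner_add_right)
  have "inj_on f ?W"
  proof (rule inj_onI)
    fix x y assume xy: "x \<in> ?W" "y \<in> ?W" "f x = f y"
    then have "x - y \<in> ?W" "f (x - y) = 0" using subspace_diff[OF W] linear_diff[OF f] by auto
    then have "orthogonal (x - y) (x - y)" by blast
    then show "x = y" by (simp add: orthogonal_def)
  qed
  then have dW: "dim (f ` ?W) = dim ?W" using dim_image_eq[OF f, of ?W] W by (simp add: span_eq_iff[THEN iffD2])
  have "f ` V \<subseteq> f ` ?W"
  proof
    fix y assume "y \<in> f ` V"
    then obtain v where v: "v \<in> V" "y = f v" by blast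
    have p: "orth_proj ?Z v \<in> ?Z" "v - orth_proj ?Z v \<in> orthogonal_comp ?Z"
      using orth_proj_in[OF Z] diff_orth_proj_in[OF Z] by blast+
    then have "v - orth_proj ?Z v \<in> ?W"
      using v subspace_diff[OF V, of v "orth_proj ?Z v"] by (auto simp: orthogonal_comp_def)
    moreover have "f (v - orth_proj ?Z v) = y" using p v by (simp add: linear_diff[OF f])
    ultimately show "y \<in> f ` ?W" by (rule image_eqI[OF sym, rotated])
  qed
  then have "f ` V = f ` ?W" by auto
  then show ?thesis using d dW by simp
qed

lemma full_dim_image_imp_inj_on:
  fixes f :: "'a::euclidean_space \<Rightarrow> 'b::euclidean_space"
  assumes f: "linear f" and V: "subspace V" and "dim (f ` V) = dim V"
  shows "inj_on f V"
proof (rule inj_onI)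
  fix x y assume xy: "x \<in> V" "y \<in> V" "f x = f y"
  have "dim {v \<in> V. f v = 0} = 0" using rank_nullity_subspace[OF f V] assms(3) by simp
  then have "{v \<in> V. f v = 0} \<subseteq> {0}" by simp
  moreover have "x - y \<in> {v \<in> V. f v = 0}" using xy subspace_diff[OF V] linear_diff[OF f] by simp
  ultimately show "x = y" by auto
qed

section \<open>Well-definedness and linearity of the map phi\<close>

locale cauchy_data =
  fixes m s :: nat and S :: "'a::euclidean_space set" and D :: "'a \<Rightarrow> 'a set" and N :: "'a \<Rightarrow> 'a"
  assumes embedded_S: "embedded_submanifold s S"
    and distribution_D: "smooth_distribution m S D"
    and tangent_D: "p \<in> S \<Longrightarrow> tangent_space S p \<subseteq> D p"
    and section_N: "smooth_section S (normal_distribution D) N"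
    and shape_rank: "p \<in> S \<Longrightarrow> dim (shape_operator S D N p ` tangent_space S p) = s"
begin

abbreviation "TS \<equiv> tangent_space S"
abbreviation "\<phi> \<equiv> phi S D"
abbreviation "Im\<phi> \<equiv> phi_image S D"

lemma subspace_D: "p \<in> S \<Longrightarrow> subspace (D p)" and dim_D: "p \<in> S \<Longrightarrow> dim (D p) = m"
  using distribution_D by (auto simp: smooth_distribution_def)

lemma graph_S:
  assumes "p \<in> S"
  obtains \<Omega> U G where "smooth_graph S (TS p) \<Omega> U G" "p \<in> U"
  using embedded_submanifold_tangent_graph[OF embedded_S assms] by metis

lemma subspace_TS: "p \<in> S \<Longrightarrow> subspace (TS p)"
  using graph_S[of p] smooth_graph.T by metis

lemma dim_TS: "p \<in> S \<Longrightarrow> dim (TS p) = s"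
  using embedded_submanifold_tangent_graph[OF embedded_S] by metis

lemma normal_iff: "n \<in> normal_distribution D p \<longleftrightarrow> (\<forall>y\<in>D p. n \<bullet> y = 0)"
  by (simp add: normal_distribution_def orthogonal_comp_iff)

lemma N_normal: "p \<in> S \<Longrightarrow> N p \<in> normal_distribution D p"
  using section_N by (simp add: smooth_section_def)

lemma smooth_along_N: "smooth_along S N"
  using section_N by (simp add: smooth_section_def)

text \<open>\<open>D\<close> is prescribed along \<open>S\<close> only. Off \<open>S\<close> the map
  \<open>P q\<close> projects onto the span of the extended frame, which makes ambient derivatives
  available.\<close>

lemma projection_D:
  assumes "p \<in> S"
  obtains U and P :: "'a \<Rightarrow> 'a \<Rightarrow> 'a" where "open U" "p \<in> U" "\<And>q. linear (P q)"
    "\<And>Y V. open V \<Longrightarrow> V \<subseteq> U \<Longrightarrow> smooth_on V Y \<Longrightarrow> smooth_on V (\<lambda>q. P q (Y q))"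
    "\<And>q. q \<in> S \<inter> U \<Longrightarrow> P q = orth_proj (D q)"
proof -
  obtain U and E :: "nat \<Rightarrow> 'a \<Rightarrow> 'a" where U: "open U" "p \<in> U"
    and E: "\<And>i. i \<in> {1..m} \<Longrightarrow> smooth_on U (E i)"
    "\<And>q. q \<in> S \<inter> U \<Longrightarrow> span ((\<lambda>i. E i q) ` {1..m}) = D q"
    "\<And>q. q \<in> U \<Longrightarrow> dim (span ((\<lambda>i. E i q) ` {1..m})) = m"
    using smooth_distribution_frame[OF distribution_D assms] by blast
  show ?thesis
  proof (rule that[OF U, of "\<lambda>q. orth_proj (span ((\<lambda>i. E i q) ` {1..m}))"])
    fix V Y assume V: "open V" "V \<subseteq> U" "smooth_on V (Y :: 'a \<Rightarrow> 'a)"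
    have "smooth_on V (E i)" if "i \<in> {1..m}" for i using E(1)[OF that] V(2) smooth_on_subset by blast
    then show "smooth_on V (\<lambda>q. orth_proj (span ((\<lambda>i. E i q) ` {1..m})) (Y q))"
      using V E(3) by (intro smooth_on_orth_proj_span) auto
  qed (use E(2) in \<open>auto intro: linear_orth_proj\<close>)
qed

text \<open>Differentiating \<open>N' q \<bullet> Y q = 0\<close> along a curve moves the derivative
  from \<open>N'\<close> to \<open>Y\<close>. The right-hand side involves \<open>N'\<close> only
  through its value at \<open>p\<close>, which is why \<open>phi\<close> does not depend on the
  extension.\<close>

lemma nabla_skew:
  assumes p: "p \<in> S" and v: "v \<in> TS p" and U: "open U" "p \<in> U" and V: "open V" "p \<in> V"
    and N': "smooth_along (S \<inter> U) N'" and Y: "smooth_along (S \<inter> V) Y"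
    and perp: "\<And>q. q \<in> S \<inter> U \<inter> V \<Longrightarrow> N' q \<bullet> Y q = 0"
  shows "nabla (S \<inter> U) N' p v \<bullet> Y p = - (N' p \<bullet> nabla (S \<inter> V) Y p v)"
proof -
  obtain \<gamma> where \<gamma>: "smooth_curve_in S p v \<gamma>" using v by (auto simp: tangent_space_def)
  note c = smooth_curve_in_Int_open[OF \<gamma>]
  have "((\<lambda>t. N' (\<gamma> t) \<bullet> Y (\<gamma> t)) has_vector_derivative
      N' (\<gamma> 0) \<bullet> nabla (S \<inter> V) Y p v + nabla (S \<inter> U) N' p v \<bullet> Y (\<gamma> 0)) (at 0)"
    by (rule bounded_bilinear.has_vector_derivative[OF bounded_bilinear_inner
        nabla_along_curve[OF N' c[OF U]] nabla_along_curve[OF Y c[OF V]]])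
  moreover have "eventually (\<lambda>t. N' (\<gamma> t) \<bullet> Y (\<gamma> t) = 0) (nhds 0)"
    using smooth_curve_in_eventually[OF c[OF U] V] by (rule eventually_mono) (use perp in auto)
  ultimately have "N' (\<gamma> 0) \<bullet> nabla (S \<inter> V) Y p v + nabla (S \<inter> U) N' p v \<bullet> Y (\<gamma> 0) = 0"
    by (rule vector_derivative_eventually_eq[OF _ has_vector_derivative_const])
  then show ?thesis using smooth_curve_inD(1)[OF \<gamma>] by simp
qed

text \<open>The extension is the projection of the constant field \<open>y\<close>; for normal
  vectors the complementary projection plays this role.\<close>

lemma D_extension:
  assumes "p \<in> S" "y \<in> D p"
  obtains V Y where "open V" "p \<in> V" "smooth_on V Y" "\<And>q. q \<in> S \<inter> V \<Longrightarrow> Y q \<in> D q" "Y p = y"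
proof -
  obtain U P where U: "open U" "p \<in> U" and sm: "\<And>Y V. open V \<Longrightarrow> V \<subseteq> U \<Longrightarrow> smooth_on V Y \<Longrightarrow> smooth_on V (\<lambda>q. P q (Y q))"
    and P: "\<And>q. q \<in> S \<inter> U \<Longrightarrow> P q = orth_proj (D q)"
    using projection_D[OF assms(1)] by metis
  show ?thesis
    using that[OF U sm[OF U(1) subset_refl smooth_on_const[OF U(1)], of y]] P U assms orth_proj_in[OF subspace_D]
      orth_proj_id[OF subspace_D] by auto
qed

lemma normal_extension:
  assumes "p \<in> S" "n \<in> normal_distribution D p"
  obtains V Y where "open V" "p \<in> V" "smooth_on V Y" "\<And>q. q \<in> S \<inter> V \<Longrightarrow> Y q \<in> normal_distribution D q" "Y p = n"
proof -
  obtain U P where U: "open U" "p \<in> U" and sm: "\<And>Y V. open V \<Longrightarrow> V \<subseteq> U \<Longrightarrow> smooth_on V Y \<Longrightarrow> smooth_on V (\<lambda>q. P q (Y q))"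
    and P: "\<And>q. q \<in> S \<inter> U \<Longrightarrow> P q = orth_proj (D q)"
    using projection_D[OF assms(1)] by metis
  show ?thesis
  proof (rule that[OF U])
    show "smooth_on U (\<lambda>q. n - P q n)"
      by (intro smooth_on_diff smooth_on_const U sm[OF U(1) subset_refl smooth_on_const[OF U(1)]])
    show "n - P q n \<in> normal_distribution D q" if "q \<in> S \<inter> U" for q
      using P[OF that] diff_orth_proj_in[OF subspace_D, of q] that by (simp add: normal_distribution_def)
    show "n - P p n = n"
      using P[of p] U assms orth_proj_eq_0[OF subspace_D, of p n] by (simp add: normal_distribution_def)
  qed
qed

text \<open>Discharges the description in \<open>phi\<close>: by \<open>nabla_skew\<close> any two
  candidates, both in \<open>D p\<close>, have the same inner product with every vector of
  \<open>D p\<close>.\<close>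

lemma phi_section:
  assumes p: "p \<in> S" and v: "v \<in> TS p" and U: "open U" "p \<in> U"
    and N': "smooth_section (S \<inter> U) (normal_distribution D) N'"
  shows "\<phi> p v (N' p) = orth_proj (D p) (nabla (S \<inter> U) N' p v)"
  unfolding phi_def
proof (rule the_equality)
  show "\<exists>W M. open W \<and> p \<in> W \<and> smooth_section (S \<inter> W) (normal_distribution D) M \<and> M p = N' p \<and>
    orth_proj (D p) (nabla (S \<inter> U) N' p v) = orth_proj (D p) (nabla (S \<inter> W) M p v)"
    using U N' by blast
  fix w assume "\<exists>W M. open W \<and> p \<in> W \<and> smooth_section (S \<inter> W) (normal_distribution D) M \<and> M p = N' p \<and>
    w = orth_proj (D p) (nabla (S \<inter> W) M p v)"
  then obtain W M where W: "open W" "p \<in> W" and M: "smooth_section (S \<inter> W) (normal_distribution D) M" "M p = N' p"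
    and w: "w = orth_proj (D p) (nabla (S \<inter> W) M p v)" by blast
  have "w \<bullet> y = orth_proj (D p) (nabla (S \<inter> U) N' p v) \<bullet> y" if y: "y \<in> D p" for y
  proof -
    obtain V Y where V: "open V" "p \<in> V" and Y: "smooth_on V Y" "\<And>q. q \<in> S \<inter> V \<Longrightarrow> Y q \<in> D q" "Y p = y"
      using D_extension[OF p y] by blast
    have sY: "smooth_along (S \<inter> V) Y" using smooth_on_imp_along[OF V(1) Y(1)] by blast
    have "nabla (S \<inter> U) N' p v \<bullet> Y p = - (N' p \<bullet> nabla (S \<inter> V) Y p v)"
      by (rule nabla_skew[OF p v U V _ sY]) (use N' Y(2) in \<open>auto simp: smooth_section_def normal_iff\<close>)
    moreover have "nabla (S \<inter> W) M p v \<bullet> Y p = - (M p \<bullet> nabla (S \<inter> V) Y p v)"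
      by (rule nabla_skew[OF p v W V _ sY]) (use M Y(2) in \<open>auto simp: smooth_section_def normal_iff\<close>)
    ultimately show ?thesis using M(2) Y(3) orth_proj_inner[OF subspace_D[OF p] y] by (simp add: w)
  qed
  then have "(w - orth_proj (D p) (nabla (S \<inter> U) N' p v)) \<bullet> y = 0" if "y \<in> D p" for y
    using that by (simp add: inner_diff_left)
  moreover have "w - orth_proj (D p) (nabla (S \<inter> U) N' p v) \<in> D p"
    using orth_proj_in[OF subspace_D[OF p]] subspace_diff[OF subspace_D[OF p]] by (simp add: w)
  ultimately have "w - orth_proj (D p) (nabla (S \<inter> U) N' p v) = 0" by (metis inner_eq_zero_iff)
  then show "w = orth_proj (D p) (nabla (S \<inter> U) N' p v)" by simp
qed

lemma phi_smooth_section: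
  assumes p: "p \<in> S" and U: "open U" "p \<in> U" and N': "smooth_on U N'"
    and n: "\<And>q. q \<in> S \<inter> U \<Longrightarrow> N' q \<in> normal_distribution D q" and v: "v \<in> TS p"
  shows "\<phi> p v (N' p) = orth_proj (D p) (frechet_derivative N' (at p) v)"
proof -
  have "smooth_section (S \<inter> U) (normal_distribution D) N'"
    unfolding smooth_section_def using smooth_on_imp_along[OF U(1) N'] n by blast
  moreover have "nabla (S \<inter> U) N' p v = frechet_derivative N' (at p) v"
    by (rule nabla_eq[OF U N']) (use v tangent_space_Int_open[OF U] in auto)
  ultimately show ?thesis using phi_section[OF p v U] by simp
qed

lemma phi_in_D: "p \<in> S \<Longrightarrow> v \<in> TS p \<Longrightarrow> n \<in> normal_distribution D p \<Longrightarrow> \<phi> p v n \<in> D p"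
  by (rule normal_extension[of p n]) (use phi_smooth_section orth_proj_in[OF subspace_D] in metis)+

text \<open>\<open>phi\<close> is meaningful for tangent \<open>v\<close> only, so linearity is
  expressed by an everywhere defined linear map that agrees with it there.\<close>

lemma phi_linear_extension:
  assumes p: "p \<in> S" and n: "n \<in> normal_distribution D p"
  obtains L where "linear L" "\<And>v. v \<in> TS p \<Longrightarrow> \<phi> p v n = L v"
proof -
  obtain V Y where V: "open V" "p \<in> V" and Y: "smooth_on V Y" "\<And>q. q \<in> S \<inter> V \<Longrightarrow> Y q \<in> normal_distribution D q" "Y p = n"
    using normal_extension[OF assms] by blast
  have "linear (\<lambda>v. orth_proj (D p) (frechet_derivative Y (at p) v))"
    using linear_compose[OF smooth_on_linear_derivative[OF Y(1) V(2)] linear_orth_proj[OF subspace_D[OF p]]]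
    by (simp add: o_def)
  then show ?thesis using that phi_smooth_section[OF p V Y(1,2)] Y(3) by blast
qed

text \<open>The left-hand side of the solvability condition. As the image of a linear map it is a
  subspace, whereas \<open>Im\<phi> p\<close> is the image of a map linear in each of two
  arguments.\<close>

definition "K\<phi> p = (\<lambda>v. \<phi> p v (N p)) ` TS p"

lemma K\<phi>_subset: "p \<in> S \<Longrightarrow> K\<phi> p \<subseteq> Im\<phi> p"
  using N_normal unfolding K\<phi>_def phi_image_def by blast

lemma Im\<phi>_subset: "p \<in> S \<Longrightarrow> Im\<phi> p \<subseteq> D p"
  using phi_in_D unfolding phi_image_def by blast

text \<open>On \<open>TS p\<close> the shape operator is \<open>\<phi> p v (N p)\<close> followed by
  the projection of \<open>K\<phi> p\<close> to \<open>TS p\<close>. The composite has full rank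
  \<open>s\<close>, so neither factor can lose dimension.\<close>

lemma inj_phi_N:
  assumes p: "p \<in> S"
  shows "inj_on (\<lambda>v. \<phi> p v (N p)) (TS p)" "inj_on (orth_proj (TS p)) (K\<phi> p)"
    "subspace (K\<phi> p)" "dim (K\<phi> p) = s"
proof -
  obtain L where L: "linear L" "\<And>v. v \<in> TS p \<Longrightarrow> \<phi> p v (N p) = L v"
    using phi_linear_extension[OF p N_normal[OF p]] by blast
  have K: "K\<phi> p = L ` TS p" using L(2) by (auto simp: K\<phi>_def)
  show sK: "subspace (K\<phi> p)" unfolding K by (rule linear_subspace_image[OF L(1) subspace_TS[OF p]])
  let ?P = "orth_proj (TS p)"
  have lP: "linear ?P" using linear_orth_proj subspace_TS p by blast
  have "shape_operator S D N p ` TS p = ?P ` K\<phi> p"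
    unfolding K\<phi>_def by (auto simp: shape_operator_def image_image)
  then have d: "dim (?P ` K\<phi> p) = s" using shape_rank[OF p] by simp
  have "dim (K\<phi> p) \<le> s" unfolding K using dim_image_le[OF L(1), of "TS p"] dim_TS[OF p] by simp
  moreover have "s \<le> dim (K\<phi> p)" using dim_image_le[OF lP, of "K\<phi> p"] d by simp
  ultimately show dK: "dim (K\<phi> p) = s" by simp
  have "inj_on L (TS p)"
    by (rule full_dim_image_imp_inj_on[OF L(1) subspace_TS[OF p]]) (use dK K dim_TS[OF p] in simp)
  then show "inj_on (\<lambda>v. \<phi> p v (N p)) (TS p)" using L(2) by (simp add: inj_on_def)
  show "inj_on ?P (K\<phi> p)"
    by (rule full_dim_image_imp_inj_on[OF lP sK]) (use dK d in simp)
qed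

lemma phi_N_eq_0_iff:
  assumes "p \<in> S" "v \<in> TS p" shows "\<phi> p v (N p) = 0 \<longleftrightarrow> v = 0"
proof -
  obtain L where L: "linear L" "\<And>v. v \<in> TS p \<Longrightarrow> \<phi> p v (N p) = L v"
    using phi_linear_extension[OF assms(1) N_normal[OF assms(1)]] by blast
  have 0: "0 \<in> TS p" using subspace_TS[OF assms(1)] subspace_0 by blast
  then have "\<phi> p 0 (N p) = 0" using L linear_0 by metis
  then show ?thesis using inj_phi_N(1)[OF assms(1)] assms(2) 0 by (metis inj_onD)
qed

lemma phi_0: "p \<in> S \<Longrightarrow> n \<in> normal_distribution D p \<Longrightarrow> \<phi> p 0 n = 0"
  using phi_linear_extension linear_0 subspace_0 subspace_TS by metis

definition "Rul p = D p \<inter> orthogonal_comp (Im\<phi> p)"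

text \<open>Injectivity and equal dimensions make the projection of \<open>K\<phi> p\<close> to
  \<open>TS p\<close> surjective. So \<open>v\<close> is the projection of some \<open>w\<close>,
  and \<open>v \<bullet> v = w \<bullet> v\<close>. This is the transversality of \<open>S\<close>
  to the rulings.\<close>

lemma TS_perp_K\<phi>:
  assumes p: "p \<in> S" and v: "v \<in> TS p" and perp: "\<And>w. w \<in> K\<phi> p \<Longrightarrow> v \<bullet> w = 0"
  shows "v = 0"
proof -
  let ?P = "orth_proj (TS p)"
  note T = subspace_TS[OF p]
  have "dim (?P ` K\<phi> p) = s"
    using dim_image_eq[OF linear_orth_proj[OF T], of "K\<phi> p"] inj_phi_N[OF p] by (simp add: span_eq_iff[THEN iffD2])
  moreover have "subspace (?P ` K\<phi> p)" using linear_subspace_image[OF linear_orth_proj[OF T]] inj_phi_N(3)[OF p] by blast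
  moreover have "?P ` K\<phi> p \<subseteq> TS p" using orth_proj_in[OF T] by blast
  ultimately have "?P ` K\<phi> p = TS p" using subspace_dim_equal[OF _ T] dim_TS[OF p] by simp
  then obtain w where w: "w \<in> K\<phi> p" "v = ?P w" using v by (metis imageE)
  have "v \<bullet> v = w \<bullet> v" using orth_proj_inner[OF T v, of w] w by simp
  then show ?thesis using perp[OF w(1)] by (simp add: inner_commute)
qed

end

section \<open>Consequences of the solvability condition\<close>

locale solvable_cauchy_data = cauchy_data +
  assumes cond: "p \<in> S \<Longrightarrow> {phi S D p v (N p) |v. v \<in> tangent_space S p} = phi_image S D p"
begin

lemma Im\<phi>_eq: "p \<in> S \<Longrightarrow> Im\<phi> p = K\<phi> p"
  using cond unfolding K\<phi>_def by blast

lemma subspace_Im\<phi>: "p \<in> S \<Longrightarrow> subspace (Im\<phi> p)" and dim_Im\<phi>: "p \<in> S \<Longrightarrow> dim (Im\<phi> p) = s"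
  using Im\<phi>_eq inj_phi_N by auto

lemma subspace_Rul: "p \<in> S \<Longrightarrow> subspace (Rul p)"
  unfolding Rul_def by (intro subspace_inter subspace_D subspace_orthogonal_comp)

lemma TS_Int_perp: "p \<in> S \<Longrightarrow> v \<in> TS p \<Longrightarrow> v \<in> orthogonal_comp (Im\<phi> p) \<Longrightarrow> v = 0"
  using TS_perp_K\<phi> Im\<phi>_eq by (simp add: orthogonal_comp_iff)

lemma dim_Rul:
  assumes p: "p \<in> S" shows "dim (Rul p) + s = m"
proof -
  have "Rul p = {y \<in> D p. \<forall>x\<in>Im\<phi> p. orthogonal x y}" by (auto simp: Rul_def orthogonal_comp_def)
  then show ?thesis
    using dim_subspace_orthogonal_to_vectors[OF subspace_Im\<phi>[OF p] subspace_D[OF p] Im\<phi>_subset[OF p]]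
      dim_Im\<phi>[OF p] dim_D[OF p] by simp
qed

text \<open>Smoothness of the family \<open>Im\<phi> q\<close>. By the condition it is exhausted by
  the values of \<open>phi\<close> on \<open>N\<close> alone; \<open>DG q\<close> carries a basis of
  \<open>TS p\<close> to one of \<open>TS q\<close>, and this gives \<open>s\<close> spanning fields
  that extend smoothly off \<open>S\<close>.\<close>

lemma projection_Im\<phi>:
  assumes p: "p \<in> S"
  obtains U and P :: "'a \<Rightarrow> 'a \<Rightarrow> 'a" where "open U" "p \<in> U" "\<And>q. linear (P q)"
    "\<And>Y V. open V \<Longrightarrow> V \<subseteq> U \<Longrightarrow> smooth_on V Y \<Longrightarrow> smooth_on V (\<lambda>q. P q (Y q))"
    "\<And>q. q \<in> S \<inter> U \<Longrightarrow> P q = orth_proj (Im\<phi> q)"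
proof -
  obtain \<Omega> U0 G where "smooth_graph S (TS p) \<Omega> U0 G" and p0: "p \<in> U0" using graph_S[OF p] by blast
  interpret g: smooth_graph S "TS p" \<Omega> U0 G by fact
  obtain U1 PD where U1: "open U1" "p \<in> U1" and PD: "\<And>q. linear (PD q)"
    "\<And>Y V. open V \<Longrightarrow> V \<subseteq> U1 \<Longrightarrow> smooth_on V Y \<Longrightarrow> smooth_on V (\<lambda>q. PD q (Y q))"
    "\<And>q. q \<in> S \<inter> U1 \<Longrightarrow> PD q = orth_proj (D q)"
    using projection_D[OF p] by blast
  obtain U2 n where U2: "open U2" "p \<in> U2" and n: "smooth_on U2 n" "\<And>q. q \<in> S \<inter> U2 \<Longrightarrow> N q = n q"
    using smooth_alongE[OF smooth_along_N p] by blast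
  obtain B where B: "B \<subseteq> TS p" "independent B" "span B = TS p" "card B = s"
    using basis_exists[of "TS p"] subspace_TS[OF p] dim_TS[OF p] by (metis span_eq_iff span_minimal subset_antisym span_mono)
  have finB: "finite B" using B independent_imp_finite by blast
  let ?U = "U0 \<inter> U1 \<inter> U2"
  have U: "open ?U" "p \<in> ?U" "?U \<subseteq> U1" using U1 U2 p0 g.open_U by auto
  have smn: "smooth_on ?U n" "smooth_on ?U G"
    using n(1) g.smooth_G g.U_\<Omega> by (auto intro: smooth_on_subset)
  let ?X = "\<lambda>b q. PD q (frechet_derivative n (at q) (g.DG q b))"
  have smX: "smooth_on ?U (?X b)" for b
    by (intro PD(2)[OF U(1,3)] smooth_on_derivative U(1) smn smooth_on_derivative_const)
  have X: "?X b q = \<phi> q (g.DG q b) (N q)" if q: "q \<in> S \<inter> ?U" for b q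
  proof -
    have "\<phi> q (g.DG q b) (n q) = orth_proj (D q) (frechet_derivative n (at q) (g.DG q b))"
      by (rule phi_smooth_section[OF _ U2(1) _ n(1)])
        (use q n(2) N_normal g.DG_tangent in \<open>auto simp flip: n(2)\<close>)
    then show ?thesis using PD(3)[of q] n(2)[of q] q by simp
  qed
  have span: "span ((\<lambda>b. ?X b q) ` B) = Im\<phi> q" if q: "q \<in> S \<inter> ?U" for q
  proof -
    have qS: "q \<in> S" and qU: "q \<in> S \<inter> U0" "q \<in> \<Omega>" using q g.U_in by auto
    obtain L where L: "linear L" "\<And>v. v \<in> TS q \<Longrightarrow> \<phi> q v (N q) = L v"
      using phi_linear_extension[OF qS N_normal[OF qS]] by blast
    have DGT: "g.DG q ` TS p = TS q"
    proof
      show "g.DG q ` TS p \<subseteq> TS q" using g.DG_tangent[OF qU(1)] by blast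
      show "TS q \<subseteq> g.DG q ` TS p"
        using g.tangent_iff[OF qU(1)] g.DG_proj[OF qU(2)] orth_proj_in[OF g.T] by (metis image_eqI subsetI)
    qed
    have "(\<lambda>b. ?X b q) ` B = L ` g.DG q ` B"
      using X[OF q] L(2) g.DG_tangent[OF qU(1)] by (auto simp: image_image)
    then have "span ((\<lambda>b. ?X b q) ` B) = L ` g.DG q ` span B"
      using linear_span_image[OF L(1)] linear_span_image[OF g.linear_DG[OF qU(2)]] by metis
    also have "\<dots> = K\<phi> q" using L(2) by (simp add: B(3) DGT K\<phi>_def)
    finally show ?thesis using Im\<phi>_eq[OF qS] by simp
  qed
  have "dim (span ((\<lambda>b. ?X b p) ` B)) = card B" using span[of p] dim_Im\<phi>[OF p] B p U by simp
  then have "\<exists>V. open V \<and> p \<in> V \<and> V \<subseteq> ?U \<and> (\<forall>q\<in>V. dim (span ((\<lambda>b. ?X b q) ` B)) = card B)"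
    by (rule full_span_open[OF finB U(1) smooth_on_continuous_on[OF smX] U(2)])
  then obtain W where W: "open W" "p \<in> W" "W \<subseteq> ?U" "\<And>q. q \<in> W \<Longrightarrow> dim (span ((\<lambda>b. ?X b q) ` B)) = card B"
    by blast
  show ?thesis
  proof (rule that[OF W(1,2), of "\<lambda>q. orth_proj (span ((\<lambda>b. ?X b q) ` B))"])
    fix V and Y :: "'a \<Rightarrow> 'a" assume V: "open V" "V \<subseteq> W" "smooth_on V Y"
    show "smooth_on V (\<lambda>q. orth_proj (span ((\<lambda>b. ?X b q) ` B)) (Y q))"
      by (rule smooth_on_orth_proj_span[OF finB V(1) smooth_on_subset[OF _ smX] _ V(3)]) (use V W in auto)
  next
    fix q assume "q \<in> S \<inter> W"
    then have "q \<in> S \<inter> ?U" using W(3) by blast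
    then show "orth_proj (span ((\<lambda>b. ?X b q) ` B)) = orth_proj (Im\<phi> q)" using span by simp
  qed (auto intro: linear_orth_proj)
qed

text \<open>\<open>Rul p\<close> is the orthogonal complement of \<open>Im\<phi> p\<close> inside
  \<open>D p\<close>, whence a difference of two projections that are already known to vary
  smoothly.\<close>

lemma orth_proj_Rul:
  assumes p: "p \<in> S"
  shows "orth_proj (Rul p) x = orth_proj (D p) x - orth_proj (Im\<phi> p) x"
proof (rule orth_proj_unique[OF subspace_Rul[OF p]])
  let ?PD = "orth_proj (D p)" and ?PI = "orth_proj (Im\<phi> p)"
  note sD = subspace_D[OF p] and sI = subspace_Im\<phi>[OF p]
  have ID: "?PI x \<in> D p" using orth_proj_in[OF sI] Im\<phi>_subset[OF p] by blast
  have "(?PD x - ?PI x) \<bullet> y = 0" if "y \<in> Im\<phi> p" for y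
    using that Im\<phi>_subset[OF p] orth_proj_inner[OF sD, of y x] orth_proj_inner[OF sI, of y x]
    by (auto simp: inner_diff_left)
  then show "?PD x - ?PI x \<in> Rul p"
    unfolding Rul_def using ID orth_proj_in[OF sD] subspace_diff[OF sD] by (simp add: orthogonal_comp_iff)
  have "(x - (?PD x - ?PI x)) \<bullet> y = 0" if "y \<in> Rul p" for y
  proof -
    have "y \<in> D p" "orth_proj (Im\<phi> p) x \<bullet> y = 0"
      using that orth_proj_in[OF sI, of x] by (auto simp: Rul_def orthogonal_comp_iff inner_commute)
    then show ?thesis using orth_proj_inner[OF sD, of y x] by (simp add: inner_diff_left)
  qed
  then show "x - (?PD x - ?PI x) \<in> orthogonal_comp (Rul p)" by (simp add: orthogonal_comp_iff)
qed

end

section \<open>Foot points near the initial submanifold\<close>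

context solvable_cauchy_data
begin

text \<open>\<open>\<alpha>\<close> assigns to a point near \<open>p\<close> its foot point on \<open>S\<close> along the orthogonal complements of the
  spaces \<open>Im\<phi> q\<close>; the coordinates \<open>\<kappa>\<close> flatten the set of points reached along \<open>Rul q\<close> alone.\<close>

definition foot_chart where
  "foot_chart p \<epsilon> U V \<alpha> \<kappa> \<Psi> \<longleftrightarrow> 0 < \<epsilon> \<and> open U \<and> p \<in> U \<and> open V \<and> smooth_on U \<kappa> \<and> \<kappa> ` U = V \<and>
     smooth_on V \<Psi> \<and> \<Psi> ` V = U \<and> (\<forall>z\<in>U. \<Psi> (\<kappa> z) = z) \<and> (\<forall>y\<in>V. \<kappa> (\<Psi> y) = y) \<and> smooth_on U \<alpha> \<and>
     (\<forall>z\<in>U. \<alpha> z \<in> S \<and> z - \<alpha> z \<in> orthogonal_comp (Im\<phi> (\<alpha> z)) \<and> (z - \<alpha> z \<in> Rul (\<alpha> z) \<longleftrightarrow> \<kappa> z \<in> D p)) \<and>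
     (\<forall>q\<in>S. \<forall>h\<in>orthogonal_comp (Im\<phi> q). dist q p < \<epsilon> \<and> norm h < \<epsilon> \<longrightarrow> q + h \<in> U \<and> \<alpha> (q + h) = q)"

lemma oblique_projection:
  assumes p: "p \<in> S"
  obtains \<sigma> where "linear \<sigma>" "\<And>x. \<sigma> x \<in> TS p" "\<And>t. t \<in> TS p \<Longrightarrow> \<sigma> t = t"
    "\<And>x. x \<in> normal_distribution D p \<Longrightarrow> \<sigma> x = 0" "\<And>x. x \<in> D p \<Longrightarrow> x - \<sigma> x \<in> Rul p"
proof -
  let ?PI = "orth_proj (Im\<phi> p)"
  note sI = subspace_Im\<phi>[OF p] and sT = subspace_TS[OF p] and sD = subspace_D[OF p]
  have lPI: "linear ?PI" using linear_orth_proj[OF sI] .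
  have inj: "inj_on ?PI (TS p)"
  proof (rule inj_onI)
    fix x y assume xy: "x \<in> TS p" "y \<in> TS p" "?PI x = ?PI y"
    then have "?PI (x - y) = 0" using linear_diff[OF lPI] by simp
    then have "x - y \<in> orthogonal_comp (Im\<phi> p)" using orth_proj_eq_0_iff[OF sI] by blast
    then have "x - y = 0" by (rule TS_Int_perp[OF p subspace_diff[OF sT xy(1,2)]])
    then show "x = y" by simp
  qed
  obtain g where g: "range g \<subseteq> TS p" "linear g" "\<And>v. v \<in> TS p \<Longrightarrow> g (?PI v) = v"
    using linear_exists_left_inverse_on[OF lPI sT inj] by blast
  have "dim (?PI ` TS p) = s"
    using dim_image_eq[OF lPI, of "TS p"] inj sT dim_TS[OF p] by (simp add: span_eq_iff[THEN iffD2])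
  moreover have "subspace (?PI ` TS p)" using linear_subspace_image[OF lPI sT] .
  moreover have "?PI ` TS p \<subseteq> Im\<phi> p" using orth_proj_in[OF sI] by blast
  ultimately have onto: "?PI ` TS p = Im\<phi> p" using subspace_dim_equal[OF _ sI] dim_Im\<phi>[OF p] by simp
  have gT: "g x \<in> TS p" for x using g(1) by blast
  show ?thesis
  proof (rule that[of "\<lambda>x. g (?PI x)"])
    show "linear (\<lambda>x. g (?PI x))" using linear_compose[OF lPI g(2)] by (simp add: o_def)
    show "g (?PI x) = 0" if "x \<in> normal_distribution D p" for x
    proof -
      have "x \<in> orthogonal_comp (Im\<phi> p)"
        using that Im\<phi>_subset[OF p] by (auto simp: normal_iff orthogonal_comp_iff)
      then show ?thesis using orth_proj_eq_0[OF sI] linear_0[OF g(2)] by simp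
    qed
    show "x - g (?PI x) \<in> Rul p" if "x \<in> D p" for x
    proof -
      obtain t where t: "t \<in> TS p" "?PI x = ?PI t" using onto orth_proj_in[OF sI, of x] by (metis imageE)
      then have "?PI (x - g (?PI x)) = 0" using g(3)[OF t(1)] linear_diff[OF lPI] by simp
      then have "x - g (?PI x) \<in> orthogonal_comp (Im\<phi> p)" using orth_proj_eq_0_iff[OF sI] by blast
      moreover have "x - g (?PI x) \<in> D p" using that gT tangent_D[OF p] subspace_diff[OF sD] by blast
      ultimately show ?thesis by (simp add: Rul_def)
    qed
  qed (use gT g(3) in auto)
qed

text \<open>The inverse chart is constructed first. A vector \<open>y\<close> splits at
  \<open>p\<close> into the tangent part \<open>\<sigma> y\<close>, the ruling part
  \<open>\<Lambda> y\<close> and the normal part \<open>\<nu> y\<close>. The first selects a foot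
  point \<open>Q y\<close> on \<open>S\<close>; the other two are projected into the ruling and the
  normal space at \<open>Q y\<close>. The resulting map \<open>\<Psi>\<close> has the identity as
  derivative at 0.\<close>

lemma foot_chart_exists:
  assumes p: "p \<in> S"
  shows "\<exists>\<epsilon> U V \<alpha> \<kappa> \<Psi>. foot_chart p \<epsilon> U V \<alpha> \<kappa> \<Psi>"
proof -
  obtain \<Omega> U0 G where "smooth_graph S (TS p) \<Omega> U0 G" and p0: "p \<in> U0" using graph_S[OF p] by blast
  interpret g: smooth_graph S "TS p" \<Omega> U0 G by fact
  obtain U1 PD where U1: "open U1" "p \<in> U1" and PD: "\<And>q. linear (PD q)"
    "\<And>Y V. open V \<Longrightarrow> V \<subseteq> U1 \<Longrightarrow> smooth_on V Y \<Longrightarrow> smooth_on V (\<lambda>q. PD q (Y q))"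
    "\<And>q. q \<in> S \<inter> U1 \<Longrightarrow> PD q = orth_proj (D q)"
    using projection_D[OF p] by blast
  obtain U2 PI where U2: "open U2" "p \<in> U2" and PI: "\<And>q. linear (PI q)"
    "\<And>Y V. open V \<Longrightarrow> V \<subseteq> U2 \<Longrightarrow> smooth_on V Y \<Longrightarrow> smooth_on V (\<lambda>q. PI q (Y q))"
    "\<And>q. q \<in> S \<inter> U2 \<Longrightarrow> PI q = orth_proj (Im\<phi> q)"
    using projection_Im\<phi>[OF p] by blast
  obtain \<sigma> where \<sigma>: "linear \<sigma>" "\<And>x. \<sigma> x \<in> TS p" "\<And>t. t \<in> TS p \<Longrightarrow> \<sigma> t = t"
    "\<And>x. x \<in> normal_distribution D p \<Longrightarrow> \<sigma> x = 0" "\<And>x. x \<in> D p \<Longrightarrow> x - \<sigma> x \<in> Rul p"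
    using oblique_projection[OF p] by blast
  let ?P = "orth_proj (D p)"
  note sD = subspace_D[OF p]
  have lP: "linear ?P" using linear_orth_proj[OF sD] .
  define \<Lambda> where "\<Lambda> y = ?P y - \<sigma> y" for y
  define \<nu> where "\<nu> y = y - ?P y" for y
  have lin: "linear \<Lambda>" "linear \<nu>"
    unfolding \<Lambda>_def[abs_def] \<nu>_def[abs_def] by (intro linear_compose_sub lP \<sigma>(1) linear_ident)+
  have \<nu>N: "\<nu> y \<in> normal_distribution D p" for y
    using diff_orth_proj_in[OF sD] by (simp add: \<nu>_def normal_distribution_def)
  have \<Lambda>R: "\<Lambda> y \<in> Rul p" for y
  proof -
    have "\<sigma> y = \<sigma> (?P y + \<nu> y)" by (simp add: \<nu>_def)
    also have "\<dots> = \<sigma> (?P y)" using \<sigma>(4)[OF \<nu>N] linear_add[OF \<sigma>(1)] by simp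
    finally show ?thesis using \<sigma>(5)[OF orth_proj_in[OF sD], of y] by (simp add: \<Lambda>_def)
  qed
  have sum: "\<sigma> y + \<Lambda> y + \<nu> y = y" for y by (simp add: \<Lambda>_def \<nu>_def)
  have onT: "\<Lambda> t = 0" "\<nu> t = 0" if "t \<in> TS p" for t
    using that \<sigma>(3)[OF that] orth_proj_id[OF sD, of t] tangent_D[OF p] by (auto simp: \<Lambda>_def \<nu>_def)
  define MM where "MM q y = (PD q (\<Lambda> y) - PI q (\<Lambda> y)) + (\<nu> y - PD q (\<nu> y))" for q y
  \<comment> \<open>\<open>MM q\<close> kills \<open>TS p\<close>. Adding the projection of
    \<open>\<sigma> y\<close> into \<open>Im\<phi> q\<close> makes the map invertible near
    \<open>p\<close>, so that its lower bound \<open>k\<close> also controls solutions of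
    \<open>MM q y = h\<close>.\<close>
  define L where "L q y = PI q (\<sigma> y) + MM q y" for q y
  have linM: "linear (MM q)" for q
    unfolding MM_def[abs_def]
    using linear_compose[OF lin(1) PD(1)[of q]] linear_compose[OF lin(1) PI(1)[of q]]
      linear_compose[OF lin(2) PD(1)[of q]] lin
    by (intro linear_compose_add linear_compose_sub) (simp_all add: o_def)
  have linL: "linear (L q)" for q
    unfolding L_def[abs_def] using linear_compose[OF \<sigma>(1) PI(1)[of q]] linM
    by (intro linear_compose_add) (simp_all add: o_def)
  let ?W = "U0 \<inter> U1 \<inter> U2"
  have W: "open ?W" "p \<in> ?W" "?W \<subseteq> U1" "?W \<subseteq> U2" using U1 U2 p0 g.open_U by auto
  have PDq: "PD q x = orth_proj (D q) x" and PIq: "PI q x = orth_proj (Im\<phi> q) x"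
    and PRq: "PD q x - PI q x = orth_proj (Rul q) x" if "q \<in> S \<inter> ?W" for q x
    using PD(3)[of q] PI(3)[of q] that orth_proj_Rul[of q x] by auto
  have MH: "MM q y \<in> orthogonal_comp (Im\<phi> q)" if q: "q \<in> S \<inter> ?W" for q y
  proof -
    have "PD q (\<Lambda> y) - PI q (\<Lambda> y) \<in> orthogonal_comp (Im\<phi> q)"
      using orth_proj_in[OF subspace_Rul, of q] q PRq[OF q] by (auto simp: Rul_def)
    moreover have "\<nu> y - PD q (\<nu> y) \<in> orthogonal_comp (Im\<phi> q)"
      using diff_orth_proj_in[OF subspace_D, of q "\<nu> y"] q PDq[OF q] Im\<phi>_subset[of q]
      by (auto simp: orthogonal_comp_iff)
    ultimately show ?thesis unfolding MM_def by (rule subspace_add[OF subspace_orthogonal_comp])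
  qed
  have smM: "smooth_on ?W (\<lambda>q. MM q e)" for e
    unfolding MM_def
    by (intro smooth_on_add smooth_on_diff PD(2)[OF W(1,3)] PI(2)[OF W(1,4)] smooth_on_const W(1))
  have smL: "smooth_on ?W (\<lambda>q. L q e)" for e
    unfolding L_def by (intro smooth_on_add smM PI(2)[OF W(1,4)] smooth_on_const W(1))
  have pW: "p \<in> S \<inter> ?W" using p W by blast
  have MMp: "MM p y = \<Lambda> y + \<nu> y" for y
    using PRq[OF pW] PDq[OF pW] orth_proj_id[OF subspace_Rul[OF p] \<Lambda>R[of y]] orth_proj_eq_0[OF sD, of "\<nu> y"] \<nu>N[of y]
    by (simp add: MM_def normal_distribution_def)
  have "inj (L p)"
  proof (rule linear_injective_0[OF linL, THEN iffD2], intro allI impI)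
    fix y assume "L p y = 0"
    then have z: "PI p (\<sigma> y) + (\<Lambda> y + \<nu> y) = 0" by (simp add: L_def MMp)
    have a: "PI p (\<sigma> y) \<in> Im\<phi> p" using PIq[OF pW] orth_proj_in[OF subspace_Im\<phi>[OF p]] by simp
    have "PI p (\<sigma> y) = 0"
    proof -
      have "PI p (\<sigma> y) = - (\<Lambda> y + \<nu> y)" using z by (metis eq_neg_iff_add_eq_0)
      then have "PI p (\<sigma> y) \<in> orthogonal_comp (Im\<phi> p)"
        using MH[OF pW, of y] MMp subspace_neg[OF subspace_orthogonal_comp] by metis
      then show ?thesis using a by (auto simp: orthogonal_comp_iff)
    qed
    then have "\<sigma> y \<in> orthogonal_comp (Im\<phi> p)"
      using PIq[OF pW] orth_proj_eq_0_iff[OF subspace_Im\<phi>[OF p]] by simp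
    then have "\<sigma> y = 0" using TS_Int_perp[OF p \<sigma>(2)] by blast
    then show "y = 0" using z sum[of y] \<open>PI p (\<sigma> y) = 0\<close> by simp
  qed
  then obtain r k where r: "r > 0" "k > 0" "ball p r \<subseteq> ?W" and k: "\<And>q x. q \<in> ball p r \<Longrightarrow> k * norm x \<le> norm (L q x)"
    using linear_family_bounded_below[OF W(1,2) linL smooth_on_continuous_on[OF smL]] by blast
  have Linj: "x = 0" if "q \<in> ball p r" "L q x = 0" for q x
    using k[OF that(1), of x] that(2) r(2) by (simp add: mult_le_0_iff)
  define Q where "Q y = G (p + \<sigma> y)" for y
  have bl\<sigma>: "bounded_linear \<sigma>" using \<sigma>(1) by (simp add: linear_conv_bounded_linear)
  have sm\<sigma>: "smooth_on A (\<lambda>y. p + \<sigma> y)" if "open A" for A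
    by (intro smooth_on_add smooth_on_const that smooth_on_bounded_linear_comp[OF bl\<sigma> that smooth_on_id[OF that]])
  define V1 where "V1 = UNIV \<inter> (\<lambda>y. p + \<sigma> y) -` \<Omega>"
  have oV1: "open V1" unfolding V1_def
    by (rule continuous_open_preimage[OF smooth_on_continuous_on[OF sm\<sigma>[OF open_UNIV]] open_UNIV g.open_\<Omega>])
  have smQ: "smooth_on V1 Q" unfolding Q_def
    by (rule smooth_on_compose[OF oV1 g.open_\<Omega> sm\<sigma>[OF oV1] g.smooth_G]) (auto simp: V1_def)
  define V2 where "V2 = V1 \<inter> Q -` ball p r"
  have oV2: "open V2" unfolding V2_def
    by (rule continuous_open_preimage[OF smooth_on_continuous_on[OF smQ] oV1 open_ball])
  have p\<Omega>: "p \<in> \<Omega>" using g.U_in p p0 by blast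
  have Q0: "Q 0 = p" using g.G_id p p0 linear_0[OF \<sigma>(1)] by (simp add: Q_def)
  have V0: "0 \<in> V2" using p\<Omega> r Q0 linear_0[OF \<sigma>(1)] by (simp add: V1_def V2_def)
  have QS: "Q y \<in> S \<inter> ?W" "Q y \<in> ball p r" if "y \<in> V2" for y
    using that g.G_in r(3) by (auto simp: V1_def V2_def Q_def)
  define \<Psi> where "\<Psi> y = Q y + MM (Q y) y" for y
  have smQ2: "smooth_on V2 Q" using smQ smooth_on_subset by (metis V2_def inf_le1)
  have smMQ: "smooth_on V2 (\<lambda>y. MM (Q y) e)" for e
    by (rule smooth_on_compose[OF oV2 W(1) smQ2 smM]) (use QS in blast)
  have sm\<Psi>: "smooth_on V2 \<Psi>"
    unfolding \<Psi>_def[abs_def]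
    by (intro smooth_on_add smQ2 oV2 smooth_on_linear_family[OF oV2 linM smMQ] smooth_on_id)
  have d\<Psi>: "(\<Psi> has_derivative (\<lambda>v. g.DG p (\<sigma> v) + MM (Q 0) v)) (at 0)"
    unfolding \<Psi>_def
  proof (rule has_derivative_add)
    have "((\<lambda>y. p + \<sigma> y) has_derivative (\<lambda>v. 0 + \<sigma> v)) (at 0)"
      by (intro has_derivative_add has_derivative_const bounded_linear_imp_has_derivative[OF bl\<sigma>])
    then have "((\<lambda>y. p + \<sigma> y) has_derivative \<sigma>) (at 0)" by simp
    moreover have "(G has_derivative g.DG p) (at (p + \<sigma> 0))"
      using g.DG_has_derivative[OF p\<Omega>] linear_0[OF \<sigma>(1)] by simp
    ultimately show "(Q has_derivative (\<lambda>v. g.DG p (\<sigma> v))) (at 0)"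
      unfolding Q_def[abs_def] by (rule has_derivative_compose)
    show "((\<lambda>y. MM (Q y) y) has_derivative MM (Q 0)) (at 0)"
      by (rule has_derivative_linear_family_at_zero[OF oV2 V0 linM])
        (use smooth_on_has_derivative[OF smMQ V0] in \<open>auto simp: differentiable_def\<close>)
  qed
  have "(\<lambda>v. g.DG p (\<sigma> v) + MM (Q 0) v) = (\<lambda>v. v)"
    using g.tangent_iff[of p] \<sigma>(2) p p0 sum by (auto simp: Q0 MMp add.assoc)
  then have "frechet_derivative \<Psi> (at 0) = (\<lambda>v. v)" using frechet_derivative_at[OF d\<Psi>] by simp
  then have "inj (frechet_derivative \<Psi> (at 0))" by simp
  then obtain V U \<kappa> where V: "open V" "V \<subseteq> V2" "0 \<in> V" and U: "open U" "\<Psi> ` V = U" "\<kappa> ` U = V"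
    "smooth_on U \<kappa>" "\<And>y. y \<in> V \<Longrightarrow> \<kappa> (\<Psi> y) = y" "\<And>z. z \<in> U \<Longrightarrow> \<Psi> (\<kappa> z) = z"
    using smooth_inverse_function[OF oV2 sm\<Psi> V0] by metis
  define \<alpha> where "\<alpha> z = Q (\<kappa> z)" for z
  have sm\<alpha>: "smooth_on U \<alpha>" unfolding \<alpha>_def[abs_def]
    by (rule smooth_on_compose[OF U(1) oV2 U(4) smQ2]) (use U(3) V(2) in auto)
  have \<kappa>V: "\<kappa> z \<in> V2" if "z \<in> U" for z using that U(3) V(2) by blast
  have \<alpha>: "\<alpha> z \<in> S \<inter> ?W" "\<alpha> z \<in> ball p r" "z - \<alpha> z = MM (\<alpha> z) (\<kappa> z)" if "z \<in> U" for z
    using QS[OF \<kappa>V[OF that]] U(6)[OF that] by (auto simp: \<alpha>_def \<Psi>_def algebra_simps)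
  \<comment> \<open>The two summands of \<open>MM\<close> lie in \<open>Rul\<close> and in the
    complement of \<open>D\<close> at the foot point. Membership of the sum in \<open>Rul\<close>
    annihilates the second, and invertibility of \<open>L\<close> then gives
    \<open>\<nu> ?y = 0\<close>.\<close>
  have slice: "z - \<alpha> z \<in> Rul (\<alpha> z) \<longleftrightarrow> \<kappa> z \<in> D p" if z: "z \<in> U" for z
  proof -
    let ?q = "\<alpha> z" and ?y = "\<kappa> z"
    note q = \<alpha>(1)[OF z]
    have R: "PD ?q (\<Lambda> ?y) - PI ?q (\<Lambda> ?y) \<in> Rul ?q" using PRq[OF q] orth_proj_in[OF subspace_Rul] q by auto
    show ?thesis
    proof
      assume "?y \<in> D p"
      then have "\<nu> ?y = 0" by (simp add: \<nu>_def orth_proj_id[OF sD])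
      then show "z - ?q \<in> Rul ?q" using R linear_0[OF PD(1)] by (simp add: \<alpha>(3)[OF z] MM_def)
    next
      assume "z - ?q \<in> Rul ?q"
      then have "MM ?q ?y - (PD ?q (\<Lambda> ?y) - PI ?q (\<Lambda> ?y)) \<in> Rul ?q"
        using R subspace_diff[OF subspace_Rul] q by (simp add: \<alpha>(3)[OF z])
      then have "\<nu> ?y - PD ?q (\<nu> ?y) \<in> D ?q" by (simp add: MM_def Rul_def)
      moreover have "\<nu> ?y - PD ?q (\<nu> ?y) \<in> orthogonal_comp (D ?q)"
        using diff_orth_proj_in[OF subspace_D] q by (simp add: PDq[OF q])
      ultimately have 0: "\<nu> ?y - PD ?q (\<nu> ?y) = 0" by (auto simp: orthogonal_comp_iff)
      have \<nu>\<nu>: "?P (\<nu> ?y) = 0" using orth_proj_eq_0[OF sD, of "\<nu> ?y"] \<nu>N by (simp add: normal_distribution_def)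
      have "L ?q (\<nu> ?y) = 0"
        using 0 \<nu>\<nu> \<sigma>(4)[OF \<nu>N[of ?y]] by (simp add: L_def MM_def \<Lambda>_def \<nu>_def[of "\<nu> ?y"] linear_0[OF PD(1)] linear_0[OF PI(1)])
      then have "\<nu> ?y = 0" using Linj \<alpha>(2)[OF z] by blast
      then have "?y = ?P ?y" by (simp add: \<nu>_def)
      then show "?y \<in> D p" using orth_proj_in[OF sD] by metis
    qed
  qed
  obtain d where d: "d > 0" "ball 0 d \<subseteq> V" using V openE by blast
  obtain r' where r': "r' > 0" "ball p r' \<subseteq> U0" using p0 g.open_U openE by blast
  \<comment> \<open>One half of \<open>d\<close> is reserved for the tangent part of the preimage
    and one half for the rest, whose size is bounded through \<open>k\<close>; \<open>r\<close> and
    \<open>r'\<close> keep the foot point where \<open>L\<close> is bounded below and where the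
    graph chart applies.\<close>
  define \<epsilon> where "\<epsilon> = Min {d / 2, k * (d / 2), r, r'}"
  have \<epsilon>: "\<epsilon> > 0" "\<epsilon> \<le> d / 2" "\<epsilon> \<le> k * (d / 2)" "\<epsilon> \<le> r" "\<epsilon> \<le> r'" using d r r' by (auto simp: \<epsilon>_def)
  have box: "q + h \<in> U \<and> \<alpha> (q + h) = q"
    if q: "q \<in> S" and h: "h \<in> orthogonal_comp (Im\<phi> q)" and near: "dist q p < \<epsilon>" "norm h < \<epsilon>" for q h
  proof -
    have qr: "q \<in> ball p r" "q \<in> U0" using near \<epsilon> r'(2) by (auto simp: dist_commute subset_iff)
    then have qW: "q \<in> S \<inter> ?W" using r(3) q by blast
    have "bij (L q)"
    proof -
      have "inj (L q)" using linear_injective_0[OF linL] Linj[OF qr(1)] by blast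
      then show ?thesis using linear_injective_imp_surjective[OF linL] by (simp add: bij_def)
    qed
    \<comment> \<open>Solving the equation for the invertible \<open>L\<close> is enough:
      \<open>h\<close> is orthogonal to \<open>Im\<phi> q\<close>, so the summand in
      \<open>Im\<phi> q\<close> vanishes, then so does \<open>\<sigma> y1\<close>, and the equation
      for \<open>MM\<close> remains.\<close>
    then obtain y1 where y1: "L q y1 = h" by (metis bij_pointE)
    have "PI q (\<sigma> y1) = h - MM q y1" using y1 by (simp add: L_def algebra_simps)
    then have "PI q (\<sigma> y1) \<in> orthogonal_comp (Im\<phi> q)"
      using h MH[OF qW] subspace_diff[OF subspace_orthogonal_comp] by metis
    moreover have "PI q (\<sigma> y1) \<in> Im\<phi> q" using PIq[OF qW] orth_proj_in[OF subspace_Im\<phi>[OF q]] by simp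
    ultimately have PI0: "PI q (\<sigma> y1) = 0" by (auto simp: orthogonal_comp_iff)
    have "L q (\<sigma> y1) = 0"
      using PI0 onT[OF \<sigma>(2)] \<sigma>(3)[OF \<sigma>(2)] linear_0[OF PD(1)] linear_0[OF PI(1)] by (simp add: L_def MM_def)
    then have \<sigma>1: "\<sigma> y1 = 0" using Linj qr(1) by blast
    have M1: "MM q y1 = h" using y1 PI0 by (simp add: L_def)
    have "k * norm y1 < k * (d / 2)" using k[OF qr(1), of y1] y1 near(2) \<epsilon>(3) by simp
    then have n1: "norm y1 < d / 2" using r(2) by (simp add: mult_less_cancel_left_pos)
    \<comment> \<open>The tangent coordinate at \<open>p\<close> whose lift to the graph is
      \<open>q\<close>.\<close>
    define y0 where "y0 = orth_proj (TS p) (q - p)"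
    have y0: "y0 \<in> TS p" "norm y0 < d / 2"
      using orth_proj_in[OF g.T] norm_orth_proj_le[OF g.T, of "q - p"] near(1) \<epsilon>(2) by (auto simp: y0_def dist_norm)
    have \<sigma>y: "\<sigma> (y0 + y1) = y0" using \<sigma>(3)[OF y0(1)] \<sigma>1 linear_add[OF \<sigma>(1)] by simp
    have "norm (y0 + y1) < d" using n1 y0(2) norm_triangle_ineq[of y0 y1] by simp
    then have yV: "y0 + y1 \<in> V" using d(2) by (auto simp: subset_iff)
    have "orth_proj (TS p) (p + y0) = orth_proj (TS p) q"
      using linear_add[OF linear_orth_proj[OF g.T], of p y0] g.proj_idem g.proj_diff by (simp add: y0_def)
    then have "G (p + y0) = G q" using g.G_cyl[of q "p + y0"] g.U_in q qr(2) by blast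
    then have Qy: "Q (y0 + y1) = q" using g.G_id q qr(2) by (simp add: Q_def \<sigma>y)
    have "MM q y0 = 0" using onT[OF y0(1)] by (simp add: MM_def linear_0[OF PD(1)] linear_0[OF PI(1)])
    have "\<Psi> (y0 + y1) = q + h" using \<open>MM q y0 = 0\<close> Qy M1 linear_add[OF linM] by (simp add: \<Psi>_def)
    moreover have "\<Psi> (y0 + y1) \<in> U" using U(2) yV by blast
    ultimately show ?thesis using U(5)[OF yV] Qy by (simp add: \<alpha>_def)
  qed
  have "p \<in> U" using box[OF p, of 0] \<epsilon>(1) by (simp add: orthogonal_comp_iff)
  moreover have "smooth_on V \<Psi>" using sm\<Psi> V(2) smooth_on_subset by blast
  moreover have "\<alpha> z \<in> S \<and> z - \<alpha> z \<in> orthogonal_comp (Im\<phi> (\<alpha> z))" if "z \<in> U" for z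
    using \<alpha>(1,3)[OF that] MH[OF \<alpha>(1)[OF that]] by simp
  ultimately have "foot_chart p \<epsilon> U V \<alpha> \<kappa> \<Psi>"
    unfolding foot_chart_def using \<epsilon>(1) V(1) U sm\<alpha> slice box by blast
  then show ?thesis by blast
qed

end

section \<open>Existence\<close>

context solvable_cauchy_data
begin

lemma foot_chart_mono: "foot_chart p \<epsilon> U V \<alpha> \<kappa> \<Psi> \<Longrightarrow> 0 < \<epsilon>' \<Longrightarrow> \<epsilon>' \<le> \<epsilon> \<Longrightarrow> foot_chart p \<epsilon>' U V \<alpha> \<kappa> \<Psi>"
  unfolding foot_chart_def by (elim conjE, intro conjI) (auto dest: order_less_le_trans)

lemma foot_chartD:
  assumes "foot_chart p \<epsilon> U V \<alpha> \<kappa> \<Psi>"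
  shows "0 < \<epsilon>" "open U" "p \<in> U" "open V" "smooth_on U \<kappa>" "\<kappa> ` U = V" "smooth_on V \<Psi>" "\<Psi> ` V = U"
    "\<And>z. z \<in> U \<Longrightarrow> \<Psi> (\<kappa> z) = z" "\<And>y. y \<in> V \<Longrightarrow> \<kappa> (\<Psi> y) = y" "smooth_on U \<alpha>"
    "\<And>z. z \<in> U \<Longrightarrow> \<alpha> z \<in> S" "\<And>z. z \<in> U \<Longrightarrow> z - \<alpha> z \<in> orthogonal_comp (Im\<phi> (\<alpha> z))"
    "\<And>z. z \<in> U \<Longrightarrow> z - \<alpha> z \<in> Rul (\<alpha> z) \<longleftrightarrow> \<kappa> z \<in> D p"
    "\<And>q h. q \<in> S \<Longrightarrow> h \<in> orthogonal_comp (Im\<phi> q) \<Longrightarrow> dist q p < \<epsilon> \<Longrightarrow> norm h < \<epsilon> \<Longrightarrow> q + h \<in> U \<and> \<alpha> (q + h) = q"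
  using assms unfolding foot_chart_def by auto

text \<open>Only the radii are chosen globally, since the set \<open>ruled e\<close> depends on
  nothing else; charts can be picked anew at each use.\<close>

definition "foot_radius e \<longleftrightarrow> (\<forall>p\<in>S. \<exists>U V \<alpha> \<kappa> \<Psi>. foot_chart p (e p) U V \<alpha> \<kappa> \<Psi>)"

lemma foot_radius_exists:
  assumes "\<And>p. p \<in> S \<Longrightarrow> 0 < d p"
  obtains e where "foot_radius e" "\<And>p. p \<in> S \<Longrightarrow> e p \<le> d p"
proof -
  have "\<exists>e. e \<le> d p \<and> (\<exists>U V \<alpha> \<kappa> \<Psi>. foot_chart p e U V \<alpha> \<kappa> \<Psi>)" if p: "p \<in> S" for p
  proof -
    obtain \<epsilon> U V \<alpha> \<kappa> \<Psi> where f: "foot_chart p \<epsilon> U V \<alpha> \<kappa> \<Psi>" using foot_chart_exists[OF p] by blast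
    then have "foot_chart p (min \<epsilon> (d p)) U V \<alpha> \<kappa> \<Psi>"
      using assms[OF p] foot_chartD(1)[OF f] by (intro foot_chart_mono[OF f]) auto
    moreover have "min \<epsilon> (d p) \<le> d p" by simp
    ultimately show ?thesis by blast
  qed
  then obtain e where "\<And>p. p \<in> S \<Longrightarrow> e p \<le> d p \<and> (\<exists>U V \<alpha> \<kappa> \<Psi>. foot_chart p (e p) U V \<alpha> \<kappa> \<Psi>)" by metis
  then show ?thesis using that unfolding foot_radius_def by blast
qed

definition "near e p q h \<longleftrightarrow> dist q p < e p / 8 \<and> norm h < e p / 8"

text \<open>Of two overlapping boxes the larger one contains, when enlarged by the factor 8, both base points.\<close>

lemma near_injective_aux:
  assumes e: "foot_radius e" and p: "p \<in> S" "p' \<in> S" and q: "q \<in> S" "q' \<in> S"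
    and h: "h \<in> orthogonal_comp (Im\<phi> q)" "h' \<in> orthogonal_comp (Im\<phi> q')"
    and n: "near e p q h" "near e p' q' h'" and eq: "q + h = q' + h'" and le: "e p' \<le> e p"
  shows "q = q'"
proof -
  obtain U V \<alpha> \<kappa> \<Psi> where f: "foot_chart p (e p) U V \<alpha> \<kappa> \<Psi>" using e p unfolding foot_radius_def by blast
  have pos: "e p > 0" using foot_chartD(1)[OF f] .
  have "\<alpha> (q + h) = q" using foot_chartD(15)[OF f q(1) h(1)] n(1) pos by (simp add: near_def)
  moreover have "\<alpha> (q' + h') = q'"
  proof -
    have "q' - p = (h - h') + (q - p)" using eq by (simp add: algebra_simps)
    then have "dist q' p = norm ((h - h') + (q - p))" by (simp only: dist_norm)
    then have "dist q' p \<le> norm h + norm h' + dist q p"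
      using norm_triangle_ineq[of "h - h'" "q - p"] norm_triangle_ineq4[of h h'] by (simp add: dist_norm)
    \<comment> \<open>Three terms, each below \<open>e p / 8\<close> because
      \<open>e p' \<le> e p\<close>; their sum stays below \<open>e p\<close>.\<close>
    then have "dist q' p < e p" "norm h' < e p" using n le pos by (auto simp: near_def)
    then show ?thesis using foot_chartD(15)[OF f q(2) h(2)] by simp
  qed
  ultimately show ?thesis using eq by simp
qed

lemma near_injective:
  assumes "foot_radius e" "p \<in> S" "p' \<in> S" "q \<in> S" "q' \<in> S"
    and "h \<in> orthogonal_comp (Im\<phi> q)" "h' \<in> orthogonal_comp (Im\<phi> q')"
    and "near e p q h" "near e p' q' h'" "q + h = q' + h'"
  shows "q = q'"
  using near_injective_aux[of e p p' q q' h h'] near_injective_aux[of e p' p q' q h' h] assms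
  by (metis linear)

lemma Rul_perp: "x \<in> Rul q \<Longrightarrow> x \<in> orthogonal_comp (Im\<phi> q)"
  by (simp add: Rul_def)

text \<open>The centre \<open>p\<close> of the box may differ from the foot point \<open>q\<close>:
  \<open>e\<close> need not be continuous, and with \<open>p\<close> held fixed the condition
  \<open>near\<close> is open.\<close>

definition "ruled e = {q + x |q x. q \<in> S \<and> x \<in> Rul q \<and> (\<exists>p\<in>S. near e p q x)}"

definition "ruled_nbhd e p U \<alpha> = {w \<in> U. near e p (\<alpha> w) (w - \<alpha> w)}"

text \<open>By \<open>near_injective\<close>, a representation \<open>q + x\<close> coming from any
  other box has the same foot point, so that membership becomes locally a condition on
  \<open>\<alpha>\<close> alone.\<close>

lemma ruled_local:
  assumes e: "foot_radius e" and p: "p \<in> S" and f: "foot_chart p (e p) U V \<alpha> \<kappa> \<Psi>"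
  shows "open (ruled_nbhd e p U \<alpha>)"
    and "ruled e \<inter> ruled_nbhd e p U \<alpha> = {w \<in> ruled_nbhd e p U \<alpha>. w - \<alpha> w \<in> Rul (\<alpha> w)}"
proof -
  have c: "continuous_on U \<alpha>" using smooth_on_continuous_on foot_chartD(11)[OF f] .
  have "ruled_nbhd e p U \<alpha> = (U \<inter> (\<lambda>w. dist (\<alpha> w) p) -` {..<e p / 8}) \<inter> (U \<inter> (\<lambda>w. norm (w - \<alpha> w)) -` {..<e p / 8})"
    by (auto simp: ruled_nbhd_def near_def)
  moreover have "open (U \<inter> (\<lambda>w. dist (\<alpha> w) p) -` {..<e p / 8})"
    using c by (intro continuous_open_preimage foot_chartD(2)[OF f] continuous_intros) auto
  moreover have "open (U \<inter> (\<lambda>w. norm (w - \<alpha> w)) -` {..<e p / 8})"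
    using c by (intro continuous_open_preimage foot_chartD(2)[OF f] continuous_intros) auto
  ultimately show "open (ruled_nbhd e p U \<alpha>)" by auto
  show "ruled e \<inter> ruled_nbhd e p U \<alpha> = {w \<in> ruled_nbhd e p U \<alpha>. w - \<alpha> w \<in> Rul (\<alpha> w)}"
  proof (intro equalityI subsetI)
    fix w assume "w \<in> ruled e \<inter> ruled_nbhd e p U \<alpha>"
    then obtain q x p' where w: "w \<in> ruled_nbhd e p U \<alpha>" "w = q + x" "q \<in> S" "x \<in> Rul q" "p' \<in> S" "near e p' q x"
      by (auto simp: ruled_def)
    then have wU: "w \<in> U" "near e p (\<alpha> w) (w - \<alpha> w)" by (auto simp: ruled_nbhd_def)
    have "q = \<alpha> w"
      using near_injective[OF e w(5) p w(3) foot_chartD(12)[OF f wU(1)] Rul_perp[OF w(4)] foot_chartD(13)[OF f wU(1)] w(6) wU(2)]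
        w(2) by simp
    moreover have "x = w - q" using w(2) by simp
    ultimately have "w - \<alpha> w \<in> Rul (\<alpha> w)" using w(4) by blast
    then show "w \<in> {w \<in> ruled_nbhd e p U \<alpha>. w - \<alpha> w \<in> Rul (\<alpha> w)}" using w(1) by blast
  next
    fix w assume w: "w \<in> {w \<in> ruled_nbhd e p U \<alpha>. w - \<alpha> w \<in> Rul (\<alpha> w)}"
    then have "w \<in> U" "near e p (\<alpha> w) (w - \<alpha> w)" by (auto simp: ruled_nbhd_def)
    moreover have "w = \<alpha> w + (w - \<alpha> w)" by simp
    ultimately have "w \<in> ruled e" unfolding ruled_def using w p foot_chartD(12)[OF f] by blast
    then show "w \<in> ruled e \<inter> ruled_nbhd e p U \<alpha>" using w by blast
  qed
qed

lemma ruled_point: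
  assumes e: "foot_radius e" and z: "z \<in> ruled e"
  obtains p U V \<alpha> \<kappa> \<Psi> where "p \<in> S" "foot_chart p (e p) U V \<alpha> \<kappa> \<Psi>" "z \<in> ruled_nbhd e p U \<alpha>"
    "z - \<alpha> z \<in> Rul (\<alpha> z)" "\<alpha> z \<in> S"
proof -
  obtain q x p where q: "z = q + x" "q \<in> S" "x \<in> Rul q" "p \<in> S" "near e p q x" using z by (auto simp: ruled_def)
  obtain U V \<alpha> \<kappa> \<Psi> where f: "foot_chart p (e p) U V \<alpha> \<kappa> \<Psi>" using e q(4) unfolding foot_radius_def by blast
  have "z \<in> U" "\<alpha> z = q"
    using foot_chartD(15)[OF f q(2) Rul_perp[OF q(3)]] foot_chartD(1)[OF f] q(1,5) by (auto simp: near_def)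
  then show ?thesis using that[OF q(4) f] q by (simp add: ruled_nbhd_def)
qed

text \<open>\<open>\<kappa>\<close> restricted to \<open>ruled_nbhd\<close> is the slice chart, with
  \<open>D p\<close> as the linear model.\<close>

lemma embedded_ruled:
  assumes e: "foot_radius e"
  shows "embedded_submanifold m (ruled e)"
  unfolding embedded_submanifold_def
proof
  fix z assume "z \<in> ruled e"
  then obtain p U V \<alpha> \<kappa> \<Psi> where p: "p \<in> S" and f: "foot_chart p (e p) U V \<alpha> \<kappa> \<Psi>" and z: "z \<in> ruled_nbhd e p U \<alpha>"
    using ruled_point[OF e] by metis
  note F = foot_chartD[OF f]
  let ?U = "ruled_nbhd e p U \<alpha>"
  note loc = ruled_local[OF e p f]
  have sub: "?U \<subseteq> U" by (auto simp: ruled_nbhd_def)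
  have img: "\<kappa> ` ?U = V \<inter> \<Psi> -` ?U"
  proof (intro equalityI subsetI)
    fix y assume "y \<in> \<kappa> ` ?U"
    then show "y \<in> V \<inter> \<Psi> -` ?U" using sub F(6,9) by auto
  next
    fix y assume "y \<in> V \<inter> \<Psi> -` ?U"
    then show "y \<in> \<kappa> ` ?U" using F(10) by (metis IntD1 IntD2 image_eqI vimageD)
  qed
  have "open (V \<inter> \<Psi> -` ?U)"
    by (rule continuous_open_preimage[OF smooth_on_continuous_on[OF F(7)] F(4) loc(1)])
  then have oV: "open (\<kappa> ` ?U)" by (simp add: img)
  have "diffeomorphism_between ?U (\<kappa> ` ?U) \<kappa>"
    unfolding diffeomorphism_between_def
    using smooth_on_subset[OF sub F(5)] smooth_on_subset[OF _ F(7), of "\<kappa> ` ?U"] img F(9) sub by blast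
  moreover have "\<kappa> ` (ruled e \<inter> ?U) = \<kappa> ` ?U \<inter> D p"
    unfolding loc(2) using sub F(14) by (auto simp: subset_iff)
  ultimately show "\<exists>U V (f :: 'a \<Rightarrow> 'a) L. open U \<and> z \<in> U \<and> open V \<and> diffeomorphism_between U V f \<and>
      subspace L \<and> dim L = m \<and> f ` (ruled e \<inter> U) = V \<inter> L"
    using loc(1) z oV subspace_D[OF p] dim_D[OF p] by blast
qed

text \<open>Differentiating \<open>\<langle>Z (\<alpha> w), w - \<alpha> w\<rangle> = 0\<close> along the ruled submanifold.\<close>

lemma ruled_skew:
  assumes e: "foot_radius e" and p: "p \<in> S" and f: "foot_chart p (e p) U V \<alpha> \<kappa> \<Psi>"
    and z: "z \<in> ruled e \<inter> ruled_nbhd e p U \<alpha>" and w: "w \<in> tangent_space (ruled e) z"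
    and Z: "open W" "\<alpha> z \<in> W" "smooth_on W Z" "\<And>q x. q \<in> S \<inter> W \<Longrightarrow> x \<in> Rul q \<Longrightarrow> Z q \<bullet> x = 0"
  defines "v \<equiv> frechet_derivative \<alpha> (at z) w"
  shows "frechet_derivative Z (at (\<alpha> z)) v \<bullet> (z - \<alpha> z) + Z (\<alpha> z) \<bullet> (w - v) = 0"
proof -
  note F = foot_chartD[OF f] and loc = ruled_local[OF e p f]
  let ?U = "ruled_nbhd e p U \<alpha>"
  have zU: "z \<in> U" using z by (auto simp: ruled_nbhd_def)
  obtain \<gamma> where \<gamma>: "smooth_curve_in (ruled e) z w \<gamma>" using w by (auto simp: tangent_space_def)
  note c = smooth_curve_inD[OF \<gamma>]
  have d\<alpha>: "((\<lambda>t. \<alpha> (\<gamma> t)) has_vector_derivative v) (at 0)"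
    unfolding v_def
    using has_vector_derivative_compose_smooth[OF c(2)] smooth_on_has_derivative[OF F(11) zU] c(1) by simp
  have dZ: "((\<lambda>t. Z (\<alpha> (\<gamma> t))) has_vector_derivative frechet_derivative Z (at (\<alpha> z)) v) (at 0)"
    using has_vector_derivative_compose_smooth[OF d\<alpha>] smooth_on_has_derivative[OF Z(3,2)] c(1) by simp
  have "((\<lambda>t. Z (\<alpha> (\<gamma> t)) \<bullet> (\<gamma> t - \<alpha> (\<gamma> t))) has_vector_derivative
     Z (\<alpha> (\<gamma> 0)) \<bullet> (w - v) + frechet_derivative Z (at (\<alpha> z)) v \<bullet> (\<gamma> 0 - \<alpha> (\<gamma> 0))) (at 0)"
    by (rule bounded_bilinear.has_vector_derivative[OF bounded_bilinear_inner dZ has_vector_derivative_diff[OF c(2) d\<alpha>]])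
  moreover have "eventually (\<lambda>t. Z (\<alpha> (\<gamma> t)) \<bullet> (\<gamma> t - \<alpha> (\<gamma> t)) = 0) (nhds 0)"
  proof -
    have "open (U \<inter> \<alpha> -` W)" by (rule continuous_open_preimage[OF smooth_on_continuous_on[OF F(11)] F(2) Z(1)])
    then have "open (?U \<inter> (U \<inter> \<alpha> -` W))" using loc(1) by blast
    moreover have "z \<in> ?U \<inter> (U \<inter> \<alpha> -` W)" using z zU Z(2) by blast
    ultimately have "eventually (\<lambda>t. \<gamma> t \<in> ruled e \<inter> (?U \<inter> (U \<inter> \<alpha> -` W))) (nhds 0)"
      by (rule smooth_curve_in_eventually[OF \<gamma>])
    then show ?thesis
    proof (rule eventually_mono)
      fix t assume t: "\<gamma> t \<in> ruled e \<inter> (?U \<inter> (U \<inter> \<alpha> -` W))"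
      then have "\<gamma> t - \<alpha> (\<gamma> t) \<in> Rul (\<alpha> (\<gamma> t))" using loc(2) by blast
      then show "Z (\<alpha> (\<gamma> t)) \<bullet> (\<gamma> t - \<alpha> (\<gamma> t)) = 0" using Z(4) F(12) t by blast
    qed
  qed
  ultimately have "Z (\<alpha> (\<gamma> 0)) \<bullet> (w - v) + frechet_derivative Z (at (\<alpha> z)) v \<bullet> (\<gamma> 0 - \<alpha> (\<gamma> 0)) = 0"
    by (rule vector_derivative_eventually_eq[OF _ has_vector_derivative_const])
  then show ?thesis using c(1) by simp
qed

section \<open>Tangent spaces and nullity of the ruled set\<close>

lemma foot_derivative_tangent:
  assumes f: "foot_chart p \<epsilon> U V \<alpha> \<kappa> \<Psi>" and z: "z \<in> U" and w: "w \<in> tangent_space M z"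
  shows "frechet_derivative \<alpha> (at z) w \<in> TS (\<alpha> z)"
  by (rule tangent_space_image[OF w foot_chartD(2)[OF f] z foot_chartD(11)[OF f]])
    (use foot_chartD(12)[OF f] in blast)

lemma phi_inner_extension:
  assumes q: "q \<in> S" and W: "open W" "q \<in> W" and Y: "smooth_on W Y"
    "\<And>q'. q' \<in> S \<inter> W \<Longrightarrow> Y q' \<in> normal_distribution D q'" and v: "v \<in> TS q" and y: "y \<in> D q"
  shows "frechet_derivative Y (at q) v \<bullet> y = \<phi> q v (Y q) \<bullet> y"
  using phi_smooth_section[OF q W Y v] orth_proj_inner[OF subspace_D[OF q] y] by simp

text \<open>For a normal field, the derivative term of \<open>ruled_skew\<close> is
  \<open>\<phi> ?q ?v n \<bullet> (z - ?q)\<close>, which vanishes because rulings are orthogonal to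
  \<open>Im\<phi>\<close>. So tangent vectors are orthogonal to all normals of \<open>D\<close>, and
  the dimensions agree.\<close>

lemma tangent_ruled:
  assumes e: "foot_radius e" and p: "p \<in> S" and f: "foot_chart p (e p) U V \<alpha> \<kappa> \<Psi>"
    and z: "z \<in> ruled e \<inter> ruled_nbhd e p U \<alpha>"
  shows "tangent_space (ruled e) z = D (\<alpha> z)"
proof -
  let ?q = "\<alpha> z"
  have zU: "z \<in> U" using z by (auto simp: ruled_nbhd_def)
  have q: "?q \<in> S" using foot_chartD(12)[OF f zU] .
  have x: "z - ?q \<in> Rul ?q" using z ruled_local(2)[OF e p f] by blast
  have zR: "z \<in> ruled e" using z by blast
  obtain \<Omega> U0 G where "smooth_graph (ruled e) (tangent_space (ruled e) z) \<Omega> U0 G" and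
    d: "dim (tangent_space (ruled e) z) = m"
    using embedded_submanifold_tangent_graph[OF embedded_ruled[OF e] zR] by metis
  then have sT: "subspace (tangent_space (ruled e) z)" using smooth_graph.T by blast
  have "tangent_space (ruled e) z \<subseteq> D ?q"
  proof
    fix w assume w: "w \<in> tangent_space (ruled e) z"
    let ?v = "frechet_derivative \<alpha> (at z) w"
    have v: "?v \<in> TS ?q" by (rule foot_derivative_tangent[OF f zU w])
    have "w \<bullet> n = 0" if n: "n \<in> normal_distribution D ?q" for n
    proof -
      obtain W Y where W: "open W" "?q \<in> W" and Y: "smooth_on W Y" "\<And>q'. q' \<in> S \<inter> W \<Longrightarrow> Y q' \<in> normal_distribution D q'" "Y ?q = n"
        using normal_extension[OF q n] by blast
      have "frechet_derivative Y (at ?q) ?v \<bullet> (z - ?q) + Y ?q \<bullet> (w - ?v) = 0"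
        by (rule ruled_skew[OF e p f z w W Y(1)]) (use Y(2) in \<open>auto simp: normal_iff Rul_def\<close>)
      moreover have "frechet_derivative Y (at ?q) ?v \<bullet> (z - ?q) = \<phi> ?q ?v n \<bullet> (z - ?q)"
        using phi_inner_extension[OF q W Y(1,2) v] x Y(3) by (simp add: Rul_def)
      moreover have "\<phi> ?q ?v n \<in> Im\<phi> ?q" unfolding phi_image_def using v n by blast
      then have "\<phi> ?q ?v n \<bullet> (z - ?q) = 0" using x by (auto simp: Rul_def orthogonal_comp_iff inner_commute)
      moreover have "n \<bullet> ?v = 0" using n v tangent_D[OF q] by (auto simp: normal_iff)
      ultimately show ?thesis using Y(3) by (simp add: inner_diff_right inner_commute)
    qed
    then have "w \<in> orthogonal_comp (orthogonal_comp (D ?q))"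
      by (simp add: orthogonal_comp_iff[of w] normal_distribution_def)
    then show "w \<in> D ?q" by (simp add: orthogonal_comp_orthogonal_comp[OF subspace_D[OF q]])
  qed
  then show ?thesis using subspace_dim_equal[OF sT subspace_D[OF q]] d dim_D[OF q] by simp
qed

text \<open>Along a ruling the foot point does not move. Conversely, if it is stationary to first
  order, \<open>ruled_skew\<close> for the field \<open>P q k\<close> with \<open>k\<close> in
  \<open>Im\<phi>\<close> reduces to \<open>k \<bullet> w = 0\<close>.\<close>

lemma foot_derivative_eq_0_iff:
  assumes e: "foot_radius e" and p: "p \<in> S" and f: "foot_chart p (e p) U V \<alpha> \<kappa> \<Psi>"
    and z: "z \<in> ruled e \<inter> ruled_nbhd e p U \<alpha>"
  shows "w \<in> D (\<alpha> z) \<and> frechet_derivative \<alpha> (at z) w = 0 \<longleftrightarrow> w \<in> Rul (\<alpha> z)"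
proof -
  let ?q = "\<alpha> z"
  note F = foot_chartD[OF f]
  have zU: "z \<in> U" and zn: "near e p ?q (z - ?q)" using z by (auto simp: ruled_nbhd_def)
  have q: "?q \<in> S" using F(12)[OF zU] .
  have x: "z - ?q \<in> Rul ?q" using z ruled_local(2)[OF e p f] by blast
  show ?thesis
  proof (intro iffI conjI)
    assume w: "w \<in> Rul ?q"
    then show "w \<in> D ?q" by (simp add: Rul_def)
    have "((\<lambda>t. \<alpha> (z + t *\<^sub>R w)) has_vector_derivative frechet_derivative \<alpha> (at z) w) (at 0)"
      using has_derivative_along_line[of \<alpha> _ z 0 w] smooth_on_has_derivative[OF F(11) zU] by simp
    moreover have "eventually (\<lambda>t. \<alpha> (z + t *\<^sub>R w) = ?q) (nhds 0)"
    proof -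
      have "open ((\<lambda>t. norm (z - ?q + t *\<^sub>R w)) -` {..<e p})" by (intro open_vimage continuous_intros)
      moreover have "0 \<in> (\<lambda>t. norm (z - ?q + t *\<^sub>R w)) -` {..<e p}" using zn F(1) by (simp add: near_def)
      moreover have "\<alpha> (z + t *\<^sub>R w) = ?q" if "t \<in> (\<lambda>t. norm (z - ?q + t *\<^sub>R w)) -` {..<e p}" for t
      proof -
        have "z - ?q + t *\<^sub>R w \<in> Rul ?q"
          using x w subspace_add[OF subspace_Rul[OF q]] subspace_scale[OF subspace_Rul[OF q]] by blast
        moreover have "dist ?q p < e p" using zn F(1) by (simp add: near_def)
        ultimately have "\<alpha> (?q + (z - ?q + t *\<^sub>R w)) = ?q"
          using F(15)[OF q Rul_perp] that by blast
        moreover have "?q + (z - ?q + t *\<^sub>R w) = z + t *\<^sub>R w" by simp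
        ultimately show ?thesis by metis
      qed
      ultimately show ?thesis unfolding eventually_nhds by blast
    qed
    ultimately show "frechet_derivative \<alpha> (at z) w = 0"
      by (rule vector_derivative_eventually_eq[OF _ has_vector_derivative_const])
  next
    assume w: "w \<in> D ?q \<and> frechet_derivative \<alpha> (at z) w = 0"
    then have wT: "w \<in> tangent_space (ruled e) z" using tangent_ruled[OF e p f z] by simp
    obtain W P where W: "open W" "?q \<in> W"
      and P: "\<And>Y V. open V \<Longrightarrow> V \<subseteq> W \<Longrightarrow> smooth_on V Y \<Longrightarrow> smooth_on V (\<lambda>q. P q (Y q))"
      "\<And>q. q \<in> S \<inter> W \<Longrightarrow> P q = orth_proj (Im\<phi> q)"
      using projection_Im\<phi>[OF q] by metis
    have "w \<bullet> k = 0" if k: "k \<in> Im\<phi> ?q" for k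
    proof -
      let ?Z = "\<lambda>q. P q k"
      have sZ: "smooth_on W ?Z" by (rule P(1)[OF W(1) subset_refl smooth_on_const[OF W(1)]])
      have "frechet_derivative ?Z (at ?q) (frechet_derivative \<alpha> (at z) w) \<bullet> (z - ?q) +
          ?Z ?q \<bullet> (w - frechet_derivative \<alpha> (at z) w) = 0"
      proof (rule ruled_skew[OF e p f z wT W sZ])
        fix q' x' assume "q' \<in> S \<inter> W" "x' \<in> Rul q'"
        then show "P q' k \<bullet> x' = 0"
          using P(2) orth_proj_in[OF subspace_Im\<phi>, of q' k] by (auto simp: Rul_def orthogonal_comp_iff inner_commute)
      qed
      moreover have "?Z ?q = k" using P(2)[of ?q] q W orth_proj_id[OF subspace_Im\<phi>[OF q] k] by simp
      ultimately show ?thesis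
        using w linear_0[OF smooth_on_linear_derivative[OF sZ W(2)]] by (simp add: inner_commute)
    qed
    then show "w \<in> Rul ?q" using w by (simp add: Rul_def orthogonal_comp_iff)
  qed
qed

text \<open>The tangent spaces are those of \<open>D\<close> at the foot point, so the Hessian
  paired with a normal \<open>n\<close> is minus \<open>\<phi>\<close> of the velocity of the foot
  point. Nonsingularity in direction \<open>N\<close> reduces the nullity to the kernel of the foot
  derivative.\<close>

lemma relative_nullity_ruled:
  assumes e: "foot_radius e" and p: "p \<in> S" and f: "foot_chart p (e p) U V \<alpha> \<kappa> \<Psi>"
    and z: "z \<in> ruled e \<inter> ruled_nbhd e p U \<alpha>"
  shows "relative_nullity (ruled e) z = Rul (\<alpha> z)"
proof -
  let ?q = "\<alpha> z" and ?M = "ruled e"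
  note F = foot_chartD[OF f] and loc = ruled_local[OF e p f]
  have zU: "z \<in> U" using z by (auto simp: ruled_nbhd_def)
  have q: "?q \<in> S" using F(12)[OF zU] .
  have zR: "z \<in> ?M" using z by blast
  have T: "tangent_space ?M z = D ?q" by (rule tangent_ruled[OF e p f z])
  obtain \<Omega> U0 G where "smooth_graph ?M (tangent_space ?M z) \<Omega> U0 G" and z0: "z \<in> U0"
    using embedded_submanifold_tangent_graph[OF embedded_ruled[OF e] zR] by metis
  then interpret g: smooth_graph ?M "D ?q" \<Omega> U0 G using T by simp
  have zg: "z \<in> ?M \<inter> U0" using zR z0 by blast
  have z\<Omega>: "z \<in> \<Omega>" using g.U_in[OF zg] .
  have inner: "g.H z w y \<bullet> n = - (\<phi> ?q (frechet_derivative \<alpha> (at z) w) n \<bullet> y)"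
    if w: "w \<in> D ?q" and y: "y \<in> D ?q" and n: "n \<in> normal_distribution D ?q" for w y n
  proof -
    let ?v = "frechet_derivative \<alpha> (at z) w"
    have wT: "w \<in> tangent_space ?M z" using w T by simp
    have v: "?v \<in> TS ?q" by (rule foot_derivative_tangent[OF f zU wT])
    obtain W Y where W: "open W" "?q \<in> W" and Y: "smooth_on W Y" "\<And>q'. q' \<in> S \<inter> W \<Longrightarrow> Y q' \<in> normal_distribution D q'" "Y ?q = n"
      using normal_extension[OF q n] by blast
    obtain \<gamma> where \<gamma>: "smooth_curve_in ?M z w \<gamma>" using wT by (auto simp: tangent_space_def)
    note c = smooth_curve_inD[OF \<gamma>]
    have d\<alpha>: "((\<lambda>t. \<alpha> (\<gamma> t)) has_vector_derivative ?v) (at 0)"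
      using has_vector_derivative_compose_smooth[OF c(2)] smooth_on_has_derivative[OF F(11) zU] c(1) by simp
    have dY: "((\<lambda>t. Y (\<alpha> (\<gamma> t))) has_vector_derivative frechet_derivative Y (at ?q) ?v) (at 0)"
      using has_vector_derivative_compose_smooth[OF d\<alpha>] smooth_on_has_derivative[OF Y(1) W(2)] c(1) by simp
    have dG: "((\<lambda>t. g.DG (\<gamma> t) y) has_vector_derivative g.H z w y) (at 0)"
      using has_vector_derivative_compose_smooth[OF c(2), of "\<lambda>z. g.DG z y"] g.H_has_derivative[OF z\<Omega>, of y] c(1) by blast
    have "((\<lambda>t. Y (\<alpha> (\<gamma> t)) \<bullet> g.DG (\<gamma> t) y) has_vector_derivative
        Y (\<alpha> (\<gamma> 0)) \<bullet> g.H z w y + frechet_derivative Y (at ?q) ?v \<bullet> g.DG (\<gamma> 0) y) (at 0)"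
      by (rule bounded_bilinear.has_vector_derivative[OF bounded_bilinear_inner dY dG])
    moreover have "eventually (\<lambda>t. Y (\<alpha> (\<gamma> t)) \<bullet> g.DG (\<gamma> t) y = 0) (nhds 0)"
    proof -
      let ?U = "ruled_nbhd e p U \<alpha> \<inter> (U \<inter> \<alpha> -` W) \<inter> U0"
      have "open (U \<inter> \<alpha> -` W)" by (rule continuous_open_preimage[OF smooth_on_continuous_on[OF F(11)] F(2) W(1)])
      then have "open ?U" using loc(1) g.open_U by blast
      moreover have "z \<in> ?U" using z zU W(2) z0 by blast
      ultimately have "eventually (\<lambda>t. \<gamma> t \<in> ?M \<inter> ?U) (nhds 0)" by (rule smooth_curve_in_eventually[OF \<gamma>])
      then show ?thesis
      proof (rule eventually_mono)
        fix t assume t: "\<gamma> t \<in> ?M \<inter> ?U"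
        have "g.DG (\<gamma> t) y \<in> tangent_space ?M (\<gamma> t)" using g.DG_tangent t by blast
        then have "g.DG (\<gamma> t) y \<in> D (\<alpha> (\<gamma> t))" using tangent_ruled[OF e p f, of "\<gamma> t"] t by blast
        moreover have "Y (\<alpha> (\<gamma> t)) \<in> normal_distribution D (\<alpha> (\<gamma> t))" using Y(2) F(12) t by blast
        ultimately show "Y (\<alpha> (\<gamma> t)) \<bullet> g.DG (\<gamma> t) y = 0" by (simp add: normal_iff)
      qed
    qed
    ultimately have "Y (\<alpha> (\<gamma> 0)) \<bullet> g.H z w y + frechet_derivative Y (at ?q) ?v \<bullet> g.DG (\<gamma> 0) y = 0"
      by (rule vector_derivative_eventually_eq[OF _ has_vector_derivative_const])
    then have "n \<bullet> g.H z w y + frechet_derivative Y (at ?q) ?v \<bullet> y = 0"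
      using c(1) Y(3) g.tangent_iff[OF zg] y T by simp
    then show ?thesis using phi_inner_extension[OF q W Y(1,2) v y] Y(3) by (simp add: inner_commute)
  qed
  have "w \<in> relative_nullity ?M z \<longleftrightarrow> w \<in> D ?q \<and> frechet_derivative \<alpha> (at z) w = 0" for w
  proof (cases "w \<in> D ?q")
    case True
    let ?v = "frechet_derivative \<alpha> (at z) w"
    have wT: "w \<in> tangent_space ?M z" using True T by simp
    have v: "?v \<in> TS ?q" by (rule foot_derivative_tangent[OF f zU wT])
    show ?thesis
    proof
      assume "w \<in> relative_nullity ?M z"
      then have H0: "g.H z w y = 0" for y using g.Null_iff[OF zg] by blast
      \<comment> \<open>The test vector \<open>y\<close> is taken to be
        \<open>\<phi> ?q ?v (N ?q)\<close> itself.\<close>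
      have "\<phi> ?q ?v (N ?q) \<in> D ?q" using phi_in_D[OF q v N_normal[OF q]] .
      then have "\<phi> ?q ?v (N ?q) \<bullet> \<phi> ?q ?v (N ?q) = 0" using inner[OF True _ N_normal[OF q]] H0 by fastforce
      then show "w \<in> D ?q \<and> ?v = 0" using phi_N_eq_0_iff[OF q v] True by simp
    next
      assume w: "w \<in> D ?q \<and> ?v = 0"
      have "g.H z w y = 0" if y: "y \<in> D ?q" for y
      proof -
        have "second_fundamental_form ?M z w y \<bullet> n = 0" for n
        proof -
          let ?T = "tangent_space ?M z"
          have eq: "second_fundamental_form ?M z w y = orth_proj (orthogonal_comp ?T) (g.H z w y)"
            by (rule g.second_fundamental_form_eq[OF zg wT]) (use y T in simp)
          have sT: "subspace ?T" using T subspace_D[OF q] by simp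
          have "orth_proj (orthogonal_comp ?T) (g.H z w y) \<bullet> n =
              orth_proj (orthogonal_comp ?T) (g.H z w y) \<bullet> orth_proj (orthogonal_comp ?T) n"
            using orth_proj_inner[OF subspace_orthogonal_comp orth_proj_in[OF subspace_orthogonal_comp, of ?T "g.H z w y"], of n]
            by (simp add: inner_commute)
          also have "\<dots> = g.H z w y \<bullet> orth_proj (orthogonal_comp ?T) n"
            by (rule orth_proj_inner[OF subspace_orthogonal_comp orth_proj_in[OF subspace_orthogonal_comp]])
          also have "\<dots> = - (\<phi> ?q ?v (orth_proj (orthogonal_comp ?T) n) \<bullet> y)"
            using orth_proj_in[OF subspace_orthogonal_comp, of ?T n] T
            by (intro inner[OF True y]) (simp add: normal_distribution_def)
          also have "\<dots> = 0"
            using w phi_0[OF q, of "orth_proj (orthogonal_comp ?T) n"] orth_proj_in[OF subspace_orthogonal_comp, of ?T n] T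
            by (simp add: normal_distribution_def)
          finally show ?thesis using eq by simp
        qed
        then have "second_fundamental_form ?M z w y = 0" by (metis inner_eq_zero_iff)
        then show ?thesis using g.second_fundamental_form_eq_0_iff[OF zg wT] y T by simp
      qed
      then have "\<forall>y\<in>tangent_space ?M z. second_fundamental_form ?M z w y = 0"
        using g.second_fundamental_form_eq_0_iff[OF zg wT] T by simp
      then show "w \<in> relative_nullity ?M z" using wT by (simp add: relative_nullity_def)
    qed
  qed (auto simp: relative_nullity_def T)
  then show ?thesis using foot_derivative_eq_0_iff[OF e p f z] by blast
qed

lemma cauchy_solution_ruled:
  assumes e: "foot_radius e"
  shows "cauchy_solution m s S D (ruled e)"
proof -
  have S: "p \<in> ruled e" "tangent_space (ruled e) p = D p" if p: "p \<in> S" for p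
  proof -
    obtain U V \<alpha> \<kappa> \<Psi> where f: "foot_chart p (e p) U V \<alpha> \<kappa> \<Psi>" using e p unfolding foot_radius_def by blast
    have n: "near e p p 0" using foot_chartD(1)[OF f] by (simp add: near_def)
    have R: "0 \<in> Rul p" using subspace_Rul[OF p] subspace_0 by blast
    show pr: "p \<in> ruled e" unfolding ruled_def using p n R by force
    have \<alpha>: "p \<in> U" "\<alpha> p = p"
      using foot_chartD(15)[OF f p Rul_perp[OF R]] foot_chartD(1)[OF f] by auto
    then have "p \<in> ruled e \<inter> ruled_nbhd e p U \<alpha>" using pr n by (simp add: ruled_nbhd_def)
    then show "tangent_space (ruled e) p = D p" using tangent_ruled[OF e p f] \<alpha> by metis
  qed
  have "relative_nullity_index (ruled e) z = m - s" if z: "z \<in> ruled e" for z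
  proof -
    obtain p U V \<alpha> \<kappa> \<Psi> where p: "p \<in> S" and f: "foot_chart p (e p) U V \<alpha> \<kappa> \<Psi>" and "z \<in> ruled_nbhd e p U \<alpha>" "\<alpha> z \<in> S"
      using ruled_point[OF e z] by metis
    then show ?thesis
      using relative_nullity_ruled[OF e p f, of z] z dim_Rul[of "\<alpha> z"] by (simp add: relative_nullity_index_eq)
  qed
  then show ?thesis
    unfolding cauchy_solution_def rank_submanifold_def using S embedded_ruled[OF e] by blast
qed

end

section \<open>Necessity and uniqueness\<close>

text \<open>In a graph chart, projection to the tangent space turns \<open>f\<close> into a
  continuous injection between spaces of the same dimension, where invariance of domain applies. No
  derivative of \<open>f\<close> enters.\<close>

lemma open_image_in_submanifold:
  fixes f :: "'b::euclidean_space \<Rightarrow> 'a::euclidean_space"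
  assumes M: "embedded_submanifold k M" and L: "subspace L" "dim L = k"
    and A: "openin (top_of_set L) A" and f: "continuous_on A f" "f ` A \<subseteq> M" "inj_on f A"
  shows "openin (top_of_set M) (f ` A)"
proof (subst openin_subopen, intro ballI)
  fix q assume "q \<in> f ` A"
  then obtain a where a: "a \<in> A" "q = f a" by blast
  then have qM: "q \<in> M" using f(2) by blast
  obtain \<Omega> U G where "smooth_graph M (tangent_space M q) \<Omega> U G" and qU: "q \<in> U" and dimT: "dim (tangent_space M q) = k"
    using embedded_submanifold_tangent_graph[OF M qM] by metis
  then interpret g: smooth_graph M "tangent_space M q" \<Omega> U G by blast
  let ?T = "tangent_space M q" and ?P = "orth_proj (tangent_space M q)"
  define B where "B = A \<inter> f -` U"
  have B: "openin (top_of_set A) B" unfolding B_def by (rule continuous_openin_preimage_gen[OF f(1) g.open_U])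
  then have BL: "openin (top_of_set L) B" using A openin_trans by blast
  have fB: "f b \<in> M \<inter> U" if "b \<in> B" for b using that f(2) by (auto simp: B_def)
  have cP: "continuous_on X ?P" for X using g.bl_proj linear_continuous_on by blast
  have fBc: "continuous_on B f" using f(1) continuous_on_subset by (metis B_def inf_le1)
  have "openin (top_of_set ?T) ((\<lambda>b. ?P (f b)) ` B)"
  proof (rule invariance_of_domain_subspaces[OF BL L(1) g.T])
    show "dim ?T \<le> dim L" using dimT L by simp
    show "continuous_on B (\<lambda>b. ?P (f b))" by (rule continuous_on_compose2[OF cP fBc subset_refl])
    show "(\<lambda>b. ?P (f b)) \<in> B \<rightarrow> ?T" using orth_proj_in[OF g.T] by blast
    show "inj_on (\<lambda>b. ?P (f b)) B"
    proof (rule inj_onI)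
      fix x y assume xy: "x \<in> B" "y \<in> B" "?P (f x) = ?P (f y)"
      then have "G (f x) = G (f y)" using g.G_cyl[OF g.U_in[OF fB[OF xy(1)]], of "f y"] by simp
      then have "f x = f y" using g.G_id fB xy by simp
      then show "x = y" using f(3) xy by (auto simp: B_def inj_on_def)
    qed
  qed
  then obtain X where X: "open X" "(\<lambda>b. ?P (f b)) ` B = ?T \<inter> X" by (auto simp: openin_open)
  have "open (U \<inter> ?P -` X)" by (rule continuous_open_preimage[OF cP g.open_U X(1)])
  moreover have "f ` B = M \<inter> (U \<inter> ?P -` X)"
  proof (intro equalityI subsetI)
    fix y assume "y \<in> f ` B"
    then show "y \<in> M \<inter> (U \<inter> ?P -` X)" using fB X(2) by auto
  next
    fix y assume y: "y \<in> M \<inter> (U \<inter> ?P -` X)"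
    then have "?P y \<in> (\<lambda>b. ?P (f b)) ` B" using X(2) orth_proj_in[OF g.T] by blast
    then obtain b where b: "b \<in> B" "?P y = ?P (f b)" by blast
    have "G y = G (f b)" using g.G_cyl[OF g.U_in[OF fB[OF b(1)]], of y] b(2) by simp
    then have "y = f b" using g.G_id y fB[OF b(1)] by auto
    then show "y \<in> f ` B" using b by blast
  qed
  ultimately have "openin (top_of_set M) (f ` B)" by (auto simp: openin_open)
  moreover have "q \<in> f ` B" using a qU by (auto simp: B_def)
  moreover have "f ` B \<subseteq> f ` A" by (auto simp: B_def)
  ultimately show "\<exists>T. openin (top_of_set M) T \<and> q \<in> T \<and> T \<subseteq> f ` A" by blast
qed

section \<open>Necessity of the condition\<close>

context cauchy_data
begin

text \<open>Along \<open>S\<close> the tangent spaces of \<open>M\<close> are those of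
  \<open>D\<close>, so normal fields of \<open>D\<close> are orthogonal to the tangent field given
  by \<open>DG\<close> on \<open>y\<close>. As \<open>v\<close> is tangent to \<open>S\<close>, a
  curve in \<open>S\<close> can be used to differentiate this.\<close>

lemma solution_second_fundamental_form:
  assumes "smooth_graph M T \<Omega> U G" and SM: "S \<subseteq> M" and TM: "\<And>q. q \<in> S \<Longrightarrow> tangent_space M q = D q"
    and p: "p \<in> S" "p \<in> U" and v: "v \<in> TS p" and y: "y \<in> D p" and n: "n \<in> normal_distribution D p"
  shows "smooth_graph.H G p v y \<bullet> n = - (\<phi> p v n \<bullet> y)"
proof -
  interpret g: smooth_graph M T \<Omega> U G by fact
  have pM: "p \<in> M \<inter> U" using SM p by blast
  obtain W Y where W: "open W" "p \<in> W" and Y: "smooth_on W Y" "\<And>q'. q' \<in> S \<inter> W \<Longrightarrow> Y q' \<in> normal_distribution D q'" "Y p = n"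
    using normal_extension[OF p(1) n] by blast
  obtain \<gamma> where \<gamma>: "smooth_curve_in S p v \<gamma>" using v by (auto simp: tangent_space_def)
  note c = smooth_curve_inD[OF \<gamma>]
  have dY: "((\<lambda>t. Y (\<gamma> t)) has_vector_derivative frechet_derivative Y (at p) v) (at 0)"
    using has_vector_derivative_compose_smooth[OF c(2)] smooth_on_has_derivative[OF Y(1) W(2)] c(1) by simp
  have dG: "((\<lambda>t. g.DG (\<gamma> t) y) has_vector_derivative g.H p v y) (at 0)"
    using has_vector_derivative_compose_smooth[OF c(2), of "\<lambda>z. g.DG z y"] g.H_has_derivative[OF g.U_in[OF pM], of y] c(1) by blast
  have "((\<lambda>t. Y (\<gamma> t) \<bullet> g.DG (\<gamma> t) y) has_vector_derivative
        Y (\<gamma> 0) \<bullet> g.H p v y + frechet_derivative Y (at p) v \<bullet> g.DG (\<gamma> 0) y) (at 0)"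
    by (rule bounded_bilinear.has_vector_derivative[OF bounded_bilinear_inner dY dG])
  moreover have "eventually (\<lambda>t. Y (\<gamma> t) \<bullet> g.DG (\<gamma> t) y = 0) (nhds 0)"
  proof -
    have "eventually (\<lambda>t. \<gamma> t \<in> S \<inter> (W \<inter> U)) (nhds 0)"
      by (rule smooth_curve_in_eventually[OF \<gamma>]) (use W g.open_U p in auto)
    then show ?thesis
    proof (rule eventually_mono)
      fix t assume t: "\<gamma> t \<in> S \<inter> (W \<inter> U)"
      then have "g.DG (\<gamma> t) y \<in> D (\<gamma> t)" using g.DG_tangent[of "\<gamma> t" y] TM SM by auto
      then show "Y (\<gamma> t) \<bullet> g.DG (\<gamma> t) y = 0" using Y(2)[of "\<gamma> t"] t by (auto simp: normal_iff)
    qed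
  qed
  ultimately have "Y (\<gamma> 0) \<bullet> g.H p v y + frechet_derivative Y (at p) v \<bullet> g.DG (\<gamma> 0) y = 0"
    by (rule vector_derivative_eventually_eq[OF _ has_vector_derivative_const])
  moreover have "g.DG p y = y" using g.tangent_iff[OF pM] y TM p by simp
  ultimately have "n \<bullet> g.H p v y + frechet_derivative Y (at p) v \<bullet> y = 0" using c(1) Y(3) by simp
  moreover have "frechet_derivative Y (at p) v \<bullet> y = \<phi> p v n \<bullet> y"
    using phi_smooth_section[OF p(1) W Y(1,2) v] orth_proj_inner[OF subspace_D[OF p(1)] y] Y(3) by simp
  ultimately show ?thesis by (simp add: inner_commute)
qed

lemma dim_perp_K\<phi>: "p \<in> S \<Longrightarrow> dim (D p \<inter> orthogonal_comp (K\<phi> p)) + s = m"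
proof -
  assume p: "p \<in> S"
  have "D p \<inter> orthogonal_comp (K\<phi> p) = {y \<in> D p. \<forall>x\<in>K\<phi> p. orthogonal x y}" by (auto simp: orthogonal_comp_def)
  moreover have "K\<phi> p \<subseteq> D p" using K\<phi>_subset[OF p] Im\<phi>_subset[OF p] by blast
  ultimately show ?thesis
    using dim_subspace_orthogonal_to_vectors[OF inj_phi_N(3)[OF p] subspace_D[OF p]]
      inj_phi_N(4)[OF p] dim_D[OF p] by simp
qed

text \<open>The relative nullity lies in \<open>Rul p\<close>, which lies in
  \<open>D p \<inter> orthogonal_comp (K\<phi> p)\<close>, and the two ends have dimension
  \<open>m - s\<close>. Equality of the last two spaces gives back the condition by taking
  complements in \<open>D p\<close>.\<close>

lemma solution_necessary:
  assumes sol: "cauchy_solution m s S D M" and p: "p \<in> S"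
  shows "Im\<phi> p = K\<phi> p" "relative_nullity M p = Rul p"
proof -
  have M: "embedded_submanifold m M" "S \<subseteq> M" and TM: "\<And>q. q \<in> S \<Longrightarrow> tangent_space M q = D q"
    and ind: "\<And>q. q \<in> M \<Longrightarrow> dim (relative_nullity M q) = m - s"
    using sol by (auto simp: cauchy_solution_def rank_submanifold_def relative_nullity_index_eq)
  have pM: "p \<in> M" using M p by blast
  obtain \<Omega> U G where gr: "smooth_graph M (tangent_space M p) \<Omega> U G" and pU: "p \<in> U"
    using embedded_submanifold_tangent_graph[OF M(1) pM] by metis
  interpret g: smooth_graph M "tangent_space M p" \<Omega> U G by fact
  have pMU: "p \<in> M \<inter> U" using pM pU by blast
  note K = inj_phi_N[OF p] and sD = subspace_D[OF p]
  let ?R = "D p \<inter> orthogonal_comp (K\<phi> p)"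
  have sub1: "relative_nullity M p \<subseteq> Rul p"
  proof
    fix y assume y: "y \<in> relative_nullity M p"
    then have yD: "y \<in> D p" and H0: "\<And>x. g.H p y x = 0" using g.Null_iff[OF pMU] TM[OF p] by auto
    have "y \<bullet> \<phi> p v n = 0" if "v \<in> TS p" "n \<in> normal_distribution D p" for v n
      using solution_second_fundamental_form[OF gr M(2) TM p pU that(1) yD that(2)]
        g.H_sym[OF g.U_in[OF pMU], of v y] H0 by (simp add: inner_commute)
    then show "y \<in> Rul p" using yD by (auto simp: Rul_def orthogonal_comp_iff phi_image_def)
  qed
  have sub2: "Rul p \<subseteq> ?R" using orthogonal_comp_anti_mono[OF K\<phi>_subset[OF p]] by (auto simp: Rul_def)
  have sR: "subspace ?R" by (intro subspace_inter sD subspace_orthogonal_comp)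
  have sN: "subspace (relative_nullity M p)"
    using linear_0[OF g.linear_H1[OF g.U_in[OF pMU]]] linear_add[OF g.linear_H1[OF g.U_in[OF pMU]]]
      linear_scale[OF g.linear_H1[OF g.U_in[OF pMU]]] g.subspace_tangent[OF pMU]
    by (auto simp: subspace_def g.Null_iff[OF pMU])
  have eq: "relative_nullity M p = ?R"
    by (rule subspace_dim_equal[OF sN sR]) (use sub1 sub2 ind[OF pM] dim_perp_K\<phi>[OF p] in auto)
  then show RR: "relative_nullity M p = Rul p" using sub1 sub2 by blast
  show "Im\<phi> p = K\<phi> p"
  proof
    show "K\<phi> p \<subseteq> Im\<phi> p" by (rule K\<phi>_subset[OF p])
    show "Im\<phi> p \<subseteq> K\<phi> p"
    proof
      fix w assume w: "w \<in> Im\<phi> p"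
      \<comment> \<open>The part of \<open>w\<close> outside \<open>K\<phi> p\<close> lies in
        \<open>Rul p\<close>, so it is orthogonal to \<open>w\<close> and to \<open>?k\<close>,
        hence to itself.\<close>
      let ?k = "orth_proj (K\<phi> p) w"
      have k: "?k \<in> K\<phi> p" by (rule orth_proj_in[OF K(3)])
      have "w - ?k \<in> D p"
        using w k Im\<phi>_subset[OF p] K\<phi>_subset[OF p] subspace_diff[OF sD] by blast
      then have "w - ?k \<in> Rul p" using diff_orth_proj_in[OF K(3), of w] eq RR by blast
      then have "(w - ?k) \<bullet> w = 0" "(w - ?k) \<bullet> ?k = 0"
        using w k K\<phi>_subset[OF p] by (auto simp: Rul_def orthogonal_comp_iff)
      then have "(w - ?k) \<bullet> (w - ?k) = 0" by (simp add: inner_diff_right)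
      then show "w \<in> K\<phi> p" using k by simp
    qed
  qed
qed

lemma solution_imp_solvable:
  assumes "cauchy_solution m s S D M"
  shows "solvable_cauchy_data m s S D N"
proof
  show "{\<phi> p v (N p) |v. v \<in> TS p} = Im\<phi> p" if "p \<in> S" for p
    using solution_necessary(1)[OF assms that] by (auto simp: K\<phi>_def)
qed

end

section \<open>Uniqueness and shape of solutions\<close>

context solvable_cauchy_data
begin

lemma solution_contains_rulings:
  assumes sol: "cauchy_solution m s S D M" and p: "p \<in> S"
  shows "\<exists>\<delta>>0. \<forall>q\<in>S. \<forall>x\<in>Rul q. dist q p < \<delta> \<and> norm x < \<delta> \<longrightarrow> q + x \<in> M"
proof -
  have M: "embedded_submanifold m M" "S \<subseteq> M"
    and ind: "\<And>q. q \<in> M \<Longrightarrow> dim (relative_nullity M q) = m - s"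
    using sol by (auto simp: cauchy_solution_def rank_submanifold_def relative_nullity_index_eq)
  have pM: "p \<in> M" using M p by blast
  obtain \<Omega> U G where "smooth_graph M (tangent_space M p) \<Omega> U G" and pU: "p \<in> U"
    using embedded_submanifold_tangent_graph[OF M(1) pM] by metis
  interpret g: smooth_graph M "tangent_space M p" \<Omega> U G by fact
  have "p \<in> M \<inter> U" using pM pU by blast
  then obtain \<epsilon> where \<epsilon>: "\<epsilon> > 0" "\<And>q x. q \<in> M \<inter> U \<Longrightarrow> x \<in> relative_nullity M q \<Longrightarrow> dist q p < \<epsilon> \<and> norm x < \<epsilon> \<Longrightarrow> q + x \<in> M"
    using g.rulings_in[of p "m - s"] ind by blast
  obtain r where r: "r > 0" "ball p r \<subseteq> U" using pU g.open_U openE by blast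
  show ?thesis
  proof (intro exI[of _ "min \<epsilon> r"] conjI ballI impI)
    fix q x assume q: "q \<in> S" "x \<in> Rul q" "dist q p < min \<epsilon> r \<and> norm x < min \<epsilon> r"
    then have "q \<in> M \<inter> U" using r(2) M(2) by (auto simp: dist_commute subset_iff)
    then show "q + x \<in> M" using \<epsilon>(2)[of q x] q solution_necessary(2)[OF sol q(1)] by simp
  qed (use \<epsilon> r in auto)
qed

lemma ruling_bundle_iff: "(q, x) \<in> ruling_bundle S D \<longleftrightarrow> q \<in> S \<and> x \<in> Rul q"
  by (auto simp: ruling_bundle_def Rul_def)

text \<open>Near \<open>p\<close> the rulings lie in \<open>M\<close> and are parametrized by an
  open piece of \<open>D p\<close>, which has the dimension of \<open>M\<close>; so they fill a
  neighbourhood of \<open>p\<close> in \<open>M\<close>. The prescribed open set \<open>O'\<close>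
  allows \<open>W\<close> to be chosen inside a set obtained from another solution.\<close>

lemma solution_local_bundle_image:
  assumes sol: "cauchy_solution m s S D M" and p: "p \<in> S" and O: "open O'" "(p, 0) \<in> O'"
  shows "\<exists>U W. open U \<and> p \<in> U \<and> openin (top_of_set (ruling_bundle S D)) W \<and> (p, 0) \<in> W \<and> W \<subseteq> O' \<and>
     (\<lambda>(p, x). p + x) ` W = M \<inter> U"
proof -
  have M: "embedded_submanifold m M" "S \<subseteq> M"
    using sol by (auto simp: cauchy_solution_def rank_submanifold_def)
  obtain \<delta> where \<delta>: "\<delta> > 0" "\<And>q x. q \<in> S \<Longrightarrow> x \<in> Rul q \<Longrightarrow> dist q p < \<delta> \<and> norm x < \<delta> \<Longrightarrow> q + x \<in> M"
    using solution_contains_rulings[OF sol p] by blast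
  obtain \<epsilon> U0 V \<alpha> \<kappa> \<Psi> where f: "foot_chart p \<epsilon> U0 V \<alpha> \<kappa> \<Psi>" using foot_chart_exists[OF p] by blast
  note F = foot_chartD[OF f]
  have p\<alpha>: "\<alpha> p = p" using F(15)[OF p, of 0] F(1) by (simp add: orthogonal_comp_iff)
  define \<theta> where "\<theta> z = (\<alpha> z, z - \<alpha> z)" for z
  have c\<alpha>: "continuous_on U0 \<alpha>" using smooth_on_continuous_on[OF F(11)] .
  have c\<theta>: "continuous_on U0 \<theta>" unfolding \<theta>_def[abs_def] by (intro continuous_intros c\<alpha>)
  define B where "B = O' \<inter> (ball p \<delta> \<times> ball 0 \<delta>)"
  have B: "open B" "(p, 0) \<in> B" using O \<delta>(1) by (auto simp: B_def intro!: open_Int open_Times)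
  define Z where "Z = U0 \<inter> \<theta> -` B"
  have Z: "open Z" unfolding Z_def by (rule continuous_open_preimage[OF c\<theta> F(2) B(1)])
  have pZ: "p \<in> Z" using F(3) B(2) p\<alpha> by (simp add: Z_def \<theta>_def)
  define A where "A = D p \<inter> (V \<inter> \<Psi> -` Z)"
  have "open (V \<inter> \<Psi> -` Z)"
    by (rule continuous_open_preimage[OF smooth_on_continuous_on[OF F(7)] F(4) Z])
  then have A: "openin (top_of_set (D p)) A" by (auto simp: A_def openin_open)
  have img: "\<Psi> ` A = {z \<in> Z. z - \<alpha> z \<in> Rul (\<alpha> z)}"
  proof (intro equalityI subsetI)
    fix z assume "z \<in> \<Psi> ` A"
    then show "z \<in> {z \<in> Z. z - \<alpha> z \<in> Rul (\<alpha> z)}" using F(10,14) by (auto simp: A_def Z_def)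
  next
    fix z assume z: "z \<in> {z \<in> Z. z - \<alpha> z \<in> Rul (\<alpha> z)}"
    then have zU: "z \<in> U0" by (simp add: Z_def)
    have "\<kappa> z \<in> A" using z F(14)[OF zU] F(6) F(9)[OF zU] zU by (auto simp: A_def)
    then show "z \<in> \<Psi> ` A" using F(9)[OF zU] by (metis imageI)
  qed
  have imgM: "\<Psi> ` A \<subseteq> M"
  proof
    fix z assume "z \<in> \<Psi> ` A"
    then have z: "z \<in> Z" "z - \<alpha> z \<in> Rul (\<alpha> z)" using img by auto
    then have "\<alpha> z + (z - \<alpha> z) \<in> M"
      using F(12)[of z] by (intro \<delta>(2)) (auto simp: Z_def B_def \<theta>_def dist_commute)
    then show "z \<in> M" by simp
  qed
  have "openin (top_of_set M) (\<Psi> ` A)"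
  proof (rule open_image_in_submanifold[OF M(1) subspace_D[OF p] dim_D[OF p] A _ imgM])
    show "continuous_on A \<Psi>" using smooth_on_continuous_on[OF F(7)] by (rule continuous_on_subset) (auto simp: A_def)
    show "inj_on \<Psi> A" by (rule inj_on_inverseI[of _ \<kappa>]) (use F(10) in \<open>auto simp: A_def\<close>)
  qed
  then obtain U1 where U1: "open U1" "\<Psi> ` A = M \<inter> U1" by (auto simp: openin_open)
  define U where "U = U1 \<inter> Z"
  have MU: "M \<inter> U = \<Psi> ` A" using U1(2) img by (auto simp: U_def)
  have "p \<in> \<Psi> ` A" using img pZ p\<alpha> subspace_0[OF subspace_Rul[OF p]] by simp
  then have pU: "p \<in> U" using MU by blast
  have oU: "open U" using U1(1) Z by (auto simp: U_def)
  define W where "W = ruling_bundle S D \<inter> (B \<inter> (\<lambda>(q, x). q + x) -` U)"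
  have "open (B \<inter> (\<lambda>(q, x). q + x) -` U)"
    by (rule continuous_open_preimage[OF _ B(1) oU]) (auto intro!: continuous_intros simp: case_prod_unfold)
  then have W: "openin (top_of_set (ruling_bundle S D)) W" by (auto simp: W_def openin_open)
  have "(p, 0) \<in> W" using p subspace_0[OF subspace_Rul[OF p]] B(2) pU by (auto simp: W_def ruling_bundle_iff)
  moreover have "(\<lambda>(p, x). p + x) ` W = M \<inter> U"
  proof (intro equalityI subsetI)
    fix z assume "z \<in> (\<lambda>(p, x). p + x) ` W"
    then obtain q x where "z = q + x" "q \<in> S" "x \<in> Rul q" "(q, x) \<in> B" "q + x \<in> U" by (auto simp: W_def ruling_bundle_iff)
    then show "z \<in> M \<inter> U" using \<delta>(2)[of q x] by (auto simp: B_def dist_commute)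
  next
    fix z assume z: "z \<in> M \<inter> U"
    then have z': "z \<in> Z" "z - \<alpha> z \<in> Rul (\<alpha> z)" using MU img by auto
    then have "\<alpha> z \<in> S" "(\<alpha> z, z - \<alpha> z) \<in> B" using F(12) by (auto simp: Z_def \<theta>_def)
    then have "(\<alpha> z, z - \<alpha> z) \<in> W" using z z' by (simp add: W_def ruling_bundle_iff)
    then show "z \<in> (\<lambda>(p, x). p + x) ` W" by force
  qed
  moreover have "W \<subseteq> O'" by (auto simp: W_def B_def)
  ultimately show ?thesis using oU pU W by blast
qed

lemma solutions_coincide:
  assumes s1: "cauchy_solution m s S D M1" and s2: "cauchy_solution m s S D M2"
  shows "\<exists>U W. open U \<and> S \<subseteq> U \<and> M1 \<inter> U = M2 \<inter> U \<and> zero_section_nhd S D W \<and> M1 \<inter> U = (\<lambda>(p, x). p + x) ` W"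
proof -
  let ?E = "\<lambda>(p::'a, x::'a). p + x" and ?B = "top_of_set (ruling_bundle S D)"
  \<comment> \<open>With \<open>O'\<close> cutting out the bundle set belonging to
    \<open>M'\<close>, the local piece of \<open>M\<close> consists of ruling points that lie in
    \<open>M'\<close>.\<close>
  have half: "\<exists>U. open U \<and> p \<in> U \<and> M \<inter> U \<subseteq> M'"
    if p: "p \<in> S" and M: "cauchy_solution m s S D M" and M': "cauchy_solution m s S D M'" for p M M'
  proof -
    obtain U W where U: "openin ?B W" "(p, 0) \<in> W" "?E ` W = M' \<inter> U"
      using solution_local_bundle_image[OF M' p open_UNIV] by blast
    obtain O' where O': "open O'" "W = ruling_bundle S D \<inter> O'" using U(1) by (auto simp: openin_open)
    then have "(p, 0) \<in> O'" using U(2) by blast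
    then obtain U1 W1 where U1: "open U1" "p \<in> U1" "openin ?B W1" "W1 \<subseteq> O'" "?E ` W1 = M \<inter> U1"
      using solution_local_bundle_image[OF M p O'(1)] by blast
    have "W1 \<subseteq> W" using U1(3,4) O'(2) openin_imp_subset by blast
    then have "M \<inter> U1 \<subseteq> M'" using U1(5) U(3) by blast
    then show ?thesis using U1 by blast
  qed
  have "\<exists>U W. open U \<and> p \<in> U \<and> M1 \<inter> U = M2 \<inter> U \<and> openin ?B W \<and> (p, 0) \<in> W \<and> ?E ` W = M1 \<inter> U" if p: "p \<in> S" for p
  proof -
    obtain U1 where U1: "open U1" "p \<in> U1" "M1 \<inter> U1 \<subseteq> M2" using half[OF p s1 s2] by blast
    obtain U2 where U2: "open U2" "p \<in> U2" "M2 \<inter> U2 \<subseteq> M1" using half[OF p s2 s1] by blast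
    obtain U3 W where U3: "open U3" "p \<in> U3" "openin ?B W" "(p, 0) \<in> W" "?E ` W = M1 \<inter> U3"
      using solution_local_bundle_image[OF s1 p open_UNIV] by blast
    let ?U = "U1 \<inter> U2 \<inter> U3"
    have oU: "open ?U" using U1 U2 U3 by blast
    have "open (?E -` ?U)"
      by (rule open_vimage[OF oU]) (auto intro!: continuous_intros simp: case_prod_unfold)
    then have "openin ?B (W \<inter> ?E -` ?U)" using U3(3) by (auto simp: openin_open)
    moreover have "?E ` (W \<inter> ?E -` ?U) = M1 \<inter> ?U"
    proof -
      have "f ` (A \<inter> f -` B) = f ` A \<inter> B" for f :: "'a \<times> 'a \<Rightarrow> 'a" and A B by blast
      then have "?E ` (W \<inter> ?E -` ?U) = (M1 \<inter> U3) \<inter> ?U" by (simp only: U3(5))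
      then show ?thesis by blast
    qed
    moreover have "M1 \<inter> ?U = M2 \<inter> ?U" using U1 U2 by blast
    moreover have "(p, 0) \<in> W \<inter> ?E -` ?U" "p \<in> ?U" using U1 U2 U3 by auto
    ultimately show ?thesis using oU by blast
  qed
  then obtain U W where UW: "\<And>p. p \<in> S \<Longrightarrow> open (U p) \<and> p \<in> U p \<and> M1 \<inter> U p = M2 \<inter> U p \<and>
      openin ?B (W p) \<and> (p, 0) \<in> W p \<and> ?E ` W p = M1 \<inter> U p"
    by metis
  let ?U = "\<Union>p\<in>S. U p" and ?W = "\<Union>p\<in>S. W p"
  have "open ?U" using UW by blast
  moreover have "S \<subseteq> ?U" using UW by blast
  moreover have "M1 \<inter> ?U = M2 \<inter> ?U" using UW by blast
  moreover have "zero_section_nhd S D ?W" unfolding zero_section_nhd_def using UW by (intro conjI openin_Union) auto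
  moreover have "?E ` ?W = (\<Union>p\<in>S. ?E ` W p)" by (rule image_UN)
  then have "M1 \<inter> ?U = ?E ` ?W" using UW by (simp only: Int_UN_distrib) simp
  ultimately show ?thesis by blast
qed

end

section \<open>Cofactors\<close>

lemma map_permutation_transpose_compose:
  assumes f: "inj_on f A" and ab: "a \<in> A" "b \<in> A" and p: "p permutes A"
  shows "map_permutation A f (Transposition.transpose a b \<circ> p) = Transposition.transpose (f a) (f b) \<circ> map_permutation A f p"
proof
  fix y
  show "map_permutation A f (Transposition.transpose a b \<circ> p) y = (Transposition.transpose (f a) (f b) \<circ> map_permutation A f p) y"
  proof (cases "y \<in> f ` A")
    case True
    then obtain x where x: "x \<in> A" "y = f x" by blast
    have "p x \<in> A" using p x permutes_in_image by metis
    then have "f (Transposition.transpose a b (p x)) = Transposition.transpose (f a) (f b) (f (p x))"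
      using f ab by (auto simp: Transposition.transpose_def inj_on_def)
    then show ?thesis using map_permutation_apply[OF f x(1)] x(2) by simp
  next
    case False
    then have "y \<noteq> f a" "y \<noteq> f b" using ab by auto
    then show ?thesis using False by (simp add: map_permutation_def restrict_id_def Transposition.transpose_def)
  qed
qed

lemma sign_map_permutation:
  assumes "finite A" "inj_on f A" "p permutes A"
  shows "sign (map_permutation A f p) = sign p"
  using assms(3,1)
proof (induction rule: permutes_induct)
  case id
  show ?case by (simp only: map_permutation_id'[OF assms(2)] sign_id)
next
  case (swap a b p)
  have "map_permutation A f p permutes f ` A"
    using map_permutation_permutes[of f A "f ` A" p] assms(2) swap by (simp add: inj_on_imp_bij_betw)
  then have "permutation (map_permutation A f p)" using assms(1) permutation_permutes by blast
  moreover have "permutation p" using swap assms(1) permutation_permutes by blast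
  moreover have "f a \<noteq> f b" using swap assms(2) by (auto simp: inj_on_def)
  ultimately show ?case
    using swap by (simp only: map_permutation_transpose_compose[OF assms(2) swap(1,2,4)]
      sign_compose[OF permutation_swap_id] sign_swap_id)
qed

text \<open>Conjugation by \<open>f\<close> is a sign-preserving bijection between the two sets of
  permutations.\<close>

lemma sum_permutations_map:
  fixes g :: "('b \<Rightarrow> 'b) \<Rightarrow> real"
  assumes A: "finite A" and f: "bij_betw f A B"
  shows "(\<Sum>q | q permutes B. of_int (sign q) * g q) =
    (\<Sum>p | p permutes A. of_int (sign p) * g (map_permutation A f p))"
proof -
  have inj: "inj_on f A" and f': "bij_betw (inv_into A f) B A" using f bij_betw_inv_into by (auto simp: bij_betw_def)
  have l: "inv_into A f (f x) = x" if "x \<in> A" for x using that inj by simp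
  have r: "f (inv_into A f y) = y" if "y \<in> B" for y using that f f_inv_into_f by (metis bij_betw_def)
  show ?thesis
  proof (rule sum.reindex_bij_witness[of _ "map_permutation A f" "map_permutation B (inv_into A f)"])
    fix q assume q: "q \<in> {q. q permutes B}"
    show "map_permutation A f (map_permutation B (inv_into A f) q) = q"
      by (rule map_permutation_compose_inv[OF f']) (use q r in auto)
    show "map_permutation B (inv_into A f) q \<in> {p. p permutes A}"
      using map_permutation_permutes[OF f'] q by simp
    have "finite B" using A f bij_betw_finite by blast
    then show "of_int (sign (map_permutation B (inv_into A f) q)) *
        g (map_permutation A f (map_permutation B (inv_into A f) q)) = of_int (sign q) * g q"
      using sign_map_permutation[of B "inv_into A f" q] f' q
        \<open>map_permutation A f (map_permutation B (inv_into A f) q) = q\<close> by (simp add: bij_betw_def)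
  next
    fix p assume p: "p \<in> {p. p permutes A}"
    show "map_permutation B (inv_into A f) (map_permutation A f p) = p"
      by (rule map_permutation_compose_inv[OF f]) (use p l in auto)
    show "map_permutation A f p \<in> {q. q permutes B}"
      using map_permutation_permutes[OF f] p by simp
  qed
qed

text \<open>The cycle that moves \<open>n\<close> to \<open>t\<close>; on \<open>{1..<n}\<close> it enumerates \<open>{1..n} - {t}\<close> in increasing order.\<close>

definition rot :: "nat \<Rightarrow> nat \<Rightarrow> nat \<Rightarrow> nat" where
  "rot t n l = (if t \<le> l \<and> l < n then Suc l else if l = n then t else l)"

text \<open>Each increase of \<open>n\<close> multiplies the cycle by one transposition of
  neighbours.\<close>

lemma rot_permutes_sign:
  assumes "1 \<le> t" "t \<le> n"
  shows "rot t n permutes {1..n} \<and> sign (rot t n) = (-1) ^ (n - t)"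
  using assms(2)
proof (induction n rule: dec_induct)
  case base
  have "rot t t = id" by (auto simp: rot_def)
  then show ?case by (simp only: permutes_id sign_id) simp
next
  case (step n)
  have eq: "rot t (Suc n) = rot t n \<circ> Transposition.transpose n (Suc n)"
    using step(1) by (auto simp: rot_def Transposition.transpose_def fun_eq_iff)
  have "rot t n permutes {1..Suc n}" using step.IH by (auto intro: permutes_subset)
  moreover have "Transposition.transpose n (Suc n) permutes {1..Suc n}" using assms(1) step(1) by (intro permutes_swap_id) auto
  ultimately have "rot t (Suc n) permutes {1..Suc n}" unfolding eq by (intro permutes_compose)
  moreover have "permutation (rot t n)" using step.IH permutation_permutes by blast
  then have "sign (rot t (Suc n)) = (-1) ^ (Suc n - t)"
    using step by (simp add: eq sign_compose permutation_swap_id sign_swap_id Suc_diff_le)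
  ultimately show ?case by blast
qed

text \<open>A permutation is uniquely \<open>rot t (Suc s) \<circ> p\<close>, with \<open>t\<close>
  the image of the last index: the indexing behind the expansion of a determinant along its last
  row.\<close>

lemma sum_permutations_last:
  fixes G :: "(nat \<Rightarrow> nat) \<Rightarrow> real"
  shows "(\<Sum>\<pi> | \<pi> permutes {1..Suc s}. G \<pi>) = (\<Sum>t\<in>{1..Suc s}. \<Sum>p | p permutes {1..s}. G (rot t (Suc s) \<circ> p))"
proof -
  let ?R = "\<lambda>t. rot t (Suc s)"
  have R: "?R t permutes {1..Suc s}" if "t \<in> {1..Suc s}" for t using rot_permutes_sign[of t "Suc s"] that by simp
  have "(\<Sum>t\<in>{1..Suc s}. \<Sum>p | p permutes {1..s}. G (?R t \<circ> p)) =
      (\<Sum>(t, p)\<in>{1..Suc s} \<times> {p. p permutes {1..s}}. G (?R t \<circ> p))"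
    by (rule sum.cartesian_product)
  also have "\<dots> = (\<Sum>\<pi> | \<pi> permutes {1..Suc s}. G \<pi>)"
  proof (rule sum.reindex_bij_witness[of _ "\<lambda>\<pi>. (\<pi> (Suc s), inv (?R (\<pi> (Suc s))) \<circ> \<pi>)" "\<lambda>(t, p). ?R t \<circ> p"])
    fix a assume "a \<in> {1..Suc s} \<times> {p. p permutes {1..s}}"
    then obtain t p where a: "a = (t, p)" "t \<in> {1..Suc s}" "p permutes {1..s}" by blast
    have "p permutes {1..Suc s}" using a(3) by (auto intro: permutes_subset)
    then have "(?R t \<circ> p) permutes {1..Suc s}" using R[OF a(2)] by (rule permutes_compose)
    then show "(case a of (t, p) \<Rightarrow> ?R t \<circ> p) \<in> {\<pi>. \<pi> permutes {1..Suc s}}" by (simp add: a(1))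
    have "p (Suc s) = Suc s" using a(3) by (simp add: permutes_not_in)
    then have "(?R t \<circ> p) (Suc s) = t" by (simp add: rot_def)
    moreover have "inv (?R t) \<circ> (?R t \<circ> p) = p" using permutes_inv_o(2)[OF R[OF a(2)]] by (simp add: o_assoc)
    ultimately show "((case a of (t, p) \<Rightarrow> ?R t \<circ> p) (Suc s), inv (?R ((case a of (t, p) \<Rightarrow> ?R t \<circ> p) (Suc s))) \<circ>
        (case a of (t, p) \<Rightarrow> ?R t \<circ> p)) = a" by (simp add: a(1))
  next
    fix \<pi> assume "\<pi> \<in> {\<pi>. \<pi> permutes {1..Suc s}}"
    then have \<pi>: "\<pi> permutes {1..Suc s}" by simp
    let ?t = "\<pi> (Suc s)"
    have t: "?t \<in> {1..Suc s}" using permutes_in_image[OF \<pi>, of "Suc s"] by simp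
    have "inv (?R ?t) \<circ> \<pi> permutes {1..Suc s}" using \<pi> permutes_inv[OF R[OF t]] by (rule permutes_compose)
    moreover have "(inv (?R ?t) \<circ> \<pi>) x = x" if "x \<in> {1..Suc s} - {1..s}" for x
    proof -
      have "x = Suc s" using that by auto
      then show ?thesis using permutes_inv_eq[OF R[OF t]] by (simp add: rot_def)
    qed
    ultimately have "inv (?R ?t) \<circ> \<pi> permutes {1..s}" by (rule permutes_superset)
    then show "(?t, inv (?R ?t) \<circ> \<pi>) \<in> {1..Suc s} \<times> {p. p permutes {1..s}}" using t by simp
    have "?R ?t \<circ> (inv (?R ?t) \<circ> \<pi>) = \<pi>" using permutes_inv_o(1)[OF R[OF t]] by (simp add: o_assoc)
    then show "(case (?t, inv (?R ?t) \<circ> \<pi>) of (t, p) \<Rightarrow> ?R t \<circ> p) = \<pi>"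
      by simp
  qed auto
  finally show ?thesis by simp
qed

text \<open>Exchanging the equal rows preserves the products and reverses the signs, so the sum
  equals its own negative.\<close>

lemma alternating_sum_repeated_row:
  fixes F :: "nat \<Rightarrow> nat \<Rightarrow> real"
  assumes A: "finite A" and l: "l \<in> A" "n \<in> A" "l \<noteq> n" and eq: "F l = F n"
  shows "(\<Sum>\<pi> | \<pi> permutes A. of_int (sign \<pi>) * (\<Prod>r\<in>A. F r (\<pi> r))) = 0"
proof -
  let ?q = "Transposition.transpose l n"
  let ?S = "\<Sum>\<pi> | \<pi> permutes A. of_int (sign \<pi>) * (\<Prod>r\<in>A. F r (\<pi> r))"
  have q: "?q permutes A" using l by (intro permutes_swap_id)
  have "?S = (\<Sum>\<pi> | \<pi> permutes A. of_int (sign (\<pi> \<circ> ?q)) * (\<Prod>r\<in>A. F r ((\<pi> \<circ> ?q) r)))"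
    by (rule sum_permutations_compose_right[OF q])
  also have "\<dots> = (\<Sum>\<pi> | \<pi> permutes A. - (of_int (sign \<pi>) * (\<Prod>r\<in>A. F r (\<pi> r))))"
  proof (rule sum.cong[OF refl])
    fix \<pi> assume "\<pi> \<in> {\<pi>. \<pi> permutes A}"
    then have "permutation \<pi>" using A permutation_permutes by blast
    then have "sign (\<pi> \<circ> ?q) = - sign \<pi>" using l(3) by (simp add: sign_compose permutation_swap_id sign_swap_id)
    moreover have "(\<Prod>r\<in>A. F r ((\<pi> \<circ> ?q) r)) = (\<Prod>r\<in>A. F (?q r) (\<pi> (?q r)))"
    proof (rule prod.cong[OF refl])
      fix r show "F r ((\<pi> \<circ> ?q) r) = F (?q r) (\<pi> (?q r))" using eq by (cases "r = l"; cases "r = n") auto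
    qed
    moreover have "(\<Prod>r\<in>A. F (?q r) (\<pi> (?q r))) = (\<Prod>r\<in>A. F r (\<pi> r))"
      using prod.permute[OF q, of "\<lambda>r. F r (\<pi> r)"] by (simp add: o_def)
    ultimately show "of_int (sign (\<pi> \<circ> ?q)) * (\<Prod>r\<in>A. F r ((\<pi> \<circ> ?q) r)) = - (of_int (sign \<pi>) * (\<Prod>r\<in>A. F r (\<pi> r)))"
      by simp
  qed
  also have "\<dots> = - ?S" by (rule sum_negf)
  finally show ?thesis by simp
qed

text \<open>The row \<open>f l'\<close> is appended as row \<open>Suc s\<close> and duplicates row
  \<open>l'\<close>. Up to the factor \<open>(-1) ^ Suc s\<close>, the sum is the expansion of this
  vanishing determinant along the new row.\<close>

lemma cofactor_orthogonality:
  fixes f :: "nat \<Rightarrow> nat \<Rightarrow> real"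
  assumes l': "l' \<in> {1..s}"
  shows "(\<Sum>t\<in>{1..Suc s}. (-1) ^ t *
    (\<Sum>p | p permutes {1..s}. of_int (sign p) * (\<Prod>l\<in>{1..s}. f l (e (rot t (Suc s) (p l))))) * f l' (e t)) = 0"
proof -
  define F where "F r k = (if r = Suc s then f l' (e k) else f r (e k))" for r k
  have "F l' = F (Suc s)" using l' by (auto simp: F_def)
  then have "(\<Sum>\<pi> | \<pi> permutes {1..Suc s}. of_int (sign \<pi>) * (\<Prod>r\<in>{1..Suc s}. F r (\<pi> r))) = 0"
    using l' by (intro alternating_sum_repeated_row[of _ l' "Suc s"]) auto
  then have "0 = (\<Sum>t\<in>{1..Suc s}. \<Sum>p | p permutes {1..s}.
      of_int (sign (rot t (Suc s) \<circ> p)) * (\<Prod>r\<in>{1..Suc s}. F r ((rot t (Suc s) \<circ> p) r)))"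
    by (simp only: sum_permutations_last)
  also have "\<dots> = (\<Sum>t\<in>{1..Suc s}. (-1) ^ (Suc s) * ((-1) ^ t *
    (\<Sum>p | p permutes {1..s}. of_int (sign p) * (\<Prod>l\<in>{1..s}. f l (e (rot t (Suc s) (p l))))) * f l' (e t)))"
  proof (rule sum.cong[OF refl])
    fix t assume t: "t \<in> {1..Suc s}"
    have "of_int (sign (rot t (Suc s) \<circ> p)) * (\<Prod>r\<in>{1..Suc s}. F r ((rot t (Suc s) \<circ> p) r)) =
      (-1) ^ (Suc s) * ((-1) ^ t * (of_int (sign p) * (\<Prod>l\<in>{1..s}. f l (e (rot t (Suc s) (p l)))) * f l' (e t)))"
      if "p permutes {1..s}" for p
    proof -
      have "permutation p" "permutation (rot t (Suc s))"
        using that rot_permutes_sign[of t "Suc s"] t permutation_permutes by (blast, auto)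
      then have "sign (rot t (Suc s) \<circ> p) = (-1) ^ (Suc s - t) * sign p"
        using rot_permutes_sign[of t "Suc s"] t by (simp add: sign_compose)
      moreover have "(-1 :: real) ^ (Suc s - t) = (-1) ^ (Suc s) * (-1) ^ t"
      proof -
        have "Suc s = (Suc s - t) + t" using t by simp
        then have "(-1 :: real) ^ (Suc s) = (-1) ^ (Suc s - t) * (-1) ^ t" by (metis power_add)
        moreover have "(-1 :: real) ^ t * (-1) ^ t = 1" by (simp flip: power_mult_distrib)
        ultimately show ?thesis by (simp only: mult.assoc mult_1_right)
      qed
      moreover have "{1..Suc s} = insert (Suc s) {1..s}" by auto
      then have "(\<Prod>r\<in>{1..Suc s}. F r ((rot t (Suc s) \<circ> p) r)) =
          f l' (e t) * (\<Prod>l\<in>{1..s}. f l (e (rot t (Suc s) (p l))))"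
        using that by (simp add: F_def permutes_not_in rot_def)
      ultimately show ?thesis by (simp add: mult_ac)
    qed
    then have "(\<Sum>p | p permutes {1..s}. of_int (sign (rot t (Suc s) \<circ> p)) * (\<Prod>r\<in>{1..Suc s}. F r ((rot t (Suc s) \<circ> p) r)))
      = (\<Sum>p | p permutes {1..s}. (-1) ^ (Suc s) * ((-1) ^ t * (of_int (sign p) * (\<Prod>l\<in>{1..s}. f l (e (rot t (Suc s) (p l)))) * f l' (e t))))"
      by (intro sum.cong) auto
    then show "(\<Sum>p | p permutes {1..s}. of_int (sign (rot t (Suc s) \<circ> p)) * (\<Prod>r\<in>{1..Suc s}. F r ((rot t (Suc s) \<circ> p) r)))
      = (-1) ^ (Suc s) * ((-1) ^ t * (\<Sum>p | p permutes {1..s}. of_int (sign p) * (\<Prod>l\<in>{1..s}. f l (e (rot t (Suc s) (p l))))) * f l' (e t))"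
      by (simp only: sum_distrib_left sum_distrib_right mult.assoc)
  qed
  finally show ?thesis by (simp only: sum_distrib_left[symmetric]) simp
qed

text \<open>A strictly increasing list is determined by its set; the enumeration of
  \<open>I i\<close> in \<open>ruling_field\<close> thereby gets the closed form given by
  \<open>rot\<close>.\<close>

lemma sorted_list_remove_nth:
  fixes e :: "nat \<Rightarrow> nat"
  assumes e: "strict_mono_on {1..Suc s} e" and t: "t \<in> {1..Suc s}" and l: "l \<in> {1..s}"
  shows "sorted_list_of_set (e ` {1..Suc s} - {e t}) ! (l - 1) = e (rot t (Suc s) l)"
proof -
  let ?xs = "map (\<lambda>l. e (rot t (Suc s) l)) [1..<Suc s]"
  have inj: "inj_on e {1..Suc s}" using e strict_mono_on_imp_inj_on by blast
  have mono: "rot t (Suc s) i < rot t (Suc s) j" if "i < j" "j \<le> s" for i j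
    using that by (auto simp: rot_def)
  have in_range: "rot t (Suc s) i \<in> {1..Suc s} - {t}" if "i \<in> {1..s}" for i
    using that by (auto simp: rot_def)
  have "sorted_wrt (<) ?xs"
  proof (subst sorted_wrt_map, subst sorted_wrt_iff_nth_less, intro allI impI)
    fix i j assume "i < j" "j < length [1..<Suc s]"
    then show "e (rot t (Suc s) ([1..<Suc s] ! i)) < e (rot t (Suc s) ([1..<Suc s] ! j))"
    proof -
      have j: "i < j" "j < s" using \<open>i < j\<close> \<open>j < length [1..<Suc s]\<close> by (simp_all del: upt_Suc)
      then have "[1..<Suc s] ! i = Suc i" "[1..<Suc s] ! j = Suc j" by (simp_all del: upt_Suc)
      moreover have "e (rot t (Suc s) (Suc i)) < e (rot t (Suc s) (Suc j))"
        using in_range[of "Suc i"] in_range[of "Suc j"] mono[of "Suc i" "Suc j"] j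
        by (intro strict_mono_onD[OF e]) auto
      ultimately show ?thesis by simp
    qed
  qed
  moreover have "set ?xs = e ` {1..Suc s} - {e t}"
  proof -
    have "rot t (Suc s) ` {1..s} = {1..Suc s} - {t}"
    proof
      show "rot t (Suc s) ` {1..s} \<subseteq> {1..Suc s} - {t}"
        by (rule image_subsetI) (rule in_range)
      show "{1..Suc s} - {t} \<subseteq> rot t (Suc s) ` {1..s}"
      proof
        fix i assume i: "i \<in> {1..Suc s} - {t}"
        then have "i = rot t (Suc s) (if i < t then i else i - 1)" "(if i < t then i else i - 1) \<in> {1..s}"
          using t by (auto simp: rot_def)
        then show "i \<in> rot t (Suc s) ` {1..s}" by blast
      qed
    qed
    then have "e ` rot t (Suc s) ` {1..s} = e ` ({1..Suc s} - {t})" by (rule arg_cong)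
    then have "(\<lambda>l. e (rot t (Suc s) l)) ` {1..s} = e ` ({1..Suc s} - {t})" by (simp only: image_image)
    also have "\<dots> = e ` {1..Suc s} - {e t}" using inj_on_image_set_diff[OF inj, of "{1..Suc s}" "{t}"] t by auto
    finally show ?thesis by (simp only: set_map set_upt atLeastLessThanSuc_atLeastAtMost)
  qed
  ultimately have "sorted_list_of_set (e ` {1..Suc s} - {e t}) = ?xs"
    by (metis sorted_list_of_set.sorted_key_list_of_set_unique strict_sorted_equal
        sorted_list_of_set.strict_sorted_key_list_of_set finite_set sorted_list_of_set.set_sorted_key_list_of_set)
  then show ?thesis using l by (auto simp del: upt_Suc)
qed

text \<open>Relabelling by the increasing enumeration of \<open>I\<close> brings the permutation sum
  of \<open>ruling_field\<close> into the shape of a cofactor.\<close>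

lemma minor_eq:
  fixes f :: "nat \<Rightarrow> nat \<Rightarrow> real" and e :: "nat \<Rightarrow> nat"
  assumes e: "strict_mono_on {1..Suc s} e" and t: "t \<in> {1..Suc s}"
  defines "I \<equiv> e ` {1..Suc s} - {e t}"
  shows "(\<Sum>\<tau> | \<tau> permutes I. of_int (sign \<tau>) * (\<Prod>l\<in>{1..s}. f l (\<tau> (sorted_list_of_set I ! (l - 1))))) =
    (\<Sum>p | p permutes {1..s}. of_int (sign p) * (\<Prod>l\<in>{1..s}. f l (e (rot t (Suc s) (p l)))))"
proof -
  let ?b = "\<lambda>l. e (rot t (Suc s) l)"
  note k = sorted_list_remove_nth[OF e t, folded I_def]
  have inj: "inj_on ?b {1..s}"
  proof (rule inj_onI)
    fix x y assume xy: "x \<in> {1..s}" "y \<in> {1..s}" "?b x = ?b y"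
    have "rot t (Suc s) x \<in> {1..Suc s}" "rot t (Suc s) y \<in> {1..Suc s}" using xy by (auto simp: rot_def)
    then have "rot t (Suc s) x = rot t (Suc s) y" using xy(3) strict_mono_on_imp_inj_on[OF e] by (meson inj_onD)
    then show "x = y" using xy by (auto simp: rot_def split: if_splits)
  qed
  have card: "card I = s" "finite I"
    using t card_image[OF strict_mono_on_imp_inj_on[OF e]] by (auto simp: I_def card_Diff_singleton)
  have "?b ` {1..s} \<subseteq> I"
  proof
    fix y assume "y \<in> ?b ` {1..s}"
    then obtain l where l: "l \<in> {1..s}" "y = ?b l" by blast
    then have "y = sorted_list_of_set I ! (l - 1)" "l - 1 < length (sorted_list_of_set I)" using k card by auto
    then show "y \<in> I" using card(2) by (metis nth_mem set_sorted_list_of_set)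
  qed
  then have bij: "bij_betw ?b {1..s} I"
    using inj card by (simp add: bij_betw_def card_image card_subset_eq)
  have "(\<Sum>\<tau> | \<tau> permutes I. of_int (sign \<tau>) * (\<Prod>l\<in>{1..s}. f l (\<tau> (sorted_list_of_set I ! (l - 1))))) =
    (\<Sum>p | p permutes {1..s}. of_int (sign p) *
       (\<Prod>l\<in>{1..s}. f l (map_permutation {1..s} ?b p (sorted_list_of_set I ! (l - 1)))))"
    by (rule sum_permutations_map[OF _ bij]) simp
  also have "\<dots> = (\<Sum>p | p permutes {1..s}. of_int (sign p) * (\<Prod>l\<in>{1..s}. f l (?b (p l))))"
    by (intro sum.cong prod.cong arg_cong2[of _ _ _ _ "(*)"] refl) (simp only: k map_permutation_apply[OF inj])
  finally show ?thesis .
qed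

text \<open>The index type \<open>'s\<close> is a vehicle: through a bijection with
  \<open>{1..s}\<close> the sum becomes \<open>det\<close> of a matrix with trivial kernel.\<close>

lemma alternating_sum_nonzero:
  fixes f :: "nat \<Rightarrow> nat \<Rightarrow> real"
  assumes card: "CARD('s::finite) = s"
    and nonsing: "\<And>v. (\<And>l. l \<in> {1..s} \<Longrightarrow> (\<Sum>k\<in>{1..s}. f l k * v k) = 0) \<Longrightarrow> \<forall>k\<in>{1..s}. v k = 0"
  shows "(\<Sum>p | p permutes {1..s}. of_int (sign p) * (\<Prod>l\<in>{1..s}. f l (p l))) \<noteq> 0"
proof -
  obtain \<beta> :: "'s \<Rightarrow> nat" where \<beta>: "bij_betw \<beta> UNIV {1..s}"
    using finite_same_card_bij[of "UNIV :: 's set" "{1..s}"] card by auto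
  define A :: "real ^ 's ^ 's" where "A = (\<chi> i j. f (\<beta> i) (\<beta> j))"
  have inj: "inj \<beta>" using \<beta> by (simp add: bij_betw_def)
  have "(\<Sum>p | p permutes {1..s}. of_int (sign p) * (\<Prod>l\<in>{1..s}. f l (p l))) =
    (\<Sum>p | p permutes (UNIV :: 's set). of_int (sign p) * (\<Prod>l\<in>{1..s}. f l (map_permutation UNIV \<beta> p l)))"
    by (rule sum_permutations_map[OF _ \<beta>]) simp
  also have "\<dots> = det A"
    unfolding det_def A_def
  proof (intro sum.cong refl arg_cong2[of _ _ _ _ "(*)"])
    fix p :: "'s \<Rightarrow> 's"
    have "(\<Prod>l\<in>{1..s}. f l (map_permutation UNIV \<beta> p l)) = (\<Prod>i\<in>UNIV. f (\<beta> i) (map_permutation UNIV \<beta> p (\<beta> i)))"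
      by (rule prod.reindex_bij_betw[OF \<beta>, symmetric])
    then show "(\<Prod>l\<in>{1..s}. f l (map_permutation UNIV \<beta> p l)) = (\<Prod>i\<in>UNIV. (\<chi> i j. f (\<beta> i) (\<beta> j)) $ i $ p i)"
      by (simp add: map_permutation_apply[OF inj])
  qed
  also have "det A \<noteq> 0"
  proof -
    have "x = 0" if x: "A *v x = 0" for x
    proof -
      define v where "v k = x $ inv \<beta> k" for k
      have v\<beta>: "v (\<beta> j) = x $ j" for j by (simp add: v_def inv_f_f[OF inj])
      have "\<forall>k\<in>{1..s}. v k = 0"
      proof (rule nonsing)
        fix l assume "l \<in> {1..s}"
        then obtain i where i: "l = \<beta> i" using \<beta> by (metis bij_betw_imp_surj_on imageE)
        have "(\<Sum>k\<in>{1..s}. f l k * v k) = (\<Sum>j\<in>UNIV. f l (\<beta> j) * v (\<beta> j))"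
          by (rule sum.reindex_bij_betw[OF \<beta>, symmetric])
        also have "\<dots> = (A *v x) $ i" by (simp add: i v\<beta> A_def matrix_vector_mult_def)
        finally show "(\<Sum>k\<in>{1..s}. f l k * v k) = 0" using x by simp
      qed
      moreover have "\<beta> j \<in> {1..s}" for j using \<beta> by (auto simp: bij_betw_def)
      ultimately have "x $ j = 0" for j using v\<beta> by metis
      then show "x = 0" by (simp add: vec_eq_iff)
    qed
    then have "invertible A" by (metis invertible_left_inverse matrix_left_invertible_ker)
    then show ?thesis using invertible_det_nz by blast
  qed
  finally show ?thesis .
qed

section \<open>The parametrization\<close>

lemma smooth_on_along_compose:
  fixes \<xi> :: "'b::euclidean_space \<Rightarrow> 'a::euclidean_space"
  assumes "open A" "smooth_on A \<xi>" "\<xi> ` A \<subseteq> R" "smooth_along R X"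
  shows "smooth_on A (\<lambda>a. X (\<xi> a))"
proof (rule smooth_on_locally)
  fix a assume a: "a \<in> A"
  then obtain U g where U: "open U" "\<xi> a \<in> U" and g: "smooth_on U g" "\<And>q. q \<in> R \<inter> U \<Longrightarrow> X q = g q"
    using smooth_alongE[OF assms(4), of "\<xi> a"] assms(3) by blast
  let ?V = "A \<inter> \<xi> -` U"
  have V: "open ?V" by (rule continuous_open_preimage[OF smooth_on_continuous_on[OF assms(2)] assms(1) U(1)])
  have "smooth_on ?V (\<lambda>a. g (\<xi> a))"
    by (rule smooth_on_compose[OF V U(1) smooth_on_subset[OF _ assms(2)] g(1)]) auto
  then have "smooth_on ?V (\<lambda>a. X (\<xi> a))"
    by (rule smooth_on_cong_imp[OF V, rotated]) (use g(2) assms(3) in auto)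
  then show "\<exists>V. open V \<and> a \<in> V \<and> smooth_on V (\<lambda>a. X (\<xi> a))" using V a U(2) by blast
qed

section \<open>The ruling fields as generalized cross products\<close>

context cauchy_data
begin

lemma adapted_frame:
  assumes E: "adapted_orthonormal_frame m s S D R E" and q: "q \<in> R"
  shows "\<And>i. i \<in> {1..m} \<Longrightarrow> E i q \<in> D q" "\<And>i. i \<in> {1..s} \<Longrightarrow> E i q \<in> TS q"
    "\<And>i k. i \<in> {1..m} \<Longrightarrow> k \<in> {1..m} \<Longrightarrow> E i q \<bullet> E k q = (if i = k then 1 else 0)"
    "span ((\<lambda>i. E i q) ` {1..s}) = TS q"
proof -
  have D: "span ((\<lambda>i. E i q) ` {1..m}) = D q" and T: "span ((\<lambda>i. E i q) ` {1..s}) = TS q"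
    using E q unfolding adapted_orthonormal_frame_def by blast+
  show "E i q \<in> D q" if "i \<in> {1..m}" for i
    unfolding D[symmetric] using that by (intro span_base imageI)
  show "E i q \<in> TS q" if "i \<in> {1..s}" for i
    unfolding T[symmetric] using that by (intro span_base imageI)
  show "E i q \<bullet> E k q = (if i = k then 1 else 0)" if "i \<in> {1..m}" "k \<in> {1..m}" for i k
    using E q that unfolding adapted_orthonormal_frame_def by blast
qed (use E q in \<open>simp add: adapted_orthonormal_frame_def\<close>)

lemma phi_coeff_eq_nabla:
  assumes E: "adapted_orthonormal_frame m s S D R E" and q: "q \<in> R" "q \<in> S"
    and i: "i \<in> {1..s}" and k: "k \<in> {1..m}"
  shows "phi_coeff S D N E q i k = nabla S N q (E i q) \<bullet> E k q"
proof -
  note fr = adapted_frame[OF E q(1)]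
  have "\<phi> q (E i q) (N q) = orth_proj (D q) (nabla S N q (E i q))"
    using phi_section[OF q(2) fr(2)[OF i] open_UNIV UNIV_I, of N] section_N by simp
  then show ?thesis using orth_proj_inner[OF subspace_D[OF q(2)] fr(1)[OF k]] by (simp add: phi_coeff_def)
qed

text \<open>\<open>e\<close> lists the indices 1, ..., s, s + j increasingly, so the exponent
  \<open>h\<close> is simply the position \<open>t\<close>; the index \<open>s + j\<close> sits at
  position \<open>s + 1\<close>.\<close>

lemma ruling_field_expansion:
  assumes "1 \<le> j"
  defines "e \<equiv> (\<lambda>t. if t \<le> s then t else s + j)"
  shows "ruling_field s S D N E j q = (\<Sum>t\<in>{1..Suc s}. ((-1) ^ t *
     (\<Sum>p | p permutes {1..s}. of_int (sign p) * (\<Prod>l\<in>{1..s}. phi_coeff S D N E q l (e (rot t (Suc s) (p l)))))) *\<^sub>R E (e t) q)"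
proof -
  have mono: "strict_mono_on {1..Suc s} e" using assms(1) by (auto simp: strict_mono_on_def e_def)
  have J: "{1..s} \<union> {s + j} = e ` {1..Suc s}"
  proof -
    have "{1..Suc s} = insert (Suc s) {1..s}" by auto
    moreover have "e ` {1..s} = {1..s}" by (auto simp: e_def image_iff)
    moreover have "e (Suc s) = s + j" by (simp add: e_def)
    ultimately show ?thesis by (simp only: image_insert Un_insert_right Un_empty_right)
  qed
  have inj: "inj_on e {1..Suc s}" using strict_mono_on_imp_inj_on[OF mono] .
  have pow: "(-1 :: real) ^ (if e t = s + j then s + 1 else e t) = (-1) ^ t" if "t \<in> {1..Suc s}" for t
    using that assms(1) by (auto simp: e_def le_Suc_eq)
  show ?thesis
    unfolding ruling_field_def Let_def J sum.reindex[OF inj] o_def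
    by (intro sum.cong refl) (simp only: minor_eq[OF mono] pow)
qed

text \<open>A kernel vector yields a tangent vector \<open>y\<close> orthogonal to
  \<open>\<phi> q (E l q) (N q)\<close> for all \<open>l\<close>, hence to \<open>K\<phi> q\<close>;
  transversality makes it zero.\<close>

lemma phi_coeff_nonsingular:
  assumes E: "adapted_orthonormal_frame m s S D R E" and q: "q \<in> R" "q \<in> S" and sm: "s \<le> m"
    and z: "\<And>l. l \<in> {1..s} \<Longrightarrow> (\<Sum>k\<in>{1..s}. phi_coeff S D N E q l k * v k) = 0"
  shows "\<forall>k\<in>{1..s}. v k = 0"
proof -
  note fr = adapted_frame[OF E q(1)]
  define y where "y = (\<Sum>k\<in>{1..s}. v k *\<^sub>R E k q)"
  have y: "y \<in> TS q"
    unfolding y_def using fr(2) subspace_TS[OF q(2)] by (intro subspace_sum subspace_scale) auto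
  obtain L where L: "linear L" "\<And>v. v \<in> TS q \<Longrightarrow> \<phi> q v (N q) = L v"
    using phi_linear_extension[OF q(2) N_normal[OF q(2)]] by blast
  have "y \<bullet> L u = 0" if "u \<in> span ((\<lambda>i. E i q) ` {1..s})" for u
  proof (rule span_induct[OF that])
    show "subspace {u. y \<bullet> L u = 0}"
      using linear_0[OF L(1)] linear_add[OF L(1)] linear_scale[OF L(1)] by (simp add: subspace_def inner_add_right)
    fix u assume "u \<in> (\<lambda>i. E i q) ` {1..s}"
    then obtain l where l: "l \<in> {1..s}" "u = E l q" by blast
    have "y \<bullet> L u = (\<Sum>k\<in>{1..s}. phi_coeff S D N E q l k * v k)"
      unfolding y_def inner_sum_left inner_scaleR_left phi_coeff_def l(2)
      by (intro sum.cong refl) (simp add: L(2)[OF fr(2)[OF l(1)]] inner_commute mult.commute)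
    then show "y \<bullet> L u = 0" using z[OF l(1)] by simp
  qed
  then have "y \<bullet> w = 0" if "w \<in> K\<phi> q" for w using that fr(4) L(2) by (auto simp: K\<phi>_def)
  then have "y = 0" by (rule TS_perp_K\<phi>[OF q(2) y])
  have "v k = y \<bullet> E k q" if "k \<in> {1..s}" for k
  proof -
    have "y \<bullet> E k q = (\<Sum>i\<in>{1..s}. v i * (if i = k then 1 else 0))"
      unfolding y_def inner_sum_left inner_scaleR_left
      by (intro sum.cong refl arg_cong2[of _ _ _ _ "(*)"] fr(3)) (use that sm in auto)
    also have "\<dots> = v k" using that by (simp add: sum.delta if_distrib cong: if_cong)
    finally show ?thesis by simp
  qed
  then show ?thesis using \<open>y = 0\<close> by simp
qed

text \<open>Only the last frame vector in the expansion lies outside the tangent space of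
  \<open>S\<close>. Its cofactor keeps exactly the columns 1, ..., s, so for every \<open>j\<close>
  it is, up to sign, the determinant of the shape operator in the frame.\<close>

lemma ruling_field_inner_frame:
  assumes E: "adapted_orthonormal_frame m s S D R E" and q: "q \<in> R" and sm: "s \<le> m"
    and j: "j \<in> {1..m - s}" "j' \<in> {1..m - s}"
  shows "ruling_field s S D N E j q \<bullet> E (s + j') q = (if j = j' then (-1) ^ Suc s *
     (\<Sum>p | p permutes {1..s}. of_int (sign p) * (\<Prod>l\<in>{1..s}. phi_coeff S D N E q l (p l))) else 0)"
proof -
  note fr = adapted_frame[OF E q]
  have j1: "1 \<le> j" using j by simp
  let ?e = "\<lambda>t. if t \<le> s then t else s + j"
  let ?T = "\<lambda>t. \<Sum>p | p permutes {1..s}. of_int (sign p) * (\<Prod>l\<in>{1..s}. phi_coeff S D N E q l (?e (rot t (Suc s) (p l))))"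
  have "ruling_field s S D N E j q \<bullet> E (s + j') q = (\<Sum>t\<in>{1..Suc s}. ((-1) ^ t * ?T t) * (E (?e t) q \<bullet> E (s + j') q))"
    unfolding ruling_field_expansion[OF j1] inner_sum_left inner_scaleR_left ..
  also have "\<dots> = (\<Sum>t\<in>{1..Suc s}. if t = Suc s then (if j = j' then (-1) ^ t * ?T t else 0) else 0)"
  proof (rule sum.cong[OF refl])
    fix t assume t: "t \<in> {1..Suc s}"
    have "E (?e t) q \<bullet> E (s + j') q = (if ?e t = s + j' then 1 else 0)"
      by (rule fr(3)) (use t j sm in \<open>auto simp: le_Suc_eq\<close>)
    then show "((-1) ^ t * ?T t) * (E (?e t) q \<bullet> E (s + j') q) =
       (if t = Suc s then (if j = j' then (-1) ^ t * ?T t else 0) else 0)"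
      using t j by (cases "t = Suc s") auto
  qed
  also have "\<dots> = (if j = j' then (-1) ^ Suc s * ?T (Suc s) else 0)" by simp
  also have "?T (Suc s) = (\<Sum>p | p permutes {1..s}. of_int (sign p) * (\<Prod>l\<in>{1..s}. phi_coeff S D N E q l (p l)))"
  proof (intro sum.cong prod.cong refl arg_cong2[of _ _ _ _ "(*)"])
    fix p l assume "p \<in> {p. p permutes {1..s}}" "l \<in> {1..s}"
    then have "p l \<in> {1..s}" by (simp only: mem_Collect_eq permutes_in_image)
    then show "phi_coeff S D N E q l (?e (rot (Suc s) (Suc s) (p l))) = phi_coeff S D N E q l (p l)"
      by (auto simp: rot_def)
  qed
  finally show ?thesis .
qed

text \<open>Pairing with \<open>E (s + j') q\<close> isolates the coefficient \<open>b j'\<close>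
  times a nonzero determinant.\<close>

lemma ruling_fields_independent:
  assumes E: "adapted_orthonormal_frame m s S D R E" and q: "q \<in> R" "q \<in> S" and sm: "s \<le> m"
    and card: "CARD('s::finite) = s"
    and z: "(\<Sum>j\<in>{1..m - s}. b j *\<^sub>R ruling_field s S D N E j q) = 0" and j': "j' \<in> {1..m - s}"
  shows "b j' = 0"
proof -
  let ?d = "\<Sum>p | p permutes {1..s}. of_int (sign p) * (\<Prod>l\<in>{1..s}. phi_coeff S D N E q l (p l))"
  have d: "?d \<noteq> 0"
    by (rule alternating_sum_nonzero[OF card]) (use phi_coeff_nonsingular[OF E q sm] in blast)
  have "0 = (\<Sum>j\<in>{1..m - s}. b j *\<^sub>R ruling_field s S D N E j q) \<bullet> E (s + j') q" using z by simp
  also have "\<dots> = (\<Sum>j\<in>{1..m - s}. b j * (if j = j' then (-1) ^ Suc s * ?d else 0))"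
    unfolding inner_sum_left inner_scaleR_left
    by (intro sum.cong refl arg_cong2[of _ _ _ _ "(*)"] ruling_field_inner_frame[OF E q(1) sm _ j'])
  also have "\<dots> = b j' * ((-1) ^ Suc s * ?d)" using j' by (simp add: if_distrib sum.delta cong: if_cong)
  finally show ?thesis using d by simp
qed

lemma smooth_on_phi_coeff:
  fixes \<xi> :: "'b::euclidean_space \<Rightarrow> 'a"
  assumes A: "open A" "smooth_on A \<xi>" "\<xi> ` A \<subseteq> S" and E: "adapted_orthonormal_frame m s S D (\<xi> ` A) E" and sm: "s \<le> m"
    and l: "l \<in> {1..s}" and k: "k \<in> {1..m}"
  shows "smooth_on A (\<lambda>a. phi_coeff S D N E (\<xi> a) l k)"
proof (rule smooth_on_locally)
  fix a assume a: "a \<in> A"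
  have smE: "smooth_on A (\<lambda>a. E i (\<xi> a))" if "i \<in> {1..m}" for i
    using E that by (intro smooth_on_along_compose[OF A(1,2) subset_refl]) (auto simp: adapted_orthonormal_frame_def)
  obtain U n where U: "open U" "\<xi> a \<in> U" and n: "smooth_on U n" "\<And>q. q \<in> S \<inter> U \<Longrightarrow> N q = n q"
    using smooth_alongE[OF smooth_along_N, of "\<xi> a"] A(3) a by blast
  let ?V = "A \<inter> \<xi> -` U"
  have V: "open ?V" by (rule continuous_open_preimage[OF smooth_on_continuous_on[OF A(2)] A(1) U(1)])
  have sE: "smooth_on ?V (\<lambda>a. E i (\<xi> a))" if "i \<in> {1..m}" for i
    by (rule smooth_on_subset[OF _ smE[OF that]]) auto
  have sme: "smooth_on ?V (\<lambda>a. frechet_derivative n (at (\<xi> a)) e)" for e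
    by (rule smooth_on_compose[OF V U(1) smooth_on_subset[OF _ A(2)] smooth_on_derivative_const[OF n(1)]]) auto
  have "smooth_on ?V (\<lambda>a. frechet_derivative n (at (\<xi> a)) (E l (\<xi> a)))"
    by (rule smooth_on_linear_family[OF V _ sme sE]) (use smooth_on_linear_derivative[OF n(1)] l sm in auto)
  then have "smooth_on ?V (\<lambda>a. frechet_derivative n (at (\<xi> a)) (E l (\<xi> a)) \<bullet> E k (\<xi> a))"
    by (intro smooth_on_inner V sE k)
  then have "smooth_on ?V (\<lambda>a. phi_coeff S D N E (\<xi> a) l k)"
  proof (rule smooth_on_cong_imp[OF V, rotated])
    fix b assume b: "b \<in> ?V"
    let ?q = "\<xi> b"
    have q: "?q \<in> S" "?q \<in> \<xi> ` A" "?q \<in> U" using b A(3) by auto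
    note fr = adapted_frame[OF E q(2)]
    have "\<phi> ?q (E l ?q) (n ?q) = orth_proj (D ?q) (frechet_derivative n (at ?q) (E l ?q))"
      by (rule phi_smooth_section[OF q(1) U(1) q(3) n(1) _ fr(2)[OF l]]) (use n(2) N_normal in \<open>auto simp flip: n(2)\<close>)
    then show "frechet_derivative n (at ?q) (E l ?q) \<bullet> E k ?q = phi_coeff S D N E ?q l k"
      using orth_proj_inner[OF subspace_D[OF q(1)] fr(1)[OF k]] n(2)[of ?q] q by (simp add: phi_coeff_def)
  qed
  then show "\<exists>V. open V \<and> a \<in> V \<and> smooth_on V (\<lambda>a. phi_coeff S D N E (\<xi> a) l k)" using V a U(2) by blast
qed

lemma smooth_on_ruling_field:
  fixes \<xi> :: "'b::euclidean_space \<Rightarrow> 'a"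
  assumes A: "open A" "smooth_on A \<xi>" "\<xi> ` A \<subseteq> S" and E: "adapted_orthonormal_frame m s S D (\<xi> ` A) E" and sm: "s \<le> m"
    and j: "j \<in> {1..m - s}"
  shows "smooth_on A (\<lambda>a. ruling_field s S D N E j (\<xi> a))"
proof -
  have j1: "1 \<le> j" using j by simp
  let ?e = "\<lambda>t. if t \<le> s then t else s + j"
  have smE: "smooth_on A (\<lambda>a. E i (\<xi> a))" if "i \<in> {1..m}" for i
    using E that by (intro smooth_on_along_compose[OF A(1,2) subset_refl]) (auto simp: adapted_orthonormal_frame_def)
  have e: "?e t \<in> {1..m}" if "t \<in> {1..Suc s}" for t using that j sm by auto
  show ?thesis
    unfolding ruling_field_expansion[OF j1]
  proof (intro smooth_on_sum smooth_on_scaleR smooth_on_mult smooth_on_prod smooth_on_const A(1))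
    fix t assume t: "t \<in> {1..Suc s}"
    show "smooth_on A (\<lambda>a. E (?e t) (\<xi> a))" by (rule smE[OF e[OF t]])
    fix p l assume p: "p \<in> {p. p permutes {1..s}}" and l: "l \<in> {1..s}"
    have "p l \<in> {1..s}" using p l by (simp only: mem_Collect_eq permutes_in_image)
    then have "rot t (Suc s) (p l) \<in> {1..Suc s}" using t by (auto simp: rot_def)
    then show "smooth_on A (\<lambda>a. phi_coeff S D N E (\<xi> a) l (?e (rot t (Suc s) (p l))))"
      by (intro smooth_on_phi_coeff[OF A E sm l] e)
  qed
qed

end

context solvable_cauchy_data
begin

text \<open>Cofactor orthogonality is orthogonality to each \<open>\<phi> q (E l q) (N q)\<close>;
  by the solvability condition these vectors span all of \<open>Im\<phi> q\<close>.\<close>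

lemma ruling_field_in_Rul:
  assumes E: "adapted_orthonormal_frame m s S D R E" and q: "q \<in> R" "q \<in> S" and sm: "s \<le> m"
    and j: "j \<in> {1..m - s}"
  shows "ruling_field s S D N E j q \<in> Rul q"
proof -
  note fr = adapted_frame[OF E q(1)]
  let ?X = "ruling_field s S D N E j q"
  let ?e = "\<lambda>t. if t \<le> s then t else s + j"
  have j1: "1 \<le> j" using j by simp
  have e: "?e t \<in> {1..m}" if "t \<in> {1..Suc s}" for t using that j sm by auto
  have "?X \<in> D q"
    unfolding ruling_field_expansion[OF j1]
    by (intro subspace_sum subspace_scale subspace_D q(2) fr(1) e)
  obtain L where L: "linear L" "\<And>v. v \<in> TS q \<Longrightarrow> \<phi> q v (N q) = L v"
    using phi_linear_extension[OF q(2) N_normal[OF q(2)]] by blast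
  have "?X \<bullet> L u = 0" if "u \<in> span ((\<lambda>i. E i q) ` {1..s})" for u
  proof (rule span_induct[OF that])
    show "subspace {u. ?X \<bullet> L u = 0}"
      using linear_0[OF L(1)] linear_add[OF L(1)] linear_scale[OF L(1)] by (simp add: subspace_def inner_add_right)
    fix u assume "u \<in> (\<lambda>i. E i q) ` {1..s}"
    then obtain l where l: "l \<in> {1..s}" "u = E l q" by blast
    have "E (?e t) q \<bullet> L u = phi_coeff S D N E q l (?e t)" for t
      using L(2)[OF fr(2)[OF l(1)]] by (simp add: phi_coeff_def l(2) inner_commute)
    then show "?X \<bullet> L u = 0"
      unfolding ruling_field_expansion[OF j1] inner_sum_left inner_scaleR_left
      by (simp only:) (rule cofactor_orthogonality[OF l(1), of "phi_coeff S D N E q" ?e])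
  qed
  then have "?X \<bullet> w = 0" if "w \<in> Im\<phi> q" for w
    using that fr(4) L(2) by (auto simp: Im\<phi>_eq[OF q(2)] K\<phi>_def)
  then show ?thesis using \<open>?X \<in> D q\<close> by (simp add: Rul_def orthogonal_comp_iff)
qed

text \<open>Near the zero section \<sigma> has rulings as values, and the foot point map recovers
  the base parameter. This gives injectivity and, after differentiation, the immersion property;
  invariance of domain gives openness in \<open>M\<close>.\<close>

lemma solution_parametrization:
  fixes A :: "(real ^ 's::finite) set" and \<xi> :: "real ^ 's \<Rightarrow> 'a" and \<iota> :: "nat \<Rightarrow> 'k::finite"
  assumes sol: "cauchy_solution m s S D M" and par: "local_parametrization A \<xi> S"
    and E: "adapted_orthonormal_frame m s S D (\<xi> ` A) E" and sm: "s \<le> m"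
    and card: "CARD('s) = s" "CARD('k) = m - s" and \<iota>: "bij_betw \<iota> {1..m - s} (UNIV :: 'k set)"
  defines "\<sigma> \<equiv> (\<lambda>(a, b :: real ^ 'k). \<xi> a + (\<Sum>j = 1..m - s. (b $ \<iota> j) *\<^sub>R ruling_field s S D N E j (\<xi> a)))"
  shows "\<exists>W. open W \<and> W \<subseteq> A \<times> UNIV \<and> (\<forall>a\<in>A. (a, 0) \<in> W) \<and> local_parametrization W \<sigma> M"
proof -
  have M: "embedded_submanifold m M" using sol by (auto simp: cauchy_solution_def rank_submanifold_def)
  have A: "open A" "smooth_on A \<xi>" "\<And>a. a \<in> A \<Longrightarrow> inj (frechet_derivative \<xi> (at a))" "\<xi> ` A \<subseteq> S"
    using par by (auto simp: local_parametrization_def)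
  have inj\<xi>: "inj_on \<xi> A" using par by (auto simp: local_parametrization_def homeomorphism_def intro: inj_on_inverseI)
  define Y where "Y z = (\<Sum>j = 1..m - s. (snd z $ \<iota> j) *\<^sub>R ruling_field s S D N E j (\<xi> (fst z)))" for z :: "(real ^ 's) \<times> (real ^ 'k)"
  have \<sigma>: "\<sigma> z = \<xi> (fst z) + Y z" for z by (simp add: \<sigma>_def Y_def case_prod_unfold)
  let ?AU = "A \<times> (UNIV :: (real ^ 'k) set)"
  have oAU: "open ?AU" using A(1) by (intro open_Times) auto
  have Y_R: "Y z \<in> Rul (\<xi> (fst z))" if "z \<in> ?AU" for z
    unfolding Y_def using that A(4)
    by (intro subspace_sum subspace_scale subspace_Rul ruling_field_in_Rul[OF E _ _ sm]) auto
  have sm_fst: "smooth_on ?AU (\<lambda>z. f (fst z))" if "smooth_on A f" for f :: "real ^ 's \<Rightarrow> 'a"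
    by (rule smooth_on_compose[OF oAU A(1) smooth_on_bounded_linear_comp[OF bounded_linear_fst oAU smooth_on_id[OF oAU]] that]) auto
  have smY: "smooth_on ?AU Y"
    unfolding Y_def
  proof (intro smooth_on_sum smooth_on_scaleR oAU)
    fix j assume j: "j \<in> {1..m - s}"
    have "bounded_linear (\<lambda>z :: (real ^ 's) \<times> (real ^ 'k). snd z $ \<iota> j)"
      by (rule bounded_linear_compose[OF bounded_linear_vec_nth bounded_linear_snd])
    from smooth_on_bounded_linear_comp[OF this oAU smooth_on_id[OF oAU]]
    show "smooth_on ?AU (\<lambda>z. snd z $ \<iota> j)" .
    show "smooth_on ?AU (\<lambda>z. ruling_field s S D N E j (\<xi> (fst z)))"
      by (rule sm_fst[OF smooth_on_ruling_field[OF A(1,2,4) E sm j]])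
  qed
  have sm\<xi>: "smooth_on ?AU (\<lambda>z. \<xi> (fst z))" by (rule sm_fst[OF A(2)])
  have sm\<sigma>: "smooth_on ?AU \<sigma>"
    using smooth_on_cong_imp[OF oAU _ smooth_on_add[OF oAU sm\<xi> smY], of \<sigma>] \<sigma> by simp
  have Y_inj: "b = b'" if a: "a \<in> A" and eq: "Y (a, b) = Y (a, b')" for a b b'
  proof -
    have "(\<Sum>j\<in>{1..m - s}. (b $ \<iota> j - b' $ \<iota> j) *\<^sub>R ruling_field s S D N E j (\<xi> a)) = 0"
      using eq by (simp add: Y_def scaleR_diff_left sum_subtractf)
    then have "b $ \<iota> j - b' $ \<iota> j = 0" if "j \<in> {1..m - s}" for j
      using ruling_fields_independent[OF E _ _ sm card(1), of "\<xi> a" "\<lambda>j. b $ \<iota> j - b' $ \<iota> j"] a A(4) that by blast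
    then have "b $ i = b' $ i" for i
      using \<iota> by (metis UNIV_I bij_betw_imp_surj_on eq_iff_diff_eq_0 imageE)
    then show ?thesis by (simp add: vec_eq_iff)
  qed
  have "\<forall>p\<in>S. \<exists>\<delta>>0. \<forall>q\<in>S. \<forall>x\<in>Rul q. dist q p < \<delta> \<and> norm x < \<delta> \<longrightarrow> q + x \<in> M"
    using solution_contains_rulings[OF sol] by blast
  then obtain \<delta> where \<delta>: "\<And>p. p \<in> S \<Longrightarrow> 0 < \<delta> p"
    "\<And>p q x. p \<in> S \<Longrightarrow> q \<in> S \<Longrightarrow> x \<in> Rul q \<Longrightarrow> dist q p < \<delta> p \<and> norm x < \<delta> p \<Longrightarrow> q + x \<in> M"
    by metis
  \<comment> \<open>One radius for two purposes: below \<open>\<delta>\<close> the rulings stay in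
    \<open>M\<close>, and as a foot radius it makes foot points unique.\<close>
  obtain e where e: "foot_radius e" "\<And>p. p \<in> S \<Longrightarrow> e p \<le> \<delta> p" using foot_radius_exists[of \<delta>] \<delta>(1) by metis
  have epos: "0 < e p" if "p \<in> S" for p using e(1) that foot_chartD(1) unfolding foot_radius_def by blast
  define O' where "O' p r = (?AU \<inter> (\<lambda>z. dist (\<xi> (fst z)) p) -` {..<r}) \<inter> (?AU \<inter> (\<lambda>z. norm (Y z)) -` {..<r})" for p and r :: real
  have oO: "open (O' p r)" for p r
    unfolding O'_def
    by (intro open_Int continuous_open_preimage[OF _ oAU open_lessThan] continuous_on_dist continuous_on_norm
        continuous_on_const smooth_on_continuous_on[OF sm\<xi>] smooth_on_continuous_on[OF smY])
  \<comment> \<open>The eighth is that of \<open>near\<close>, so injectivity holds across different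
    boxes.\<close>
  define W where "W = (\<Union>p\<in>S. O' p (e p / 8))"
  have oW: "open W" unfolding W_def using oO by blast
  have WA: "W \<subseteq> ?AU" by (auto simp: W_def O'_def)
  have W_near: "\<exists>p\<in>S. near e p (\<xi> (fst z)) (Y z)" if "z \<in> W" for z
    using that by (auto simp: W_def O'_def near_def)
  have zero: "(a, 0) \<in> W" if "a \<in> A" for a
    using that A(4) epos[of "\<xi> a"] by (auto simp: W_def O'_def Y_def intro!: bexI[of _ "\<xi> a"])
  have fst_A: "fst z \<in> A" if "z \<in> W" for z using that WA by auto
  have \<xi>S: "\<xi> (fst z) \<in> S" if "z \<in> W" for z using fst_A[OF that] A(4) by blast
  have W_M: "\<sigma> ` W \<subseteq> M"
  proof
    fix y assume "y \<in> \<sigma> ` W"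
    then obtain z where z: "z \<in> W" "y = \<sigma> z" by blast
    obtain p where p: "p \<in> S" "near e p (\<xi> (fst z)) (Y z)" using W_near[OF z(1)] by blast
    have "\<xi> (fst z) + Y z \<in> M"
      using \<delta>(2)[OF p(1) \<xi>S[OF z(1)] Y_R] z(1) WA p e(2)[OF p(1)] epos[OF p(1)] by (auto simp: near_def)
    then show "y \<in> M" using z(2) \<sigma> by simp
  qed
  have inj: "inj_on \<sigma> W"
  proof (rule inj_onI)
    fix z z' assume z: "z \<in> W" "z' \<in> W" "\<sigma> z = \<sigma> z'"
    obtain p p' where p: "p \<in> S" "near e p (\<xi> (fst z)) (Y z)" "p' \<in> S" "near e p' (\<xi> (fst z')) (Y z')"
      using W_near z(1,2) by meson
    have "Y z \<in> Rul (\<xi> (fst z))" "Y z' \<in> Rul (\<xi> (fst z'))" using Y_R z WA by blast+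
    then have "\<xi> (fst z) = \<xi> (fst z')"
      using near_injective[OF e(1) p(1,3) \<xi>S[OF z(1)] \<xi>S[OF z(2)] Rul_perp Rul_perp p(2,4)] z(3) \<sigma> by simp
    then have f: "fst z = fst z'" using inj_onD[OF inj\<xi>] fst_A z(1,2) by blast
    have "Y z = Y z'" using f z(3) \<sigma>[of z] \<sigma>[of z'] by simp
    moreover have "z = (fst z, snd z)" "z' = (fst z, snd z')" using f by (simp_all add: prod_eq_iff)
    ultimately have "Y (fst z, snd z) = Y (fst z, snd z')" by metis
    then have "snd z = snd z'" using Y_inj[OF fst_A[OF z(1)]] by blast
    then show "z = z'" using f by (simp add: prod_eq_iff)
  qed
  have DIM: "dim (UNIV :: ((real ^ 's) \<times> (real ^ 'k)) set) = m" using card sm by simp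
  have cont: "continuous_on W \<sigma>" using smooth_on_continuous_on[OF smooth_on_subset[OF WA sm\<sigma>]] .
  have open_image: "openin (top_of_set M) (\<sigma> ` X)" if "open X" "X \<subseteq> W" for X
  proof (rule open_image_in_submanifold[OF M subspace_UNIV DIM])
    show "openin (top_of_set UNIV) X" using that(1) by (simp add: open_openin[symmetric])
    show "continuous_on X \<sigma>" using cont that(2) by (rule continuous_on_subset)
    show "\<sigma> ` X \<subseteq> M" using W_M that(2) by blast
    show "inj_on \<sigma> X" using inj that(2) by (rule inj_on_subset)
  qed
  have "\<exists>\<eta>. homeomorphism W (\<sigma> ` W) \<sigma> \<eta>"
  proof -
    have "openin (top_of_set (\<sigma> ` W)) (\<sigma> ` X)" if "openin (top_of_set W) X" for X
    proof -
      have "open X" "X \<subseteq> W" using that oW openin_open_eq by auto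
      then have "openin (top_of_set M) (\<sigma> ` X)" by (rule open_image)
      then show ?thesis using openin_subset_trans W_M \<open>X \<subseteq> W\<close> image_mono by metis
    qed
    then show ?thesis using homeomorphism_injective_open_map[OF cont refl inj] by metis
  qed
  moreover have "inj (frechet_derivative \<sigma> (at z))" if z: "z \<in> W" for z
  proof -
    let ?D = "frechet_derivative \<sigma> (at z)"
    have zAU: "z \<in> ?AU" and a: "fst z \<in> A" using z WA by auto
    have d\<sigma>: "(\<sigma> has_derivative ?D) (at z)" using smooth_on_has_derivative[OF sm\<sigma> zAU] .
    have lin: "linear ?D" using has_derivative_linear[OF d\<sigma>] .
    obtain p where p: "p \<in> S" "near e p (\<xi> (fst z)) (Y z)" using W_near[OF z] by blast
    obtain U V \<alpha> \<kappa> \<Psi> where f: "foot_chart p (e p) U V \<alpha> \<kappa> \<Psi>" using e(1) p(1) unfolding foot_radius_def by blast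
    note F = foot_chartD[OF f]
    \<comment> \<open>The full radius \<open>e p\<close> provides an open set around
      \<open>z\<close> on which the foot point of \<open>\<sigma> w\<close> is
      \<open>\<xi> (fst w)\<close>, an identity that can be differentiated.\<close>
    have on_O: "\<sigma> w \<in> U \<and> \<alpha> (\<sigma> w) = \<xi> (fst w)" if "w \<in> O' p (e p)" for w
      using F(15)[OF _ Rul_perp[OF Y_R], of w] that A(4) \<sigma>[of w] by (auto simp: O'_def)
    have zO: "z \<in> O' p (e p)" using p(2) zAU F(1) by (auto simp: O'_def near_def)
    have d\<alpha>: "(\<alpha> has_derivative frechet_derivative \<alpha> (at (\<sigma> z))) (at (\<sigma> z))"
      using smooth_on_has_derivative[OF F(11)] on_O[OF zO] by blast
    have "((\<lambda>w. \<alpha> (\<sigma> w)) has_derivative (\<lambda>v. frechet_derivative \<alpha> (at (\<sigma> z)) (?D v))) (at z)"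
      using has_derivative_compose[OF d\<sigma> d\<alpha>] .
    then have 1: "((\<lambda>w. \<xi> (fst w)) has_derivative (\<lambda>v. frechet_derivative \<alpha> (at (\<sigma> z)) (?D v))) (at z)"
      by (rule has_derivative_transform_within_open[OF _ oO zO]) (use on_O in blast)
    have 2: "((\<lambda>w. \<xi> (fst w)) has_derivative (\<lambda>v. frechet_derivative \<xi> (at (fst z)) (fst v))) (at z)"
      using has_derivative_compose[OF bounded_linear_imp_has_derivative[OF bounded_linear_fst] smooth_on_has_derivative[OF A(2) a]] .
    have fstD: "frechet_derivative \<alpha> (at (\<sigma> z)) (?D v) = frechet_derivative \<xi> (at (fst z)) (fst v)" for v
      using has_derivative_unique[OF 1 2] by metis
    show ?thesis
    proof (rule linear_injective_0[OF lin, THEN iffD2], intro allI impI)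
      fix v assume v: "?D v = 0"
      have "frechet_derivative \<xi> (at (fst z)) (fst v) = 0"
        using fstD[of v] v linear_0[OF has_derivative_linear[OF d\<alpha>]] by simp
      moreover have "frechet_derivative \<xi> (at (fst z)) 0 = 0"
        using linear_0[OF smooth_on_linear_derivative[OF A(2) a]] .
      ultimately have v1: "fst v = 0" using A(3)[OF a] by (metis injD)
      have "((\<lambda>t. \<sigma> (z + t *\<^sub>R v)) has_vector_derivative ?D v) (at 0)"
        using has_derivative_along_line[of \<sigma> ?D z 0 v] d\<sigma> by simp
      \<comment> \<open>Once \<open>fst v = 0\<close>, the map is affine on the line through
        \<open>z\<close>, and its derivative is the combination of the ruling fields with
        coefficients \<open>snd v\<close>.\<close>
      moreover have "\<sigma> (z + t *\<^sub>R v) = \<sigma> z + t *\<^sub>R Y (fst z, snd v)" for t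
        by (simp add: \<sigma> Y_def v1 scaleR_add_left sum.distrib scaleR_sum_right)
      ultimately have "((\<lambda>t. \<sigma> z + t *\<^sub>R Y (fst z, snd v)) has_vector_derivative ?D v) (at 0)" by simp
      then have "Y (fst z, snd v) = ?D v" using line_has_vector_derivative vector_derivative_unique_at by blast
      then have "Y (fst z, snd v) = Y (fst z, 0)" using v by (simp add: Y_def)
      then have "snd v = 0" by (rule Y_inj[OF a])
      then show "v = 0" using v1 by (simp add: prod_eq_iff)
    qed
  qed
  moreover have "smooth_on W \<sigma>" using smooth_on_subset[OF WA sm\<sigma>] .
  ultimately have "local_parametrization W \<sigma> M"
    unfolding local_parametrization_def using oW W_M open_image[OF oW subset_refl] by blast
  then show ?thesis using oW WA zero by blast
qed

end

text \<open>The types \<open>'s\<close> and \<open>'k\<close> are index types through which the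
  parameter spaces of dimensions \<open>s\<close> and \<open>m - s\<close> exist as types;
  \<open>\<iota>\<close> numbers the fibre coordinates. In the last part \<open>W\<close> contains
  the whole zero section over \<open>A\<close>, which makes "b near 0" precise with a bound that may
  vary with \<open>a\<close>.\<close>

theorem theorem1p2:
  fixes m s c :: nat
    and S :: "(real ^ 'n) set"
    and D :: "real ^ 'n \<Rightarrow> (real ^ 'n) set"
    and N :: "real ^ 'n \<Rightarrow> real ^ 'n"
  assumes "1 \<le> s" and "s < m" and "1 \<le> c" and "CARD('n) = m + c"
    and "embedded_submanifold s S" and "connected S"
    and "smooth_distribution m S D" and "\<forall>p\<in>S. tangent_space S p \<subseteq> D p"
    and "smooth_section S (normal_distribution D) N"
    and "\<forall>p\<in>S. dim (shape_operator S D N p ` tangent_space S p) = s"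
    and "CARD('s::finite) = s" and "CARD('k::finite) = m - s"
  shows "((\<exists>M. cauchy_solution m s S D M) \<longleftrightarrow>
           (\<forall>p\<in>S. {phi S D p v (N p) | v. v \<in> tangent_space S p} = phi_image S D p)) \<and>
         (\<forall>M\<^sub>1 M\<^sub>2. cauchy_solution m s S D M\<^sub>1 \<and> cauchy_solution m s S D M\<^sub>2 \<longrightarrow>
           (\<exists>U W. open U \<and> S \<subseteq> U \<and> M\<^sub>1 \<inter> U = M\<^sub>2 \<inter> U \<and>
              zero_section_nhd S D W \<and> M\<^sub>1 \<inter> U = (\<lambda>(p, x). p + x) ` W)) \<and>
         (\<forall>M (A :: (real ^ 's) set) \<xi> E (\<iota> :: nat \<Rightarrow> 'k).
           cauchy_solution m s S D M \<and> local_parametrization A \<xi> S \<and>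
           adapted_orthonormal_frame m s S D (\<xi> ` A) E \<and> bij_betw \<iota> {1..m - s} UNIV \<longrightarrow>
             (\<forall>q\<in>\<xi> ` A. \<forall>i\<in>{1..s}. \<forall>k\<in>{1..m}.
                phi_coeff S D N E q i k = nabla S N q (E i q) \<bullet> E k q) \<and>
             (\<exists>W. open W \<and> W \<subseteq> A \<times> UNIV \<and> (\<forall>a\<in>A. (a, 0) \<in> W) \<and>
                local_parametrization W
                  (\<lambda>(a, b :: real ^ 'k). \<xi> a + (\<Sum>j = 1..m - s. (b $ \<iota> j) *\<^sub>R ruling_field s S D N E j (\<xi> a)))
                  M))"
proof -
  interpret cauchy_data m s S D N
    by unfold_locales (use assms in auto)
  have sm: "s \<le> m" using assms(2) by simp
  show ?thesis
  proof (intro conjI allI impI ballI iffI)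
    fix p assume "\<exists>M. cauchy_solution m s S D M" "p \<in> S"
    then show "{phi S D p v (N p) | v. v \<in> tangent_space S p} = phi_image S D p"
      using solution_imp_solvable solvable_cauchy_data.cond by blast
  next
    assume "\<forall>p\<in>S. {phi S D p v (N p) | v. v \<in> tangent_space S p} = phi_image S D p"
    then interpret s: solvable_cauchy_data m s S D N by unfold_locales blast
    obtain e where "s.foot_radius e" by (rule s.foot_radius_exists[of "\<lambda>_. 1"]) (simp, erule that)
    then show "\<exists>M. cauchy_solution m s S D M" using s.cauchy_solution_ruled by blast
  next
    fix M\<^sub>1 M\<^sub>2 assume M: "cauchy_solution m s S D M\<^sub>1 \<and> cauchy_solution m s S D M\<^sub>2"
    then interpret s: solvable_cauchy_data m s S D N using solution_imp_solvable by blast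
    show "\<exists>U W. open U \<and> S \<subseteq> U \<and> M\<^sub>1 \<inter> U = M\<^sub>2 \<inter> U \<and> zero_section_nhd S D W \<and> M\<^sub>1 \<inter> U = (\<lambda>(p, x). p + x) ` W"
      using s.solutions_coincide M by blast
  next
    fix M A \<xi> E \<iota> q i k
    assume *: "cauchy_solution m s S D M \<and> local_parametrization (A :: (real ^ 's) set) \<xi> S \<and>
      adapted_orthonormal_frame m s S D (\<xi> ` A) E \<and> bij_betw \<iota> {1..m - s} (UNIV :: 'k set)"
      and q: "q \<in> \<xi> ` A" and ik: "i \<in> {1..s}" "k \<in> {1..m}"
    have "q \<in> S" using * q unfolding local_parametrization_def by blast
    then show "phi_coeff S D N E q i k = nabla S N q (E i q) \<bullet> E k q"
      using phi_coeff_eq_nabla[OF _ q _ ik] * by blast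
  next
    fix M A \<xi> E \<iota>
    assume *: "cauchy_solution m s S D M \<and> local_parametrization (A :: (real ^ 's) set) \<xi> S \<and>
      adapted_orthonormal_frame m s S D (\<xi> ` A) E \<and> bij_betw \<iota> {1..m - s} (UNIV :: 'k set)"
    then interpret s: solvable_cauchy_data m s S D N using solution_imp_solvable by blast
    show "\<exists>W. open W \<and> W \<subseteq> A \<times> UNIV \<and> (\<forall>a\<in>A. (a, 0) \<in> W) \<and>
        local_parametrization W
          (\<lambda>(a, b :: real ^ 'k). \<xi> a + (\<Sum>j = 1..m - s. (b $ \<iota> j) *\<^sub>R ruling_field s S D N E j (\<xi> a))) M"
      using s.solution_parametrization[OF _ _ _ sm assms(11,12)] * by blast
  qed
qed

end
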